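(* Let $E$ and $S$ be Polish spaces endowed with filtrations $(\mathcal{B}_t(E))_{t\in I}$, $(\mathcal{B}_t(S))_{t\in I}$ of their Borel sigma-fields indexed by a same totally ordered set $I$, and assume that $(\mathcal{B}_t(S))_{t\in I}$ is a regular filtration. Let $c:E\times S\to\mathbb{R}\cup\{+\infty\}$ be a non-negative lower semi-continuous map. Then for any $\eta\in\mathcal{P}_E$, $\nu\in\mathcal{P}_S$ we have $D^R_{\eta,\nu}=P_{\eta,\nu}$, where $$P_{\eta,\nu}:=\inf\left\{\int_{E\times S}c(x,y)\,d\gamma(x,y):\gamma\in\Pi_c(\eta,\nu)\right\}$$ and $$D^R_{\eta,\nu}:=\sup\left\{\int_S g(y)\,d\nu(y)\ :\ (g,h)\in C_b(S)\times\mathcal{H}_\eta,\ g(y)+h(x,y)\le c(x,y)\ \ \forall (x,y)\in E\times S\right\}.$$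
   Context: A filtration $(\mathcal{B}_t(E))_{t\in I}$ of $\mathcal{B}(E)$ is a family of sigma-fields with $\mathcal{B}_s(E)\subset\mathcal{B}_t(E)\subset\mathcal{B}(E)$ for $s\le t$ (similarly on $S$). $\mathcal{P}_Z$ is the set of Borel probabilities on a Polish space $Z$. For a sigma-field $\mathcal{G}\subset\mathcal{B}(E)$, $\mathcal{G}^\eta$ is its $\eta$-completion (generated by $\mathcal{G}$ and the $\eta$-negligible sets). $\Pi(\eta,\nu)$ is the set of Borel probabilities on $E\times S$ with marginals $\eta$ and $\nu$. Regular filtration: $(\mathcal{B}_t(S))_{t\in I}$ is regular if there is a family $(\rho_t)_{t\in I}$ of continuous maps $\rho_t:S\to S$ with $\mathcal{B}_t(S)=\rho_t^{-1}(\mathcal{B}(S))$ for all $t\in I$, $\rho_s\circ\rho_t=\rho_{\min(s,t)}$ for all $s,t\in I$, and $\rho_{t_f}=\mathrm{Id}_S$ for some $t_f\in I$. A kernel associated to $\gamma\in\Pi(\eta,\nu)$ is a map $\Theta_\gamma:E\times\mathcal{B}(S)\to\mathbb{R}$ with $\Theta^x_\gamma\in\mathcal{P}_S$ for all $x$, $x\mapsto\Theta^x_\gamma(B)$ Borel for all $B$, and $\gamma(A\times B)=\int_A\Theta^x_\gamma(B)\,d\eta(x)$ for all $A\in\mathcal{B}(E),B\in\mathcal{B}(S)$. For $t\in I$, $\mathcal{G}_t(\gamma)$ is the $\eta$-completion of the smallest sigma-field on $E$ making $x\mapsto\Theta^x_\gamma(C)$ measurable for every $C\in\mathcal{B}_t(S)$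 with $\nu(\partial C)=0$. Causal transference plans: $\Pi_c(\eta,\nu)=\{\gamma\in\Pi(\eta,\nu):\mathcal{G}_t(\gamma)\subset\mathcal{B}_t(E)^\eta\ \text{for all }t\in I\}$. Definition of $\mathcal{H}_\eta$: add a symbol $t_0\notin I$ with $\mathcal{B}_{t_0}(S)=\{\emptyset,S\}$, $\mathcal{B}_{t_0}(E)=\{\emptyset,E\}$. $\mathcal{H}_\eta$ is the set of Borel maps $h:E\times S\to\mathbb{R}$ of the form $h(x,y)=\sum_{i=1}^N g_i(x)1_{A_i}(y)$ with $N\in\mathbb{N}$, such that for some $t_1,\dots,t_N\in I\cup\{t_0\}$ and all $i=1,\dots,N$: $A_i\in\mathcal{B}_{t_i}(S)$; and $g_i:E\to\mathbb{R}$ is a bounded measurable map such that $g_i=X_i-E_\eta[X_i\mid\mathcal{B}_{t_i}(E)^\eta]$ $\eta$-a.s. for some $X_i\in L^\infty(\eta)$. *)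

theory Defs
  imports "HOL-Probability.Probability"
begin

definition borel_probs :: "'a::topological_space measure set" where
  "borel_probs = {\<mu>. sets \<mu> = sets borel \<and> prob_space \<mu>}"

text \<open>A sigma-field on the whole type is represented by its set of members.\<close>

definition borel_filtration :: "'i::linorder set \<Rightarrow> ('i \<Rightarrow> 'a::topological_space set set) \<Rightarrow> bool" where
  "borel_filtration I B \<longleftrightarrow>
     (\<forall>t\<in>I. sigma_algebra UNIV (B t) \<and> B t \<subseteq> sets borel) \<and>
     (\<forall>s\<in>I. \<forall>t\<in>I. s \<le> t \<longrightarrow> B s \<subseteq> B t)"

definition regular_filtration :: "'i::linorder set \<Rightarrow> ('i \<Rightarrow> 's::topological_space set set) \<Rightarrow> bool" where
  "regular_filtration I B \<longleftrightarrow>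
     (\<exists>\<rho> :: 'i \<Rightarrow> 's \<Rightarrow> 's.
        (\<forall>t\<in>I. continuous_on UNIV (\<rho> t) \<and> B t = {\<rho> t -` A | A. A \<in> sets borel}) \<and>
        (\<forall>s\<in>I. \<forall>t\<in>I. \<rho> s \<circ> \<rho> t = \<rho> (min s t)) \<and>
        (\<exists>tf\<in>I. \<rho> tf = id))"

text \<open>The sets in \<^term>\<open>null_sets (completion \<eta>)\<close> are exactly the (not necessarily Borel)
  subsets of \<^term>\<open>\<eta>\<close>-null Borel sets.\<close>

definition sigma_completion :: "'a measure \<Rightarrow> 'a set set \<Rightarrow> 'a set set" where
  "sigma_completion \<eta> G = sigma_sets UNIV (G \<union> null_sets (completion \<eta>))"

definition transference_plans ::
    "'e::topological_space measure \<Rightarrow> 's::topological_space measure \<Rightarrow> ('e \<times> 's) measure set" where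
  "transference_plans \<eta> \<nu> =
     {\<gamma> \<in> borel_probs. distr \<gamma> borel fst = \<eta> \<and> distr \<gamma> borel snd = \<nu>}"

definition is_kernel ::
    "'e::topological_space measure \<Rightarrow> ('e \<times> 's::topological_space) measure \<Rightarrow> ('e \<Rightarrow> 's measure) \<Rightarrow> bool" where
  "is_kernel \<eta> \<gamma> \<Theta> \<longleftrightarrow>
     (\<forall>x. \<Theta> x \<in> borel_probs) \<and>
     (\<forall>B\<in>sets borel. (\<lambda>x. measure (\<Theta> x) B) \<in> borel_measurable borel) \<and>
     (\<forall>A\<in>sets borel. \<forall>B\<in>sets borel.
        measure \<gamma> (A \<times> B) = (LINT x:A|\<eta>. measure (\<Theta> x) B))"

definition kernel_sigma ::
    "('i \<Rightarrow> 's::topological_space set set) \<Rightarrow> 'e measure \<Rightarrow> 's measure \<Rightarrow> ('e \<Rightarrow> 's measure) \<Rightarrow> 'i \<Rightarrow> 'e set set" where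
  "kernel_sigma BS \<eta> \<nu> \<Theta> t =
     sigma_completion \<eta>
       (sigma_sets UNIV
          {(\<lambda>x. measure (\<Theta> x) C) -` U | C U.
             C \<in> BS t \<and> measure \<nu> (frontier C) = 0 \<and> U \<in> sets (borel :: real measure)})"

text \<open>Two kernels of the same plan agree outside an \<^term>\<open>\<eta>\<close>-null set, so the completed
  sigma-fields do not depend on which kernel is chosen.\<close>

definition causal_plans ::
    "'i::linorder set \<Rightarrow> ('i \<Rightarrow> 'e::topological_space set set) \<Rightarrow> ('i \<Rightarrow> 's::topological_space set set)
     \<Rightarrow> 'e measure \<Rightarrow> 's measure \<Rightarrow> ('e \<times> 's) measure set" where
  "causal_plans I BE BS \<eta> \<nu> =
     {\<gamma> \<in> transference_plans \<eta> \<nu>.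
        \<exists>\<Theta>. is_kernel \<eta> \<gamma> \<Theta> \<and>
            (\<forall>t\<in>I. kernel_sigma BS \<eta> \<nu> \<Theta> t \<subseteq> sigma_completion \<eta> (BE t))}"

text \<open>The index \<^term>\<open>None\<close> plays the role of the extra symbol outside the index set,
  carrying the trivial sigma-field.\<close>

definition with_trivial :: "('i \<Rightarrow> 'a set set) \<Rightarrow> 'i option \<Rightarrow> 'a set set" where
  "with_trivial B t = (case t of None \<Rightarrow> {{}, UNIV} | Some s \<Rightarrow> B s)"

definition L_infty :: "'a measure \<Rightarrow> ('a \<Rightarrow> real) set" where
  "L_infty \<eta> = {X \<in> borel_measurable \<eta>. \<exists>K. AE x in \<eta>. \<bar>X x\<bar> \<le> K}"

text \<open>The conditioning sigma-field contains non-Borel sets in general, so the conditional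
  expectation is taken over \<^term>\<open>completion \<eta>\<close>.\<close>

definition H_maps ::
    "'i::linorder set \<Rightarrow> ('i \<Rightarrow> 'e::topological_space set set) \<Rightarrow> ('i \<Rightarrow> 's::topological_space set set)
     \<Rightarrow> 'e measure \<Rightarrow> ('e \<times> 's \<Rightarrow> real) set" where
  "H_maps I BE BS \<eta> =
     {h \<in> borel_measurable borel.
        \<exists>(N::nat) (g :: nat \<Rightarrow> 'e \<Rightarrow> real) (A :: nat \<Rightarrow> 's set) (t :: nat \<Rightarrow> 'i option).
          h = (\<lambda>(x, y). \<Sum>i=1..N. g i x * indicator (A i) y) \<and>
          (\<forall>i\<in>{1..N}.
             t i \<in> insert None (Some ` I) \<and>
             A i \<in> with_trivial BS (t i) \<and>
             g i \<in> borel_measurable borel \<and> bounded (range (g i)) \<and>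
             (\<exists>X\<in>L_infty \<eta>. AE x in \<eta>.
                g i x = X x - real_cond_exp (completion \<eta>)
                                (sigma UNIV (sigma_completion \<eta> (with_trivial BE (t i)))) X x))}"

definition lower_semicontinuous :: "('a::topological_space \<Rightarrow> ereal) \<Rightarrow> bool" where
  "lower_semicontinuous f \<longleftrightarrow> (\<forall>a. open {x. a < f x})"

definition primal_value ::
    "'i::linorder set \<Rightarrow> ('i \<Rightarrow> 'e::topological_space set set) \<Rightarrow> ('i \<Rightarrow> 's::topological_space set set)
     \<Rightarrow> ('e \<times> 's \<Rightarrow> ereal) \<Rightarrow> 'e measure \<Rightarrow> 's measure \<Rightarrow> ereal" where
  "primal_value I BE BS c \<eta> \<nu> =
     (INF \<gamma>\<in>causal_plans I BE BS \<eta> \<nu>. enn2ereal (\<integral>\<^sup>+ z. e2ennreal (c z) \<partial>\<gamma>))"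

definition dual_value ::
    "'i::linorder set \<Rightarrow> ('i \<Rightarrow> 'e::topological_space set set) \<Rightarrow> ('i \<Rightarrow> 's::topological_space set set)
     \<Rightarrow> ('e \<times> 's \<Rightarrow> ereal) \<Rightarrow> 'e measure \<Rightarrow> 's measure \<Rightarrow> ereal" where
  "dual_value I BE BS c \<eta> \<nu> =
     (SUP (g, h) \<in> {(g, h). g \<in> bcontfun \<and> h \<in> H_maps I BE BS \<eta> \<and>
                            (\<forall>x y. ereal (g y + h (x, y)) \<le> c (x, y))}.
        ereal (\<integral>y. g y \<partial>\<nu>))"

end

theory Submission
  imports Defs
begin

text \<open>Write \<open>D\<close> for the dual value, assumed finite. By Hahn-Banach, applied to the sublinear functional
  \<open>p f = inf {\<integral>g d\<nu> + l D | f \<le> g + h + l c, l \<ge> 0}\<close> on all bounded functions, there is a positive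
  linear \<open>L\<close> with \<open>L = \<integral>_ d\<nu>\<close> on \<open>C_b(S)\<close>, \<open>L = 0\<close> on \<open>H_\<eta>\<close> and \<open>L f \<le> D\<close> for \<open>f \<le> c\<close>. The term \<open>l c\<close>
  encodes the last bound directly, so that no compactness of the set of plans is needed. Testing
  against \<open>H_\<eta>\<close> shows that \<open>L\<close> has first marginal \<open>\<eta>\<close>, so \<open>A \<mapsto> L (1_A \<otimes> 1_B)\<close> has a density with respect to
  \<open>\<eta>\<close>. Coding the points of \<open>S\<close> by their membership in a countable base of \<open>\<nu>\<close>-continuity balls, these
  densities assemble into a kernel \<open>\<Theta>\<close>. The plan \<open>\<eta> \<otimes> \<Theta>\<close> agrees with \<open>L\<close> on \<open>\<nu>\<close>-continuity sets, hence is
  causal, and has cost at most \<open>D\<close>. For weak duality, regularity of the filtration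
  provides enough \<open>\<nu>\<close>-continuity sets to generate each \<open>\<B>_t(S)\<close>.\<close>

section \<open>Hahn-Banach for spaces of functions\<close>

text \<open>Maps in \<open>H_maps\<close> are in general discontinuous in both variables, so
  \<open>L\<close> has to live on all bounded functions, no Riesz representation is at hand, and
  countable additivity must be recovered separately in each variable. In x it comes from domination:
  \<Lambda>(A, B) \<le> \<eta>(A). In y it is available only on average, through \<nu>. For almost
  every x the densities prescribe consistent masses of the cells, hence a law on 0-1 sequences, but
  such a sequence need not be the code of any point of S. The average over \<eta> of these laws has
  the same cylinder masses as the law of codes under \<nu>, hence equals it, and is therefore
  carried by genuine codes. \<open>L\<close> and the plan may still differ on other Borel sets,
  which is harmless because the definition of causality tests \<nu>-continuity sets only.\<close>

definition sublinear_on :: "('a \<Rightarrow> real) set \<Rightarrow> (('a \<Rightarrow> real) \<Rightarrow> real) \<Rightarrow> bool" where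
  "sublinear_on V p \<longleftrightarrow>
     (\<forall>f\<in>V. \<forall>g\<in>V. p (\<lambda>x. f x + g x) \<le> p f + p g) \<and>
     (\<forall>f\<in>V. \<forall>a\<ge>0. p (\<lambda>x. a * f x) = a * p f)"

definition function_subspace :: "('a \<Rightarrow> real) set \<Rightarrow> bool" where
  "function_subspace V \<longleftrightarrow>
     (\<forall>f\<in>V. \<forall>g\<in>V. (\<lambda>x. f x + g x) \<in> V) \<and> (\<forall>f\<in>V. \<forall>a. (\<lambda>x. a * f x) \<in> V)"

text \<open>Only one half of homogeneity needs checking: applied to \<open>a * f\<close> with factor
  \<open>inverse a\<close> it yields the reverse inequality, and the factor 0 reduces to the value
  at zero.\<close>

lemma sublinear_onI:
  assumes "function_subspace V"
    and add: "\<And>f g. f \<in> V \<Longrightarrow> g \<in> V \<Longrightarrow> p (\<lambda>x. f x + g x) \<le> p f + p g"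
    and mult: "\<And>f a. f \<in> V \<Longrightarrow> a > 0 \<Longrightarrow> p (\<lambda>x. a * f x) \<le> a * p f"
    and zero: "\<And>f. f \<in> V \<Longrightarrow> p (\<lambda>x. 0) = 0"
  shows "sublinear_on V p"
proof -
  have "p (\<lambda>x. a * f x) = a * p f" if f: "f \<in> V" and a: "a \<ge> 0" for f a
  proof (cases "a = 0")
    case True
    then show ?thesis using zero[OF f] by simp
  next
    case False
    then have a: "a > 0" using a by simp
    have V: "(\<lambda>x. a * f x) \<in> V" using assms(1) f unfolding function_subspace_def by blast
    have "p (\<lambda>x. inverse a * (a * f x)) \<le> inverse a * p (\<lambda>x. a * f x)"
      by (rule mult[OF V]) (use a in simp)
    moreover have "(\<lambda>x. inverse a * (a * f x)) = f" using a by (auto simp: fun_eq_iff)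
    ultimately have "p f \<le> inverse a * p (\<lambda>x. a * f x)" by simp
    then have "a * p f \<le> p (\<lambda>x. a * f x)" using a by (simp add: field_simps)
    then show ?thesis using mult[OF f a] by simp
  qed
  then show ?thesis using add unfolding sublinear_on_def by blast
qed

text \<open>Subadditivity at f + (-f). In the Zorn argument it bounds all functionals of a chain
  from below by one number, so that their pointwise infimum is finite.\<close>

lemma sublinear_on_lower:
  assumes V: "function_subspace V" and p: "sublinear_on V p" and f: "f \<in> V"
  shows "- p (\<lambda>x. - f x) \<le> p f"
proof -
  have "(\<lambda>x. (-1) * f x) \<in> V" using V f unfolding function_subspace_def by blast
  then have nf: "(\<lambda>x. - f x) \<in> V" by simp
  have sub: "\<forall>f\<in>V. \<forall>g\<in>V. p (\<lambda>x. f x + g x) \<le> p f + p g"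
    using p unfolding sublinear_on_def by blast
  have "p (\<lambda>x. f x + - f x) \<le> p f + p (\<lambda>x. - f x)"
    by (rule sub[rule_format, OF f nf])
  moreover have "p (\<lambda>x. 0 * f x) = 0 * p f"
    using p f unfolding sublinear_on_def by blast
  ultimately show ?thesis by simp
qed

text \<open>A minimal sublinear functional below \<open>p\<close> is linear.\<close>

lemma sublinear_dominates_linear:
  assumes V: "function_subspace V" and p: "sublinear_on V p"
  shows "\<exists>L. (\<forall>f\<in>V. \<forall>g\<in>V. L (\<lambda>x. f x + g x) = L f + L g) \<and>
             (\<forall>f\<in>V. \<forall>a. L (\<lambda>x. a * f x) = a * L f) \<and> (\<forall>f\<in>V. L f \<le> p f)"
proof -
  have Va: "(\<lambda>x. f x + g x) \<in> V" if "f \<in> V" "g \<in> V" for f g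
    using V that unfolding function_subspace_def by blast
  have Vm: "(\<lambda>x. a * f x) \<in> V" if "f \<in> V" for f a
    using V that unfolding function_subspace_def by blast
  have Vn: "(\<lambda>x. - f x) \<in> V" if "f \<in> V" for f
    using Vm[OF that, of "-1"] by simp
  \<comment> \<open>Values off \<open>V\<close> are pinned to 0: sublinearity says nothing there,
    and an infimum over a chain could otherwise fail to exist.\<close>
  define SL where "SL = {q. sublinear_on V q \<and> (\<forall>f. f \<notin> V \<longrightarrow> q f = 0) \<and> (\<forall>f\<in>V. q f \<le> p f)}"
  \<comment> \<open>The order is reversed: \<open>P q q'\<close> puts \<open>q'\<close> below
    \<open>q\<close>, so the maximal element from Zorn's lemma is a minimal functional.\<close>
  define P where "P q q' \<longleftrightarrow> (\<forall>f. q' f \<le> q f)" for q q' :: "('a \<Rightarrow> real) \<Rightarrow> real"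
  have SLa: "q (\<lambda>x. f x + g x) \<le> q f + q g" if "q \<in> SL" "f \<in> V" "g \<in> V" for q f g
    using that unfolding SL_def sublinear_on_def by blast
  have SLm: "q (\<lambda>x. a * f x) = a * q f" if "q \<in> SL" "f \<in> V" "a \<ge> 0" for q f a
    using that unfolding SL_def sublinear_on_def by blast
  have SLz: "q (\<lambda>x. 0) = 0" if "q \<in> SL" "f \<in> V" for q f
    using SLm[OF that, of 0] by simp
  have SLl: "- q (\<lambda>x. - f x) \<le> q f" if "q \<in> SL" "f \<in> V" for q f
    using sublinear_on_lower[OF V _ that(2)] that(1) unfolding SL_def by blast
  have SLp: "q f \<le> p f" if "q \<in> SL" "f \<in> V" for q f
    using that unfolding SL_def by blast
  define p0 where "p0 f = (if f \<in> V then p f else 0)" for f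
  have p0: "p0 \<in> SL"
    using p Va Vm unfolding SL_def sublinear_on_def p0_def by auto
  have "\<exists>m\<in>SL. \<forall>q\<in>SL. P m q \<longrightarrow> q = m"
  proof (rule predicate_Zorn)
    show "partial_order_on SL (relation_of P SL)"
      unfolding partial_order_on_def preorder_on_def refl_on_def trans_def antisym_def
        relation_of_def P_def
      by (auto simp: fun_eq_iff intro: order.antisym order.trans)
  next
    fix C assume C: "C \<in> Chains (relation_of P SL)"
    show "\<exists>u\<in>SL. \<forall>a\<in>C. P a u"
    proof (cases "C = {}")
      case True
      then show ?thesis using p0 by blast
    next
      case False
      have CS: "q \<in> SL" if "q \<in> C" for q
        using C that unfolding Chains_def relation_of_def by auto
      have tot: "P q r \<or> P r q" if "q \<in> C" "r \<in> C" for q r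
        using C that unfolding Chains_def relation_of_def by auto
      define u where "u f = (INF q\<in>C. q f)" for f
      have bd: "bdd_below ((\<lambda>q. q f) ` C)" if "f \<in> V" for f
      proof (rule bdd_belowI2)
        fix q assume q: "q \<in> C"
        show "- p (\<lambda>x. - f x) \<le> q f"
          using SLl[OF CS[OF q] that] SLp[OF CS[OF q] Vn[OF that]] by simp
      qed
      have ule: "u f \<le> q f" if "q \<in> C" "f \<in> V" for q f
        unfolding u_def by (rule cINF_lower[OF bd[OF that(2)] that(1)])
      have uge: "b \<le> u f" if "\<And>q. q \<in> C \<Longrightarrow> b \<le> q f" for b f
        unfolding u_def by (rule cINF_greatest[OF False that])
      have "sublinear_on V u"
      proof (rule sublinear_onI[OF V])
        fix f g assume f: "f \<in> V" and g: "g \<in> V"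
        \<comment> \<open>Of two members of a chain the smaller one lies below both, so the infima
          may be taken separately in \<open>q\<close> and in \<open>r\<close>.\<close>
        have *: "u (\<lambda>x. f x + g x) \<le> q f + r g" if q: "q \<in> C" and r: "r \<in> C" for q r
        proof -
          obtain s where s: "s \<in> C" "s f \<le> q f" "s g \<le> r g"
            using tot[OF q r] q r unfolding P_def by blast
          have "u (\<lambda>x. f x + g x) \<le> s (\<lambda>x. f x + g x)" by (rule ule[OF s(1) Va[OF f g]])
          also have "\<dots> \<le> s f + s g" by (rule SLa[OF CS[OF s(1)] f g])
          finally show ?thesis using s by simp
        qed
        have "u (\<lambda>x. f x + g x) - q f \<le> u g" if "q \<in> C" for q
          by (rule uge) (use *[OF that] in \<open>simp add: algebra_simps\<close>)
        then have "u (\<lambda>x. f x + g x) - u g \<le> u f"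
          by (intro uge) (simp add: algebra_simps)
        then show "u (\<lambda>x. f x + g x) \<le> u f + u g" by simp
      next
        fix f and a :: real assume f: "f \<in> V" and a: "a > 0"
        have "u (\<lambda>x. a * f x) / a \<le> u f"
        proof (rule uge)
          fix q assume q: "q \<in> C"
          have "u (\<lambda>x. a * f x) \<le> a * q f"
            using ule[OF q Vm[OF f, of a]] SLm[OF CS[OF q] f, of a] a by simp
          then show "u (\<lambda>x. a * f x) / a \<le> q f" using a by (simp add: field_simps)
        qed
        then show "u (\<lambda>x. a * f x) \<le> a * u f" using a by (simp add: field_simps)
      next
        fix f assume f: "f \<in> V"
        have "(\<lambda>q. q (\<lambda>x. 0)) ` C = {0}" using SLz[OF CS f] False by force
        then show "u (\<lambda>x. 0) = 0" unfolding u_def by simp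
      qed
      moreover have "u f = 0" if "f \<notin> V" for f
      proof -
        have "q f = 0" if "q \<in> C" for q
          using CS[OF that] \<open>f \<notin> V\<close> unfolding SL_def by blast
        then have "(\<lambda>q. q f) ` C = {0}" using False by force
        then show ?thesis unfolding u_def by simp
      qed
      moreover have "u f \<le> p f" if "f \<in> V" for f
        using False ule SLp CS that by (meson all_not_in_conv order.trans)
      ultimately have uSL: "u \<in> SL" unfolding SL_def by blast
      have "u f \<le> q f" if "q \<in> C" for q f
      proof (cases "f \<in> V")
        case True
        then show ?thesis using ule that by blast
      next
        case False
        then show ?thesis using uSL CS[OF that] unfolding SL_def by simp
      qed
      then show ?thesis using uSL unfolding P_def by blast
    qed
  qed
  then obtain m where m: "m \<in> SL" and min: "\<And>q. q \<in> SL \<Longrightarrow> P m q \<Longrightarrow> q = m" by blast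
  have super: "m f + m g \<le> m (\<lambda>x. f x + g x)" if f: "f \<in> V" and g: "g \<in> V" for f g
  proof -
    \<comment> \<open>Classical perturbation of \<open>m\<close> in the direction \<open>g\<close>.
      It is sublinear and below \<open>m\<close> (take t = 0), so minimality gives
      \<open>q = m\<close>, and t = 1 then becomes superadditivity of \<open>m\<close>.\<close>
    define q where
      "q f = (if f \<in> V then INF t\<in>{0..}. m (\<lambda>x. f x + t * g x) - t * m g else 0)" for f
    have bd: "bdd_below ((\<lambda>t. m (\<lambda>x. f x + t * g x) - t * m g) ` {0..})" if f: "f \<in> V" for f
    proof (rule bdd_belowI2)
      fix t :: real assume t: "t \<in> {0..}"
      have "m (\<lambda>x. (f x + t * g x) + - f x) \<le> m (\<lambda>x. f x + t * g x) + m (\<lambda>x. - f x)"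
        by (rule SLa[OF m Va[OF f Vm[OF g]] Vn[OF f]])
      moreover have "(\<lambda>x. (f x + t * g x) + - f x) = (\<lambda>x. t * g x)" by auto
      moreover have "m (\<lambda>x. t * g x) = t * m g" using SLm[OF m g] t by simp
      ultimately show "- m (\<lambda>x. - f x) \<le> m (\<lambda>x. f x + t * g x) - t * m g" by simp
    qed
    have qle: "q f \<le> m (\<lambda>x. f x + t * g x) - t * m g" if "f \<in> V" "t \<ge> 0" for f t
      unfolding q_def using cINF_lower[OF bd[OF that(1)], of t] that by simp
    have qge: "b \<le> q f" if "f \<in> V" "\<And>t. t \<ge> 0 \<Longrightarrow> b \<le> m (\<lambda>x. f x + t * g x) - t * m g" for b f
      unfolding q_def using that by (auto intro!: cINF_greatest)
    have qm: "q f \<le> m f" if "f \<in> V" for f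
      using qle[OF that, of 0] by simp
    have "sublinear_on V q"
    proof (rule sublinear_onI[OF V])
      fix f h assume f: "f \<in> V" and h: "h \<in> V"
      have *: "q (\<lambda>x. f x + h x) \<le> (m (\<lambda>x. f x + t * g x) - t * m g) + (m (\<lambda>x. h x + s * g x) - s * m g)"
        if "t \<ge> 0" "s \<ge> 0" for t s
      proof -
        have "q (\<lambda>x. f x + h x) \<le> m (\<lambda>x. (f x + h x) + (t + s) * g x) - (t + s) * m g"
          using qle[OF Va[OF f h], of "t + s"] that by simp
        also have "(\<lambda>x. (f x + h x) + (t + s) * g x) = (\<lambda>x. (f x + t * g x) + (h x + s * g x))"
          by (auto simp: algebra_simps)
        also have "m \<dots> \<le> m (\<lambda>x. f x + t * g x) + m (\<lambda>x. h x + s * g x)"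
          by (rule SLa[OF m Va[OF f Vm[OF g]] Va[OF h Vm[OF g]]])
        finally show ?thesis by (simp add: algebra_simps)
      qed
      have "q (\<lambda>x. f x + h x) - (m (\<lambda>x. f x + t * g x) - t * m g) \<le> q h" if "t \<ge> 0" for t
        by (rule qge[OF h]) (use *[OF that] in \<open>simp add: algebra_simps\<close>)
      then have "q (\<lambda>x. f x + h x) - q h \<le> q f"
        by (intro qge[OF f]) (simp add: algebra_simps)
      then show "q (\<lambda>x. f x + h x) \<le> q f + q h" by simp
    next
      fix f and a :: real assume f: "f \<in> V" and a: "a > 0"
      have "q (\<lambda>x. a * f x) / a \<le> q f"
      proof (rule qge[OF f])
        fix t :: real assume t: "t \<ge> 0"
        have "q (\<lambda>x. a * f x) \<le> m (\<lambda>x. a * f x + (a * t) * g x) - (a * t) * m g"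
          using qle[OF Vm[OF f], of "a * t"] t a by simp
        also have "(\<lambda>x. a * f x + (a * t) * g x) = (\<lambda>x. a * (f x + t * g x))"
          by (auto simp: algebra_simps)
        also have "m \<dots> = a * m (\<lambda>x. f x + t * g x)"
          using SLm[OF m Va[OF f Vm[OF g]], of a] a by simp
        finally show "q (\<lambda>x. a * f x) / a \<le> m (\<lambda>x. f x + t * g x) - t * m g"
          using a by (simp add: field_simps)
      qed
      then show "q (\<lambda>x. a * f x) \<le> a * q f" using a by (simp add: field_simps)
    next
      fix f assume f: "f \<in> V"
      have z: "(\<lambda>x. 0) \<in> V" using Vm[OF f, of 0] by simp
      have "0 \<le> q (\<lambda>x. 0)"
        by (rule qge[OF z]) (use SLm[OF m g] in simp)
      moreover have "q (\<lambda>x. 0) \<le> 0" using qm[OF z] SLz[OF m f] by simp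
      ultimately show "q (\<lambda>x. 0) = 0" by simp
    qed
    moreover have "q f \<le> p f" if "f \<in> V" for f
      using qm[OF that] SLp[OF m that] by simp
    ultimately have "q \<in> SL" unfolding SL_def by (simp add: q_def)
    moreover have "P m q"
      unfolding P_def
    proof
      fix f show "q f \<le> m f"
        using qm[of f] m by (cases "f \<in> V") (simp_all add: q_def SL_def)
    qed
    ultimately have "q = m" by (rule min)
    then have "m f \<le> m (\<lambda>x. f x + 1 * g x) - 1 * m g" using qle[OF f, of 1] by simp
    then show ?thesis by simp
  qed
  have add: "m (\<lambda>x. f x + g x) = m f + m g" if "f \<in> V" "g \<in> V" for f g
    using super[OF that] SLa[OF m that] by simp
  have neg: "m (\<lambda>x. - f x) = - m f" if "f \<in> V" for f
    using add[OF that Vn[OF that]] SLz[OF m that] by simp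
  have "m (\<lambda>x. a * f x) = a * m f" if f: "f \<in> V" for f a
  proof (cases "a \<ge> 0")
    case True
    then show ?thesis using SLm[OF m f] by simp
  next
    case False
    then have "m (\<lambda>x. - ((- a) * f x)) = - ((-a) * m f)"
      using SLm[OF m f, of "-a"] neg[OF Vm[OF f, of "-a"]] by simp
    then show ?thesis by simp
  qed
  then show ?thesis using add SLp[OF m] by blast
qed

section \<open>Continuity balls\<close>

text \<open>Around a given centre at most countably many spheres carry mass, so an uncharged radius
  exists in every open interval; the centres run through a countable dense set.\<close>

lemma continuity_ball_base:
  fixes \<nu> :: "'s::polish_space measure"
  assumes "finite_measure \<nu>" and sets: "sets \<nu> = sets borel"
  obtains a :: "nat \<Rightarrow> 's" and r :: "nat \<Rightarrow> real"
  where "\<And>n. measure \<nu> {y. dist (a n) y = r n} = 0"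
    and "\<And>y \<epsilon>. \<epsilon> > 0 \<Longrightarrow> \<exists>n. dist (a n) y < r n \<and> r n < \<epsilon>"
proof -
  interpret finite_measure \<nu> by fact
  have [simp]: "space \<nu> = UNIV" using sets_eq_imp_space_eq[OF sets] by simp
  note [measurable_cong] = sets
  obtain D :: "'s set" where D: "countable D" "\<And>X. open X \<Longrightarrow> X \<noteq> {} \<Longrightarrow> \<exists>d\<in>D. d \<in> X"
    using countable_dense_exists by blast
  have "D \<noteq> {}" using D(2)[of UNIV] by auto
  \<comment> \<open>The lower end ensures that a centre closer than 1/(2(m+1)) to \<open>y\<close>
    has \<open>y\<close> in its ball; the upper end makes the radii shrink.\<close>
  have "\<exists>s. 1 / (2 * (real m + 1)) < s \<and> s < 1 / (real m + 1) \<and> measure \<nu> {y. dist d y = s} = 0"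
    for d m
  proof -
    interpret N: finite_measure "distr \<nu> borel (dist d)"
      by (rule finite_measure_distr) measurable
    let ?I = "{1 / (2 * (real m + 1)) <..< 1 / (real m + 1)}"
    have "1 / (2 * (real m + 1)) < 1 / (real m + 1)" by (simp add: field_simps)
    then have "uncountable ?I" using uncountable_open_interval by blast
    then have "?I - {x. measure (distr \<nu> borel (dist d)) {x} \<noteq> 0} \<noteq> {}"
      using N.countable_support by (metis countable_empty uncountable_minus_countable)
    then obtain s where "s \<in> ?I" "measure (distr \<nu> borel (dist d)) {s} = 0" by blast
    moreover have "measure (distr \<nu> borel (dist d)) {s} = measure \<nu> {y. dist d y = s}"
      by (subst measure_distr) (auto simp: vimage_def)
    ultimately show ?thesis by auto
  qed
  then have "\<exists>s. \<forall>d m. 1 / (2 * (real m + 1)) < s d m \<and> s d m < 1 / (real m + 1) \<and>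
      measure \<nu> {y. dist d y = s d m} = 0"
    by (intro choice allI)
  then obtain s where s: "\<And>d m. 1 / (2 * (real m + 1)) < s d m" "\<And>d m. s d m < 1 / (real m + 1)"
    "\<And>d m. measure \<nu> {y. dist d y = s d m} = 0" by blast
  define e where "e = from_nat_into (D \<times> (UNIV :: nat set))"
  have rng: "range e = D \<times> UNIV"
    unfolding e_def using D(1) \<open>D \<noteq> {}\<close> by (intro range_from_nat_into) auto
  show thesis
  proof (rule that[of "\<lambda>n. fst (e n)" "\<lambda>n. s (fst (e n)) (snd (e n))"])
    show "measure \<nu> {y. dist (fst (e n)) y = s (fst (e n)) (snd (e n))} = 0" for n
      by (rule s(3))
    fix y :: 's and \<epsilon> :: real assume "\<epsilon> > 0"
    then obtain m where m: "1 / (real m + 1) < \<epsilon>"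
      using nat_approx_posE[of \<epsilon>] by (auto simp: add.commute)
    have "\<exists>d\<in>D. d \<in> ball y (1 / (2 * (real m + 1)))" by (rule D(2)) auto
    then obtain d where d: "d \<in> D" "dist d y < 1 / (2 * (real m + 1))"
      by (auto simp: dist_commute)
    obtain n where "e n = (d, m)" using rng d(1) by (metis UNIV_I mem_Sigma_iff rangeE)
    then show "\<exists>n. dist (fst (e n)) y < s (fst (e n)) (snd (e n)) \<and> s (fst (e n)) (snd (e n)) < \<epsilon>"
      using d(2) s(1)[where d = d and m = m] s(2)[where d = d and m = m] m
      by (intro exI[of _ n]) auto
  qed
qed

lemma open_eq_Union_balls:
  fixes a :: "nat \<Rightarrow> 's::metric_space"
  assumes base: "\<And>y \<epsilon>. \<epsilon> > 0 \<Longrightarrow> \<exists>n. dist (a n) y < r n \<and> r n < \<epsilon>" and "open O'"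
  shows "O' = (\<Union>n\<in>{n. ball (a n) (r n) \<subseteq> O'}. ball (a n) (r n))"
proof
  show "O' \<subseteq> (\<Union>n\<in>{n. ball (a n) (r n) \<subseteq> O'}. ball (a n) (r n))"
  proof
    fix y assume "y \<in> O'"
    then obtain e where e: "e > 0" "ball y e \<subseteq> O'" using \<open>open O'\<close> open_contains_ball by blast
    \<comment> \<open>A ball of radius below \<open>e / 2\<close> that contains \<open>y\<close>
      lies in the ball of radius \<open>e\<close> about \<open>y\<close>.\<close>
    obtain n where n: "dist (a n) y < r n" "r n < e / 2" using base[of "e / 2" y] e by auto
    have "z \<in> ball y e" if "z \<in> ball (a n) (r n)" for z
      using that n dist_triangle3[of y z "a n"] by (simp add: dist_commute)
    then have "ball (a n) (r n) \<subseteq> O'" using e by blast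
    then show "y \<in> (\<Union>n\<in>{n. ball (a n) (r n) \<subseteq> O'}. ball (a n) (r n))" using n by auto
  qed
qed auto

lemma frontier_ball_subset: "frontier (ball a r) \<subseteq> {y. dist (a::'a::metric_space) y = r}"
proof
  fix y assume "y \<in> frontier (ball a r)"
  then have "y \<in> closure (ball a r)" "y \<notin> ball a r" by (auto simp: frontier_def interior_open)
  moreover have "closure (ball a r) \<subseteq> cball a r" by (rule closure_minimal) auto
  ultimately show "y \<in> {y. dist a y = r}" by force
qed

section \<open>Densities of dominated additive set functions\<close>

text \<open>Domination by a finite measure turns finite additivity into continuity at the empty set,
  hence into countable additivity, and Radon-Nikodym applies. The total mass being finite, the
  density can be made real-valued.\<close>

lemma density_of_dominated_additive:
  fixes \<mu> :: "'a set \<Rightarrow> real"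
  assumes "finite_measure M"
    and dom: "\<And>A. A \<in> sets M \<Longrightarrow> 0 \<le> \<mu> A \<and> \<mu> A \<le> measure M A"
    and add: "\<And>A B. A \<in> sets M \<Longrightarrow> B \<in> sets M \<Longrightarrow> A \<inter> B = {} \<Longrightarrow> \<mu> (A \<union> B) = \<mu> A + \<mu> B"
  obtains f :: "'a \<Rightarrow> real" where "f \<in> borel_measurable M" "\<And>x. 0 \<le> f x"
    "\<And>A. A \<in> sets M \<Longrightarrow> (\<integral>\<^sup>+x\<in>A. ennreal (f x) \<partial>M) = ennreal (\<mu> A)"
proof -
  interpret finite_measure M by fact
  define m where "m A = ennreal (\<mu> A)" for A
  have m0: "\<mu> {} = 0" using dom[of "{}"] by simp
  have "countably_additive (sets M) m"
  proof (rule sets.empty_continuous_imp_countably_additive)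
    show "positive (sets M) m" by (simp add: positive_def m_def m0)
    show "additive (sets M) m"
      using add dom by (auto simp: additive_def m_def)
    show "\<forall>A\<in>sets M. m A \<noteq> \<infinity>" by (simp add: m_def)
    fix A :: "nat \<Rightarrow> 'a set" assume A: "range A \<subseteq> sets M" "decseq A" "(\<Inter>i. A i) = {}"
    have "(\<lambda>i. measure M (A i)) \<longlonglongrightarrow> 0"
      using finite_Lim_measure_decseq[OF A(1,2)] A(3) by simp
    then have "(\<lambda>i. \<mu> (A i)) \<longlonglongrightarrow> 0"
      by (rule tendsto_sandwich[OF _ _ tendsto_const, rotated 2])
         (use dom A(1) in auto)
    then show "(\<lambda>i. m (A i)) \<longlonglongrightarrow> 0"
      unfolding m_def using tendsto_ennrealI by fastforce
  qed
  moreover have "positive (sets M) m" by (simp add: positive_def m_def m0)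
  ultimately have em: "emeasure (measure_of (space M) (sets M) m) A = m A" if "A \<in> sets M" for A
    using that by (intro emeasure_measure_of_sigma) (auto simp: sets.sigma_algebra_axioms)
  define N where "N = measure_of (space M) (sets M) m"
  have sN: "sets N = sets M" by (simp add: N_def sets.space_closed)
  have "absolutely_continuous M N"
    unfolding absolutely_continuous_def
  proof
    fix A assume "A \<in> null_sets M"
    then have "A \<in> sets M" "measure M A = 0" by (auto simp: measure_def)
    then show "A \<in> null_sets N" using dom[of A] sN em by (auto simp: null_sets_def N_def m_def)
  qed
  then obtain f where f: "f \<in> borel_measurable M" "density M f = N"
    using Radon_Nikodym[OF _ sN] by blast
  have nn: "(\<integral>\<^sup>+x\<in>A. f x \<partial>M) = ennreal (\<mu> A)" if "A \<in> sets M" for A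
    using emeasure_density[OF f(1) that] em[OF that] f(2) by (simp add: N_def m_def)
  have "(\<integral>\<^sup>+x. f x \<partial>M) = ennreal (\<mu> (space M))"
  proof -
    have "(\<integral>\<^sup>+x. f x \<partial>M) = (\<integral>\<^sup>+x\<in>space M. f x \<partial>M)"
      by (rule nn_integral_cong) auto
    then show ?thesis using nn[of "space M"] by simp
  qed
  then have "AE x in M. f x \<noteq> \<infinity>" using f(1) by (intro nn_integral_PInf_AE) auto
  then have fin: "AE x in M. ennreal (enn2real (f x)) = f x" by (auto simp: less_top)
  show thesis
  proof (rule that[of "\<lambda>x. enn2real (f x)"])
    show "(\<lambda>x. enn2real (f x)) \<in> borel_measurable M" using f(1) by measurable
    fix A assume A: "A \<in> sets M"
    have "(\<integral>\<^sup>+x\<in>A. ennreal (enn2real (f x)) \<partial>M) = (\<integral>\<^sup>+x\<in>A. f x \<partial>M)"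
      using fin by (intro nn_integral_cong_AE) auto
    then show "(\<integral>\<^sup>+x\<in>A. ennreal (enn2real (f x)) \<partial>M) = ennreal (\<mu> A)" using nn[OF A] by simp
  qed simp
qed

lemma AE_eq_of_set_nn_integrals:
  fixes f g :: "'a \<Rightarrow> ennreal"
  assumes "sigma_finite_measure M" and f: "f \<in> borel_measurable M" and g: "g \<in> borel_measurable M"
    and "\<And>A. A \<in> sets M \<Longrightarrow> (\<integral>\<^sup>+x\<in>A. f x \<partial>M) = (\<integral>\<^sup>+x\<in>A. g x \<partial>M)"
  shows "AE x in M. f x = g x"
proof -
  interpret sigma_finite_measure M by fact
  have "density M f = density M g"
    using assms by (intro measure_eqI) (auto simp: emeasure_density)
  then show ?thesis using density_unique_iff[OF f g] by simp
qed

section \<open>Coding points by the balls of a base\<close>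

text \<open>The most recent bit stands at the head, so that refining a word by one bit is
  \<open>Cons\<close> and coarsening it is \<open>drop\<close>.\<close>

fun digits :: "nat \<Rightarrow> (nat \<Rightarrow> bool) \<Rightarrow> bool list" where
  "digits 0 \<omega> = []"
| "digits (Suc n) \<omega> = \<omega> n # digits n \<omega>"

lemma length_digits [simp]: "length (digits n \<omega>) = n"
  by (induction n) auto

lemma drop_digits: "n \<le> m \<Longrightarrow> drop (m - n) (digits m \<omega>) = digits n \<omega>"
proof (induction m)
  case (Suc m)
  then show ?case by (cases "n = Suc m") (auto simp: Suc_diff_le)
qed simp

lemma digits_eq_iff: "digits n \<omega> = digits n \<omega>' \<longleftrightarrow> (\<forall>k<n. \<omega> k = \<omega>' k)"
  by (induction n) (auto simp: less_Suc_eq)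

definition cylinder :: "bool list \<Rightarrow> (nat \<Rightarrow> bool) set" where
  "cylinder p = {\<omega>. digits (length p) \<omega> = p}"

text \<open>The product sigma-algebra on 0-1 sequences. The empty set joins the cylinders so that
  the generator is closed under intersection, as uniqueness of measures requires.\<close>

definition cantor_algebra :: "(nat \<Rightarrow> bool) measure" where
  "cantor_algebra = sigma UNIV (insert {} (range cylinder))"

lemma space_cantor_algebra [simp]: "space cantor_algebra = UNIV"
  by (simp add: cantor_algebra_def space_measure_of_conv)

lemma sets_cantor_algebra: "sets cantor_algebra = sigma_sets UNIV (insert {} (range cylinder))"
  by (simp add: cantor_algebra_def sets_measure_of)

lemma cylinder_measurable [measurable]: "cylinder p \<in> sets cantor_algebra"
  by (simp add: sets_cantor_algebra sigma_sets.Basic)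

text \<open>Two cylinders are nested or disjoint, since a word determines its shorter prefixes by
  \<open>drop_digits\<close>.\<close>

lemma Int_stable_cylinder: "Int_stable (insert {} (range cylinder))"
proof -
  have *: "cylinder q \<subseteq> cylinder p \<or> cylinder q \<inter> cylinder p = {}" if "length p \<le> length q" for p q
  proof -
    have "digits (length p) \<omega> = drop (length q - length p) q" if "\<omega> \<in> cylinder q" for \<omega>
      using that drop_digits[OF \<open>length p \<le> length q\<close>, of \<omega>] by (simp add: cylinder_def)
    then show ?thesis unfolding cylinder_def by (cases "drop (length q - length p) q = p") auto
  qed
  have "cylinder p \<inter> cylinder q \<in> insert {} (range cylinder)" for p q
  proof (cases "length p \<le> length q")
    case True
    then have "cylinder p \<inter> cylinder q = cylinder q \<or> cylinder p \<inter> cylinder q = {}"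
      using *[of p q] by blast
    then show ?thesis by auto
  next
    case False
    then have "cylinder p \<inter> cylinder q = cylinder p \<or> cylinder p \<inter> cylinder q = {}"
      using *[of q p] by auto
    then show ?thesis by auto
  qed
  then show ?thesis unfolding Int_stable_def by auto
qed

lemma measurable_coordinate: "Measurable.pred cantor_algebra (\<lambda>\<omega>. \<omega> n)"
proof -
  have "{\<omega>. \<omega> n} = (\<Union>p\<in>{p. length p = n}. cylinder (True # p))"
    by (auto simp: cylinder_def)
  moreover have "\<dots> \<in> sets cantor_algebra"
    by (intro sets.countable_UN'') auto
  ultimately show ?thesis by (simp add: pred_def)
qed

lemma measurable_digits [measurable]:
  assumes [measurable]: "\<And>k. Measurable.pred M (\<lambda>z. d k z)"
  shows "(\<lambda>z. digits n (\<lambda>k. d k z)) \<in> measurable M (count_space UNIV)"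
proof (induction n)
  case (Suc n)
  have "(\<lambda>z. d n z # q) \<in> measurable M (count_space UNIV)" for q by measurable
  then have "(\<lambda>z. d n z # digits n (\<lambda>k. d k z)) \<in> measurable M (count_space UNIV)"
    using Suc by (rule measurable_compose_countable)
  then show ?case by simp
qed simp

lemma measurable_into_cantor:
  assumes [measurable]: "\<And>k. Measurable.pred M (\<lambda>z. d k z)"
  shows "(\<lambda>z n. d n z) \<in> measurable M cantor_algebra"
  unfolding cantor_algebra_def
proof (rule measurable_measure_of)
  fix A assume "A \<in> insert {} (range cylinder)"
  then consider "A = {}" | p where "A = cylinder p" by auto
  then show "(\<lambda>z n. d n z) -` A \<inter> space M \<in> sets M"
  proof cases
    case 2
    have "{z\<in>space M. digits (length p) (\<lambda>k. d k z) = p} \<in> sets M" by measurable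
    moreover have "(\<lambda>z n. d n z) -` A \<inter> space M = {z\<in>space M. digits (length p) (\<lambda>k. d k z) = p}"
      by (auto simp: 2 cylinder_def)
    ultimately show ?thesis by simp
  qed simp
qed auto

locale ball_base =
  fixes a :: "nat \<Rightarrow> 's::polish_space" and r :: "nat \<Rightarrow> real"
  assumes base: "\<And>y \<epsilon>. \<epsilon> > 0 \<Longrightarrow> \<exists>n. dist (a n) y < r n \<and> r n < \<epsilon>"
begin

definition U where "U n = ball (a n) (r n)"

definition address :: "'s \<Rightarrow> nat \<Rightarrow> bool" where
  "address y n \<longleftrightarrow> y \<in> U n"

definition cell :: "bool list \<Rightarrow> 's set" where
  "cell p = address -` cylinder p"

text \<open>Uses the code alone: among the balls that the code claims to contain the point, the
  first of radius below 1/(m+1) supplies its centre. If there is none, the value is unspecified but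
  harmless.\<close>

definition pick :: "nat \<Rightarrow> (nat \<Rightarrow> bool) \<Rightarrow> 's" where
  "pick m \<omega> = a (LEAST n. \<omega> n \<and> r n < 1 / real (Suc m))"

text \<open>The fallback \<open>a 0\<close> turns a non-Cauchy sequence into a constant one. The
  limit thus exists for every code, and \<open>locate\<close> is a pointwise limit of measurable
  maps.\<close>

definition locate :: "(nat \<Rightarrow> bool) \<Rightarrow> 's" where
  "locate \<omega> = lim (\<lambda>m. if Cauchy (\<lambda>m. pick m \<omega>) then pick m \<omega> else a 0)"

text \<open>For the code of an actual point the picked centres lie within 1/(m+1) of it, so
  completeness is not what makes this limit exist: it is the point itself.\<close>

lemma locate_address [simp]: "locate (address y) = y"
proof -
  have d: "dist (pick m (address y)) y < 1 / real (Suc m)" for m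
  proof -
    let ?P = "\<lambda>n. address y n \<and> r n < 1 / real (Suc m)"
    have "\<exists>n. ?P n" using base[of "1 / real (Suc m)" y] by (auto simp: address_def U_def)
    then have "?P (Least ?P)" by (rule LeastI_ex)
    then show ?thesis by (simp add: pick_def address_def U_def)
  qed
  have "(\<lambda>m. dist (pick m (address y)) y) \<longlonglongrightarrow> 0"
  proof (rule tendsto_sandwich[OF _ _ tendsto_const])
    show "(\<lambda>m. 1 / real (Suc m)) \<longlonglongrightarrow> 0" using LIMSEQ_Suc lim_1_over_n by blast
  qed (use d in \<open>auto intro!: always_eventually less_imp_le\<close>)
  then have l: "(\<lambda>m. pick m (address y)) \<longlonglongrightarrow> y" by (rule iffD2[OF tendsto_dist_iff])
  have "Cauchy (\<lambda>m. pick m (address y))" by (rule LIMSEQ_imp_Cauchy[OF l])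
  then have "locate (address y) = lim (\<lambda>m. pick m (address y))" unfolding locate_def by presburger
  then show ?thesis using limI[OF l] by simp
qed

lemma measurable_locate [measurable]: "locate \<in> borel_measurable cantor_algebra"
proof -
  have [measurable]: "pick m \<in> borel_measurable cantor_algebra" for m
    unfolding pick_def using measurable_coordinate by measurable
  show ?thesis
  proof (rule borel_measurable_LIMSEQ_metric)
    fix \<omega>
    have "convergent (\<lambda>m. if Cauchy (\<lambda>m. pick m \<omega>) then pick m \<omega> else a 0)"
      by (cases "Cauchy (\<lambda>m. pick m \<omega>)") (auto simp: Cauchy_convergent convergent_const)
    then show "(\<lambda>m. if Cauchy (\<lambda>m. pick m \<omega>) then pick m \<omega> else a 0) \<longlonglongrightarrow> locate \<omega>"
      unfolding locate_def by (simp add: convergent_LIMSEQ_iff)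
  qed measurable
qed

lemma measurable_address [measurable]: "address \<in> measurable borel cantor_algebra"
proof -
  have "Measurable.pred borel (\<lambda>y. address y k)" for k
    by (simp add: address_def U_def pred_def borel_open)
  then have "(\<lambda>y n. address y n) \<in> measurable borel cantor_algebra"
    by (rule measurable_into_cantor)
  then show ?thesis by simp
qed

lemma cell_borel [measurable]: "cell p \<in> sets borel"
  unfolding cell_def using measurable_sets[OF measurable_address cylinder_measurable] by simp

lemma cell_Nil [simp]: "cell [] = UNIV"
  by (simp add: cell_def cylinder_def)

lemma cell_Cons: "cell (b # p) = cell p \<inter> (if b then U (length p) else - U (length p))"
  by (auto simp: cell_def cylinder_def address_def)

text \<open>Frontiers of intersections and complements stay inside the union of the frontiers, and
  the frontier of a ball inside its sphere. Cells are therefore \<nu>-continuity sets, on which the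
  second marginal of a finitely additive plan is known exactly.\<close>

lemma frontier_cell_null:
  assumes \<nu>: "sets \<nu> = sets borel" and null: "\<And>n. {y. dist (a n) y = r n} \<in> null_sets \<nu>"
  shows "frontier (cell p) \<in> null_sets \<nu>"
proof (induction p)
  case (Cons b p)
  have "frontier (U n) \<subseteq> {y. dist (a n) y = r n}" for n
    unfolding U_def by (rule frontier_ball_subset)
  then have "frontier (U n) \<in> null_sets \<nu>" for n
    by (intro null_sets_subset[OF null]) (auto simp: \<nu> borel_closed)
  then have "frontier (if b then U n else - U n) \<in> null_sets \<nu>" for n
    by (simp add: frontier_complement)
  then have "frontier (cell p) \<union> frontier (if b then U (length p) else - U (length p)) \<in> null_sets \<nu>"
    using Cons by (intro null_sets.Un) auto
  then show ?case
    unfolding cell_Cons by (rule null_sets_subset) (auto simp: \<nu> borel_closed frontier_Int_subset)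
qed (use \<nu> in \<open>simp\<close>)

section \<open>Sets decided by finitely many balls\<close>

text \<open>Membership in the finite algebra generated by the first \<open>n\<close> balls. Such a
  set is a finite union of cells, so finite additivity is enough to handle it.\<close>

definition saturated :: "nat \<Rightarrow> 's set \<Rightarrow> bool" where
  "saturated n A \<longleftrightarrow> (\<forall>y z. (\<forall>k<n. y \<in> U k \<longleftrightarrow> z \<in> U k) \<longrightarrow> y \<in> A \<longrightarrow> z \<in> A)"

lemma saturated_Int: "saturated n A \<Longrightarrow> saturated m B \<Longrightarrow> saturated (max n m) (A \<inter> B)"
  unfolding saturated_def less_max_iff_disj Int_iff by meson

lemma saturated_U: "k < n \<Longrightarrow> saturated n (U k)"
  unfolding saturated_def by blast

lemma saturated_UN: "(\<And>i. i \<in> N \<Longrightarrow> saturated n (B i)) \<Longrightarrow> saturated n (\<Union>i\<in>N. B i)"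
  unfolding saturated_def by blast

lemma saturated_decomp:
  assumes "saturated n A"
  shows "A = \<Union> (cell ` {p. length p = n \<and> cell p \<inter> A \<noteq> {}})"
proof -
  have c: "y \<in> cell (digits n (address y))" for y by (simp add: cell_def cylinder_def)
  have imp: "z \<in> A" if "length p = n" "y \<in> cell p" "y \<in> A" "z \<in> cell p" for p y z
  proof -
    have "digits n (address y) = digits n (address z)"
      using that by (simp add: cell_def cylinder_def)
    then show ?thesis using assms that(3) by (simp add: digits_eq_iff saturated_def address_def)
  qed
  show ?thesis
  proof (rule set_eqI)
    fix y
    show "y \<in> A \<longleftrightarrow> y \<in> \<Union> (cell ` {p. length p = n \<and> cell p \<inter> A \<noteq> {}})" (is "_ \<longleftrightarrow> _ \<in> ?R")
    proof
      assume A: "y \<in> A"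
      have "digits n (address y) \<in> {p. length p = n \<and> cell p \<inter> A \<noteq> {}}"
        using IntI[OF c[of y] A] by (metis (mono_tags) empty_iff length_digits mem_Collect_eq)
      then show "y \<in> ?R" using c[of y] by (rule UN_I)
    next
      assume "y \<in> ?R"
      then obtain p where p: "length p = n" "cell p \<inter> A \<noteq> {}" "y \<in> cell p" by (elim UN_E CollectE conjE)
      then obtain x where "x \<in> cell p" "x \<in> A" by (elim ex_in_conv[THEN iffD2, elim_format] exE IntE)
      with p show "y \<in> A" by (intro imp[of p x y])
    qed
  qed
qed

lemma finite_cells: "finite {p :: bool list. length p = n \<and> Q p}"
  by (rule finite_subset[OF _ finite_lists_length_eq[of UNIV n]]) auto

lemma saturated_borel:
  assumes "saturated n A"
  shows "A \<in> sets borel"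
proof -
  have "\<Union> (cell ` {p. length p = n \<and> cell p \<inter> A \<noteq> {}}) \<in> sets borel"
    by (rule sets.finite_Union) (auto simp: finite_cells)
  then show ?thesis using saturated_decomp[OF assms] by (rule ssubst[rotated])
qed

end

section \<open>Kernels of finitely additive plans\<close>

text \<open>\<open>\<Lambda> A B\<close> abstracts the value of \<open>L\<close> at the indicator of
  a rectangle. Additivity is finite only, and \<open>B\<close> ranges over arbitrary subsets of S
  because \<open>L\<close> is defined on all bounded functions. The bound on closed sets is what
  testing \<open>L\<close> against continuous functions of y yields for indicators.\<close>

locale additive_plan = ball_base a r + E: prob_space \<eta> + S: prob_space \<nu>
  for a :: "nat \<Rightarrow> 's::polish_space" and r :: "nat \<Rightarrow> real"
    and \<eta> :: "'e measure" and \<nu> :: "'s measure" +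
  fixes \<Lambda> :: "'e set \<Rightarrow> 's set \<Rightarrow> real"
  assumes sets_\<nu>: "sets \<nu> = sets borel"
    and sphere_null: "\<And>n. measure \<nu> {y. dist (a n) y = r n} = 0"
    and nonneg: "\<And>A B. A \<in> sets \<eta> \<Longrightarrow> 0 \<le> \<Lambda> A B"
    and add_left: "\<And>A A' B. A \<in> sets \<eta> \<Longrightarrow> A' \<in> sets \<eta> \<Longrightarrow> A \<inter> A' = {} \<Longrightarrow>
      \<Lambda> (A \<union> A') B = \<Lambda> A B + \<Lambda> A' B"
    and add_right: "\<And>A B B'. A \<in> sets \<eta> \<Longrightarrow> B \<inter> B' = {} \<Longrightarrow> \<Lambda> A (B \<union> B') = \<Lambda> A B + \<Lambda> A B'"
    and marginal_left: "\<And>A. A \<in> sets \<eta> \<Longrightarrow> \<Lambda> A UNIV = measure \<eta> A"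
    and marginal_right: "\<And>B. closed B \<Longrightarrow> \<Lambda> (space \<eta>) B \<le> measure \<nu> B"
begin

lemma space_\<nu>: "space \<nu> = UNIV"
  using sets_eq_imp_space_eq[OF sets_\<nu>] by simp

lemma \<Lambda>_mono: "A \<in> sets \<eta> \<Longrightarrow> B \<subseteq> B' \<Longrightarrow> \<Lambda> A B \<le> \<Lambda> A B'"
  using add_right[of A B "B' - B"] nonneg[of A "B' - B"] by (simp add: Un_absorb1)

lemma \<Lambda>_empty: "A \<in> sets \<eta> \<Longrightarrow> \<Lambda> A {} = 0"
  using add_right[of A "{}" "{}"] by simp

lemma \<Lambda>_Compl: "A \<in> sets \<eta> \<Longrightarrow> \<Lambda> A B + \<Lambda> A (- B) = measure \<eta> A"
  using add_right[of A B "- B"] marginal_left[of A] by simp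

text \<open>Portmanteau argument: up to a null frontier both \<open>B\<close> and its complement are
  closed, so the bound on closed sets holds for each; both sides add up to 1, which forces
  equality.\<close>

lemma \<Lambda>_continuity_set:
  assumes "frontier B \<in> null_sets \<nu>" and "B \<in> sets borel"
  shows "\<Lambda> (space \<eta>) B = measure \<nu> B"
proof -
  have le: "\<Lambda> (space \<eta>) C \<le> measure \<nu> C" if "frontier C \<in> null_sets \<nu>" "C \<in> sets borel" for C
  proof -
    have "\<Lambda> (space \<eta>) C \<le> \<Lambda> (space \<eta>) (closure C)" by (rule \<Lambda>_mono) (auto simp: closure_subset)
    also have "\<dots> \<le> measure \<nu> (closure C)" by (rule marginal_right) simp
    also have "\<dots> \<le> measure \<nu> (C \<union> frontier C)"
      using that by (intro S.finite_measure_mono) (use interior_subset[of C] in \<open>auto simp: sets_\<nu> frontier_def borel_closed\<close>)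
    also have "\<dots> = measure \<nu> C"
      using that by (intro measure_Un_null_set) (auto simp: sets_\<nu>)
    finally show ?thesis .
  qed
  have "\<Lambda> (space \<eta>) (- B) \<le> measure \<nu> (- B)" using assms by (intro le) (auto simp: frontier_complement)
  moreover have "measure \<nu> (- B) = 1 - measure \<nu> B"
    using S.prob_compl[of B] assms by (simp add: sets_\<nu> space_\<nu> Compl_eq_Diff_UNIV)
  moreover have "\<Lambda> (space \<eta>) B + \<Lambda> (space \<eta>) (- B) = 1" using \<Lambda>_Compl[of "space \<eta>" B] by (simp add: E.prob_space)
  ultimately show ?thesis using le[of B] assms by simp
qed

lemma \<Lambda>_cell: "\<Lambda> (space \<eta>) (cell p) = measure \<nu> (cell p)"
proof (rule \<Lambda>_continuity_set)
  have "{y. dist (a n) y = r n} \<in> sets \<nu>" for n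
    unfolding sets_\<nu> by (intro borel_closed closed_Collect_eq continuous_intros)
  then have "{y. dist (a n) y = r n} \<in> null_sets \<nu>" for n
    using sphere_null[of n] by (simp add: null_sets_def S.emeasure_eq_measure)
  then show "frontier (cell p) \<in> null_sets \<nu>" by (rule frontier_cell_null[OF sets_\<nu>])
qed simp

lemma density_exists:
  "\<exists>f. f \<in> borel_measurable \<eta> \<and> (\<forall>x. 0 \<le> f x) \<and>
     (\<forall>A\<in>sets \<eta>. (\<integral>\<^sup>+x\<in>A. ennreal (f x) \<partial>\<eta>) = ennreal (\<Lambda> A B))"
proof -
  have "0 \<le> \<Lambda> A B \<and> \<Lambda> A B \<le> measure \<eta> A" if "A \<in> sets \<eta>" for A
    using nonneg[OF that] \<Lambda>_mono[OF that, of B UNIV] marginal_left[OF that] by simp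
  then obtain f :: "'e \<Rightarrow> real" where "f \<in> borel_measurable \<eta>" "\<And>x. 0 \<le> f x"
    "\<And>A. A \<in> sets \<eta> \<Longrightarrow> (\<integral>\<^sup>+x\<in>A. ennreal (f x) \<partial>\<eta>) = ennreal (\<Lambda> A B)"
    by (rule density_of_dominated_additive[OF E.finite_measure_axioms _ add_left]) auto
  then show ?thesis by blast
qed

section \<open>Conditional masses of cells and subdivision of the unit interval\<close>

text \<open>A version of the conditional probability, given x, that y lies in the cell of
  \<open>p\<close>.\<close>

definition weight :: "bool list \<Rightarrow> 'e \<Rightarrow> real" where
  "weight p = (SOME f. f \<in> borel_measurable \<eta> \<and> (\<forall>x. 0 \<le> f x) \<and>
     (\<forall>A\<in>sets \<eta>. (\<integral>\<^sup>+x\<in>A. ennreal (f x) \<partial>\<eta>) = ennreal (\<Lambda> A (cell p))))"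

lemma weight_measurable [measurable]: "weight p \<in> borel_measurable \<eta>"
  and weight_nonneg: "0 \<le> weight p x"
  and weight_integral: "A \<in> sets \<eta> \<Longrightarrow> (\<integral>\<^sup>+x\<in>A. ennreal (weight p x) \<partial>\<eta>) = ennreal (\<Lambda> A (cell p))"
  using someI_ex[OF density_exists[of "cell p"], folded weight_def] by auto

definition consistent :: "'e \<Rightarrow> bool" where
  "consistent x \<longleftrightarrow> weight [] x = 1 \<and> (\<forall>p. weight p x = weight (True # p) x + weight (False # p) x)"

lemma consistentD:
  assumes "consistent x"
  shows "weight [] x = 1" and "weight p x = weight (True # p) x + weight (False # p) x"
  using assms unfolding consistent_def by blast+

text \<open>Both identities hold after integration over every measurable set, by additivity of
  \<Lambda> in its second argument. There are countably many words, so one null set serves them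
  all.\<close>

lemma AE_consistent: "AE x in \<eta>. consistent x"
proof -
  note sf = E.sigma_finite_measure_axioms
  have "AE x in \<eta>. ennreal (weight [] x) = 1"
  proof (rule AE_eq_of_set_nn_integrals[OF sf])
    fix A assume "A \<in> sets \<eta>"
    then show "(\<integral>\<^sup>+x\<in>A. ennreal (weight [] x) \<partial>\<eta>) = (\<integral>\<^sup>+x\<in>A. 1 \<partial>\<eta>)"
      by (simp add: weight_integral marginal_left E.emeasure_eq_measure)
  qed auto
  then have *: "AE x in \<eta>. weight [] x = 1" by (simp add: ennreal_eq_1)
  have "AE x in \<eta>. ennreal (weight p x) = ennreal (weight (True # p) x + weight (False # p) x)" for p
  proof (rule AE_eq_of_set_nn_integrals[OF sf])
    fix A assume A: "A \<in> sets \<eta>"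
    have "cell p = cell (True # p) \<union> cell (False # p)" "cell (True # p) \<inter> cell (False # p) = {}"
      by (auto simp: cell_Cons)
    then have "\<Lambda> A (cell p) = \<Lambda> A (cell (True # p)) + \<Lambda> A (cell (False # p))"
      using add_right[OF A] by metis
    moreover have "(\<integral>\<^sup>+x\<in>A. ennreal (weight (True # p) x + weight (False # p) x) \<partial>\<eta>)
        = (\<integral>\<^sup>+x\<in>A. ennreal (weight (True # p) x) \<partial>\<eta>) + (\<integral>\<^sup>+x\<in>A. ennreal (weight (False # p) x) \<partial>\<eta>)"
      using A by (subst nn_integral_add[symmetric])
        (auto simp: weight_nonneg ennreal_plus distrib_right simp del: ennreal_plus[symmetric] intro!: nn_integral_cong)
    ultimately show "(\<integral>\<^sup>+x\<in>A. ennreal (weight p x) \<partial>\<eta>)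
        = (\<integral>\<^sup>+x\<in>A. ennreal (weight (True # p) x + weight (False # p) x) \<partial>\<eta>)"
      using A by (simp add: weight_integral nonneg)
  qed auto
  then have "AE x in \<eta>. weight p x = weight (True # p) x + weight (False # p) x" for p
    by (simp add: weight_nonneg ennreal_inj del: ennreal_plus)
  then have "AE x in \<eta>. \<forall>p. weight p x = weight (True # p) x + weight (False # p) x"
    by (simp add: AE_all_countable)
  with * show ?thesis unfolding consistent_def by eventually_elim blast
qed

text \<open>The unit interval is cut into consecutive intervals of lengths \<open>weight p x\<close>, one for each
  prefix \<open>p\<close> of a given length; \<open>start p x\<close> is the left end point of the interval of \<open>p\<close>.\<close>

fun start :: "bool list \<Rightarrow> 'e \<Rightarrow> real" where
  "start [] x = 0"
| "start (b # p) x = (if b then start p x else start p x + weight (True # p) x)"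

text \<open>Descends the subdivision towards \<open>u\<close>: the child \<open>True\<close> takes
  the left piece of its parent's interval and the child \<open>False\<close> the remaining right
  piece.\<close>

fun prefix :: "nat \<Rightarrow> 'e \<Rightarrow> real \<Rightarrow> bool list" where
  "prefix 0 x u = []"
| "prefix (Suc n) x u =
     (u < start (prefix n x u) x + weight (True # prefix n x u) x) # prefix n x u"

definition bit :: "nat \<Rightarrow> 'e \<Rightarrow> real \<Rightarrow> bool" where
  "bit n x u = hd (prefix (Suc n) x u)"

lemma prefix_digits: "prefix n x u = digits n (\<lambda>k. bit k x u)"
  by (induction n) (simp_all add: bit_def)

lemma start_measurable [measurable]: "start p \<in> borel_measurable \<eta>"
proof (induction p)
  case (Cons b p)
  note [measurable] = Cons
  have "start (b # p) = (\<lambda>x. if b then start p x else start p x + weight (True # p) x)"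
    by (rule ext) simp
  then show ?case by simp
qed (simp add: start.simps(1)[abs_def])

lemma start_bounds:
  assumes "consistent x"
  shows "0 \<le> start p x \<and> start p x + weight p x \<le> 1"
proof (induction p)
  case (Cons b p)
  have "weight p x = weight (True # p) x + weight (False # p) x"
    by (rule consistentD[OF assms])
  then show ?case using Cons weight_nonneg[of "True # p" x] weight_nonneg[of "False # p" x]
    by (cases b) auto
qed (simp add: consistentD(1)[OF assms])

text \<open>By consistency the intervals of the two children partition the interval of their parent;
  otherwise the pieces need not fit together.\<close>

lemma prefix_eq_iff:
  assumes x: "consistent x" and u: "0 \<le> u" "u < 1"
  shows "length p = n \<Longrightarrow> prefix n x u = p \<longleftrightarrow> start p x \<le> u \<and> u < start p x + weight p x"
proof (induction n arbitrary: p)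
  case 0
  then show ?case using u by (simp add: consistentD(1)[OF x])
next
  case (Suc n)
  then obtain b q where p: "p = b # q" "length q = n" by (cases p) auto
  have w: "weight q x = weight (True # q) x + weight (False # q) x"
    by (rule consistentD[OF x])
  have "prefix (Suc n) x u = p \<longleftrightarrow> prefix n x u = q \<and> b = (u < start q x + weight (True # q) x)"
    by (auto simp: p)
  also have "\<dots> \<longleftrightarrow> start p x \<le> u \<and> u < start p x + weight p x"
    using Suc.IH[OF p(2)] w weight_nonneg[of "True # q" x] weight_nonneg[of "False # q" x]
    by (cases b) (auto simp: p(1))
  finally show ?case .
qed

definition lam :: "real measure" where
  "lam = uniform_measure lborel {0..<1}"

sublocale lam: prob_space lam
  unfolding lam_def by (rule prob_space_uniform_measure) auto

lemma space_lam [simp]: "space lam = UNIV" and sets_lam [measurable_cong]: "sets lam = sets borel"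
  by (simp_all add: lam_def)

lemma emeasure_lam: "A \<in> sets borel \<Longrightarrow> emeasure lam A = emeasure lborel ({0..<1} \<inter> A)"
  by (simp add: lam_def divide_ennreal_def)

lemma measurable_prefix:
  "(\<lambda>z. prefix n (fst z) (snd z)) \<in> measurable (\<eta> \<Otimes>\<^sub>M lam) (count_space UNIV)"
proof (induction n)
  case (Suc n)
  have "(\<lambda>z. (snd z < start q (fst z) + weight (True # q) (fst z)) # q)
      \<in> measurable (\<eta> \<Otimes>\<^sub>M lam) (count_space UNIV)" for q
    by measurable
  then have "(\<lambda>z. (snd z < start (prefix n (fst z) (snd z)) (fst z)
        + weight (True # prefix n (fst z) (snd z)) (fst z)) # prefix n (fst z) (snd z))
      \<in> measurable (\<eta> \<Otimes>\<^sub>M lam) (count_space UNIV)"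
    using Suc by (rule measurable_compose_countable)
  then show ?case by simp
qed simp

lemma measurable_bit: "Measurable.pred (\<eta> \<Otimes>\<^sub>M lam) (\<lambda>z. bit n (fst z) (snd z))"
  unfolding bit_def by (rule measurable_compose[OF measurable_prefix]) simp

text \<open>Within [0,1) the numbers \<open>u\<close> with prefix \<open>p\<close> form a half-open
  interval whose length is the prescribed weight.\<close>

lemma lam_prefix:
  assumes "x \<in> space \<eta>" and x: "consistent x"
  shows "emeasure lam {u. prefix (length p) x u = p} = ennreal (weight p x)"
proof -
  let ?A = "{u. prefix (length p) x u = p}"
  have eq: "{0..<1} \<inter> ?A = {start p x..<start p x + weight p x}"
    using prefix_eq_iff[OF x _ _ refl, of _ p] start_bounds[OF x, of p] by fastforce
  have "(\<lambda>u. prefix (length p) x u) \<in> measurable lam (count_space UNIV)"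
    using measurable_compose[OF measurable_Pair1'[OF assms(1)] measurable_prefix] by simp
  then have "(\<lambda>u. prefix (length p) x u) -` {p} \<inter> space lam \<in> sets lam"
    by (rule measurable_sets) simp
  then have "?A \<in> sets borel" by (simp add: vimage_def sets_lam)
  then show ?thesis
    using weight_nonneg[of p x] by (simp add: emeasure_lam eq)
qed

end

section \<open>The kernel driven by a uniform variable\<close>

context additive_plan begin

text \<open>A uniform variable is turned into bits with the prescribed conditional masses, and the
  resulting code is decoded. This gives a probability measure at every x without an extension
  theorem, and reduces measurability in x to joint measurability in (x, u).\<close>

definition \<Theta> :: "'e \<Rightarrow> 's measure" where
  "\<Theta> x = distr lam borel (\<lambda>u. locate (\<lambda>n. bit n x u))"

sublocale EL: pair_sigma_finite \<eta> lam ..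

lemma measurable_bits [measurable]: "(\<lambda>z n. bit n (fst z) (snd z)) \<in> measurable (\<eta> \<Otimes>\<^sub>M lam) cantor_algebra"
  by (rule measurable_into_cantor[OF measurable_bit])

lemma measurable_locate_bits [measurable]:
  "(\<lambda>z. locate (\<lambda>n. bit n (fst z) (snd z))) \<in> measurable (\<eta> \<Otimes>\<^sub>M lam) borel"
  using measurable_compose[OF measurable_bits measurable_locate] by simp

lemma measurable_locate_bits_section:
  "x \<in> space \<eta> \<Longrightarrow> (\<lambda>u. locate (\<lambda>n. bit n x u)) \<in> measurable lam borel"
  using measurable_compose[OF measurable_Pair1' measurable_locate_bits, of x] by simp

lemma \<Theta>_measurable: "\<Theta> \<in> measurable \<eta> (subprob_algebra borel)"
  unfolding \<Theta>_def[abs_def]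
proof (rule measurable_distr2)
  show "case_prod (\<lambda>x u. locate (\<lambda>n. bit n x u)) \<in> measurable (\<eta> \<Otimes>\<^sub>M lam) borel"
    using measurable_locate_bits by (simp add: split_beta)
  show "(\<lambda>x. lam) \<in> measurable \<eta> (subprob_algebra lam)"
    by (rule measurable_const) (simp add: space_subprob_algebra lam.subprob_space_axioms)
qed

lemma \<Theta>_prob: "x \<in> space \<eta> \<Longrightarrow> prob_space (\<Theta> x)"
  unfolding \<Theta>_def by (rule lam.prob_space_distr[OF measurable_locate_bits_section])

lemma sets_\<Theta> [simp, measurable_cong]: "sets (\<Theta> x) = sets borel" and space_\<Theta> [simp]: "space (\<Theta> x) = UNIV"
  by (simp_all add: \<Theta>_def)

lemma emeasure_\<Theta>_measurable [measurable]:
  "B \<in> sets borel \<Longrightarrow> (\<lambda>x. emeasure (\<Theta> x) B) \<in> borel_measurable \<eta>"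
  by (rule measurable_compose[OF \<Theta>_measurable measurable_emeasure_subprob_algebra])

lemma emeasure_\<Theta>:
  "x \<in> space \<eta> \<Longrightarrow> B \<in> sets borel \<Longrightarrow> emeasure (\<Theta> x) B = emeasure lam {u. locate (\<lambda>n. bit n x u) \<in> B}"
  unfolding \<Theta>_def by (subst emeasure_distr[OF measurable_locate_bits_section]) (auto simp: vimage_def)

lemma measurable_address_\<nu>: "address \<in> measurable \<nu> cantor_algebra"
  using measurable_address by (simp cong: measurable_cong_sets add: sets_\<nu>)

text \<open>Both laws give the cylinder of \<open>p\<close> the mass \<nu>(cell p): averaging
  \<open>weight p\<close> over \<eta> gives \<Lambda> of the whole space and the cell, and cells are
  \<nu>-continuity sets. Random codes are thus distributed like addresses of actual points, although
  \<Lambda> is only finitely additive.\<close>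

lemma law_of_bits:
  "distr (\<eta> \<Otimes>\<^sub>M lam) cantor_algebra (\<lambda>z n. bit n (fst z) (snd z)) = distr \<nu> cantor_algebra address"
proof (rule measure_eqI_generator_eq[OF Int_stable_cylinder, where A = "\<lambda>_. UNIV"])
  fix X assume "X \<in> insert {} (range cylinder)"
  then consider "X = {}" | p where "X = cylinder p" by auto
  then show "emeasure (distr (\<eta> \<Otimes>\<^sub>M lam) cantor_algebra (\<lambda>z n. bit n (fst z) (snd z))) X
      = emeasure (distr \<nu> cantor_algebra address) X"
  proof cases
    case 2
    have "emeasure (distr \<nu> cantor_algebra address) X = emeasure \<nu> (cell p)"
      by (subst emeasure_distr[OF measurable_address_\<nu>]) (auto simp: 2 cell_def space_\<nu>)
    also have "\<dots> = ennreal (\<Lambda> (space \<eta>) (cell p))"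
      by (simp add: \<Lambda>_cell S.emeasure_eq_measure)
    also have "\<dots> = (\<integral>\<^sup>+x\<in>space \<eta>. ennreal (weight p x) \<partial>\<eta>)"
      by (rule weight_integral[symmetric]) simp
    also have "\<dots> = (\<integral>\<^sup>+x. emeasure lam {u. prefix (length p) x u = p} \<partial>\<eta>)"
      by (rule nn_integral_cong_AE) (use AE_consistent AE_space in \<open>eventually_elim; simp add: lam_prefix\<close>)
    also have "\<dots> = (\<integral>\<^sup>+x. emeasure lam (Pair x -` ((\<lambda>z n. bit n (fst z) (snd z)) -` X \<inter> space (\<eta> \<Otimes>\<^sub>M lam))) \<partial>\<eta>)"
      by (intro nn_integral_cong arg_cong2[where f = emeasure] refl)
         (auto simp: 2 cylinder_def prefix_digits space_pair_measure)
    also have "\<dots> = emeasure (\<eta> \<Otimes>\<^sub>M lam) ((\<lambda>z n. bit n (fst z) (snd z)) -` X \<inter> space (\<eta> \<Otimes>\<^sub>M lam))"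
      by (rule lam.emeasure_pair_measure_alt[symmetric])
         (use measurable_sets[OF measurable_bits cylinder_measurable] in \<open>simp add: 2\<close>)
    also have "\<dots> = emeasure (distr (\<eta> \<Otimes>\<^sub>M lam) cantor_algebra (\<lambda>z n. bit n (fst z) (snd z))) X"
      by (rule emeasure_distr[symmetric, OF measurable_bits]) (simp add: 2)
    finally show ?thesis ..
  qed simp
next
  have "cylinder [] = UNIV" by (simp add: cylinder_def)
  then show "range (\<lambda>_::nat. UNIV) \<subseteq> insert {} (range cylinder)" by (metis image_subset_iff insertCI rangeI)
  interpret EL': prob_space "\<eta> \<Otimes>\<^sub>M lam"
    by (intro prob_spaceI) (simp add: space_pair_measure lam.emeasure_pair_measure_Times E.emeasure_space_1 lam.emeasure_space_1[simplified])
  interpret D: prob_space "distr (\<eta> \<Otimes>\<^sub>M lam) cantor_algebra (\<lambda>z n. bit n (fst z) (snd z))"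
    by (rule EL'.prob_space_distr) simp
  show "emeasure (distr (\<eta> \<Otimes>\<^sub>M lam) cantor_algebra (\<lambda>z n. bit n (fst z) (snd z))) UNIV \<noteq> \<infinity>"
    by simp
qed (auto simp: sets_cantor_algebra)

text \<open>The averaged law of random codes is the law of addresses under \<nu>, and
  \<open>locate\<close> inverts \<open>address\<close>.\<close>

lemma \<Theta>_marginal:
  assumes B: "B \<in> sets borel"
  shows "(\<integral>\<^sup>+x. emeasure (\<Theta> x) B \<partial>\<eta>) = emeasure \<nu> B"
proof -
  have L: "locate -` B \<in> sets cantor_algebra"
    using measurable_sets[OF measurable_locate B] by simp
  let ?b = "\<lambda>z n. bit n (fst z) (snd z)"
  have "(\<integral>\<^sup>+x. emeasure (\<Theta> x) B \<partial>\<eta>)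
      = (\<integral>\<^sup>+x. emeasure lam (Pair x -` (?b -` (locate -` B) \<inter> space (\<eta> \<Otimes>\<^sub>M lam))) \<partial>\<eta>)"
    by (intro nn_integral_cong) (simp add: emeasure_\<Theta>[OF _ B] vimage_def space_pair_measure)
  also have "\<dots> = emeasure (\<eta> \<Otimes>\<^sub>M lam) (?b -` (locate -` B) \<inter> space (\<eta> \<Otimes>\<^sub>M lam))"
    by (rule lam.emeasure_pair_measure_alt[symmetric]) (rule measurable_sets[OF measurable_bits L])
  also have "\<dots> = emeasure (distr (\<eta> \<Otimes>\<^sub>M lam) cantor_algebra ?b) (locate -` B)"
    by (rule emeasure_distr[symmetric, OF measurable_bits L])
  also have "\<dots> = emeasure \<nu> (address -` (locate -` B) \<inter> space \<nu>)"
    unfolding law_of_bits by (rule emeasure_distr[OF measurable_address_\<nu> L])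
  also have "address -` (locate -` B) \<inter> space \<nu> = B" by (auto simp: space_\<nu>)
  finally show ?thesis .
qed

text \<open>A code and its decoded point agree about the cell whenever the code is an address. By
  \<open>law_of_bits\<close> this passes from \<nu> to almost every pair (x, u), and by Fubini to
  almost every x.\<close>

lemma AE_\<Theta>_cell: "AE x in \<eta>. emeasure (\<Theta> x) (cell p) = ennreal (weight p x)"
proof -
  let ?b = "\<lambda>z n. bit n (fst z) (snd z)"
  have L: "locate -` cell p \<in> sets cantor_algebra"
    using measurable_sets[OF measurable_locate cell_borel] by simp
  then have P: "{\<omega> \<in> space cantor_algebra. locate \<omega> \<in> cell p \<longleftrightarrow> \<omega> \<in> cylinder p} \<in> sets cantor_algebra"
    by measurable
  have "AE y in \<nu>. locate (address y) \<in> cell p \<longleftrightarrow> address y \<in> cylinder p"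
    by (simp add: cell_def)
  then have "AE \<omega> in distr \<nu> cantor_algebra address. locate \<omega> \<in> cell p \<longleftrightarrow> \<omega> \<in> cylinder p"
    by (subst AE_distr_iff[OF measurable_address_\<nu> P])
  then have "AE z in \<eta> \<Otimes>\<^sub>M lam. locate (?b z) \<in> cell p \<longleftrightarrow> ?b z \<in> cylinder p"
    unfolding law_of_bits[symmetric] by (subst (asm) AE_distr_iff[OF measurable_bits P])
  then have "AE x in \<eta>. AE u in lam. locate (\<lambda>n. bit n x u) \<in> cell p \<longleftrightarrow> (\<lambda>n. bit n x u) \<in> cylinder p"
    using EL.AE_pair by fastforce
  then show ?thesis
    using AE_consistent AE_space
  proof eventually_elim
    fix x
    assume ae: "AE u in lam. locate (\<lambda>n. bit n x u) \<in> cell p \<longleftrightarrow> (\<lambda>n. bit n x u) \<in> cylinder p"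
      and c: "consistent x" and x: "x \<in> space \<eta>"
    have m: "(\<lambda>u n. bit n x u) \<in> measurable lam cantor_algebra"
      using measurable_compose[OF measurable_Pair1'[OF x] measurable_bits] by simp
    have "emeasure (\<Theta> x) (cell p) = emeasure lam {u. locate (\<lambda>n. bit n x u) \<in> cell p}"
      by (rule emeasure_\<Theta>[OF x cell_borel])
    also have "\<dots> = emeasure lam {u. (\<lambda>n. bit n x u) \<in> cylinder p}"
    proof (rule emeasure_eq_AE)
      show "{u. locate (\<lambda>n. bit n x u) \<in> cell p} \<in> sets lam"
        using measurable_sets[OF measurable_locate_bits_section[OF x] cell_borel] by (simp add: vimage_def)
      show "{u. (\<lambda>n. bit n x u) \<in> cylinder p} \<in> sets lam"
        using measurable_sets[OF m cylinder_measurable] by (simp add: vimage_def)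
    qed (use ae in simp)
    also have "\<dots> = ennreal (weight p x)"
      using lam_prefix[OF x c, of p] by (simp add: cylinder_def prefix_digits)
    finally show "emeasure (\<Theta> x) (cell p) = ennreal (weight p x)" .
  qed
qed

section \<open>Agreement of the kernel with the additive plan\<close>

lemma \<Theta>_cell: "A \<in> sets \<eta> \<Longrightarrow> (\<integral>\<^sup>+x\<in>A. emeasure (\<Theta> x) (cell p) \<partial>\<eta>) = ennreal (\<Lambda> A (cell p))"
  using AE_\<Theta>_cell[of p] weight_integral[of A p]
  by (subst nn_integral_cong_AE[of _ "\<lambda>x. ennreal (weight p x) * indicator A x"]) auto

text \<open>A finite sum over the disjoint cells that make up \<open>B\<close>; no limit is taken,
  so finite additivity of \<Lambda> suffices.\<close>

lemma \<Theta>_saturated: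
  assumes "saturated n B" and A: "A \<in> sets \<eta>"
  shows "(\<integral>\<^sup>+x\<in>A. emeasure (\<Theta> x) B \<partial>\<eta>) = ennreal (\<Lambda> A B)"
proof -
  define P where "P = {p. length p = n \<and> cell p \<inter> B \<noteq> {}}"
  have "finite P" unfolding P_def by (rule finite_cells)
  have disj: "cell p \<inter> cell q = {}" if "p \<in> P" "q \<in> P" "p \<noteq> q" for p q
    using that by (auto simp: P_def cell_def cylinder_def)
  have "F \<subseteq> P \<Longrightarrow> (\<integral>\<^sup>+x\<in>A. emeasure (\<Theta> x) (\<Union>(cell ` F)) \<partial>\<eta>) = ennreal (\<Lambda> A (\<Union>(cell ` F)))"
    if "finite F" for F
    using that
  proof (induction F)
    case empty
    then show ?case by (simp add: \<Lambda>_empty[OF A])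
  next
    case (insert p F)
    have d: "cell p \<inter> \<Union> (cell ` F) = {}" using insert disj by blast
    have m: "\<Union> (cell ` F) \<in> sets borel" using insert by (intro sets.finite_UN) auto
    have "(\<integral>\<^sup>+x\<in>A. emeasure (\<Theta> x) (cell p \<union> \<Union>(cell ` F)) \<partial>\<eta>)
        = (\<integral>\<^sup>+x. emeasure (\<Theta> x) (cell p) * indicator A x + emeasure (\<Theta> x) (\<Union>(cell ` F)) * indicator A x \<partial>\<eta>)"
      using d m by (intro nn_integral_cong) (simp add: plus_emeasure[symmetric] distrib_right)
    also have "\<dots> = ennreal (\<Lambda> A (cell p)) + ennreal (\<Lambda> A (\<Union>(cell ` F)))"
      using insert A m by (subst nn_integral_add) (auto simp: \<Theta>_cell)
    also have "\<dots> = ennreal (\<Lambda> A (cell p \<union> \<Union>(cell ` F)))"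
      using add_right[OF A d] nonneg[OF A] by simp
    finally show ?case by simp
  qed
  from this[OF \<open>finite P\<close> subset_refl] show ?thesis
    using saturated_decomp[OF assms(1), folded P_def] by metis
qed

text \<open>Only an inequality: along the increasing saturated sets \<open>H m\<close> monotone
  convergence is available for the kernel, but only monotonicity for the finitely additive
  \<Lambda>.\<close>

lemma \<Theta>_open:
  assumes "open G" and A: "A \<in> sets \<eta>"
  shows "(\<integral>\<^sup>+x\<in>A. emeasure (\<Theta> x) G \<partial>\<eta>) \<le> ennreal (\<Lambda> A G)"
proof -
  define H where "H m = (\<Union>k\<in>{k. k < m \<and> U k \<subseteq> G}. U k)" for m :: nat
  have sat: "saturated m (H m)" for m
    unfolding H_def by (rule saturated_UN) (auto intro: saturated_U)
  have G: "G = (\<Union>m. H m)"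
    using open_eq_Union_balls[OF base assms(1)] unfolding H_def U_def by blast
  have inc: "incseq H" unfolding incseq_def H_def by force
  have Hb: "H m \<in> sets borel" for m by (rule saturated_borel[OF sat])
  have "emeasure (\<Theta> x) G = (SUP m. emeasure (\<Theta> x) (H m))" for x
    unfolding G by (rule SUP_emeasure_incseq[symmetric]) (use inc Hb in auto)
  then have "(\<integral>\<^sup>+x\<in>A. emeasure (\<Theta> x) G \<partial>\<eta>) = (\<integral>\<^sup>+x. (SUP m. emeasure (\<Theta> x) (H m) * indicator A x) \<partial>\<eta>)"
    by (simp add: SUP_mult_right_ennreal)
  also have "\<dots> = (SUP m. \<integral>\<^sup>+x\<in>A. emeasure (\<Theta> x) (H m) \<partial>\<eta>)"
  proof (rule nn_integral_monotone_convergence_SUP)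
    show "incseq (\<lambda>m x. emeasure (\<Theta> x) (H m) * indicator A x)"
      using inc Hb by (auto simp: incseq_def le_fun_def intro!: mult_right_mono emeasure_mono)
  qed (use A Hb in measurable)
  also have "\<dots> \<le> ennreal (\<Lambda> A G)"
  proof (rule SUP_least)
    fix m
    have "H m \<subseteq> G" using G by blast
    then show "(\<integral>\<^sup>+x\<in>A. emeasure (\<Theta> x) (H m) \<partial>\<eta>) \<le> ennreal (\<Lambda> A G)"
      using \<Theta>_saturated[OF sat A, of m] \<Lambda>_mono[OF A] by (simp add: ennreal_leI)
  qed
  finally show ?thesis .
qed

text \<open>The frontier is null for almost every kernel measure, since the average of its masses is
  its \<nu>-mass. Hence \<open>B\<close> may be replaced by its interior and
  \<open>\<Theta>_open\<close> gives one inequality. The complement satisfies the same one, and the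
  equal totals leave room for neither to be strict.\<close>

lemma \<Theta>_continuity_set:
  assumes B: "B \<in> sets borel" and "frontier B \<in> null_sets \<nu>" and A: "A \<in> sets \<eta>"
  shows "(\<integral>\<^sup>+x\<in>A. emeasure (\<Theta> x) B \<partial>\<eta>) = ennreal (\<Lambda> A B)"
proof -
  have le: "(\<integral>\<^sup>+x\<in>A. emeasure (\<Theta> x) C \<partial>\<eta>) \<le> ennreal (\<Lambda> A C)"
    if C: "C \<in> sets borel" "frontier C \<in> null_sets \<nu>" for C
  proof -
    have fb: "frontier C \<in> sets borel" by (simp add: borel_closed)
    have "(\<integral>\<^sup>+x. emeasure (\<Theta> x) (frontier C) \<partial>\<eta>) = 0"
      using \<Theta>_marginal[OF fb] null_setsD1[OF C(2)] by simp
    then have "AE x in \<eta>. emeasure (\<Theta> x) (frontier C) = 0"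
      by (subst (asm) nn_integral_0_iff_AE) (use fb in measurable)
    then have "AE x in \<eta>. emeasure (\<Theta> x) C \<le> emeasure (\<Theta> x) (interior C)"
    proof eventually_elim
      fix x assume "emeasure (\<Theta> x) (frontier C) = 0"
      then have f: "frontier C \<in> null_sets (\<Theta> x)" using fb by (auto simp: null_sets_def)
      have "emeasure (\<Theta> x) C \<le> emeasure (\<Theta> x) (interior C \<union> frontier C)"
        using fb closure_subset[of C] by (intro emeasure_mono) (auto simp: frontier_def borel_open)
      also have "\<dots> = emeasure (\<Theta> x) (interior C)"
        using f by (intro emeasure_Un_null_set) (auto simp: borel_open)
      finally show "emeasure (\<Theta> x) C \<le> emeasure (\<Theta> x) (interior C)" .
    qed
    then have "AE x in \<eta>. emeasure (\<Theta> x) C * indicator A x \<le> emeasure (\<Theta> x) (interior C) * indicator A x"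
      by eventually_elim (rule mult_right_mono, simp_all)
    then have "(\<integral>\<^sup>+x\<in>A. emeasure (\<Theta> x) C \<partial>\<eta>) \<le> (\<integral>\<^sup>+x\<in>A. emeasure (\<Theta> x) (interior C) \<partial>\<eta>)"
      by (rule nn_integral_mono_AE)
    also have "\<dots> \<le> ennreal (\<Lambda> A (interior C))" by (rule \<Theta>_open[OF open_interior A])
    also have "\<dots> \<le> ennreal (\<Lambda> A C)" by (intro ennreal_leI \<Lambda>_mono[OF A] interior_subset)
    finally show ?thesis .
  qed
  let ?I = "\<lambda>C. \<integral>\<^sup>+x\<in>A. emeasure (\<Theta> x) C \<partial>\<eta>"
  have "?I B + ?I (- B) = (\<integral>\<^sup>+x. emeasure (\<Theta> x) B * indicator A x + emeasure (\<Theta> x) (- B) * indicator A x \<partial>\<eta>)"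
    by (rule nn_integral_add[symmetric]) (use A B in \<open>auto intro!: borel_measurable_times\<close>)
  also have "\<dots> = (\<integral>\<^sup>+x\<in>A. 1 \<partial>\<eta>)"
  proof (rule nn_integral_cong)
    fix x assume x: "x \<in> space \<eta>"
    have "emeasure (\<Theta> x) B + emeasure (\<Theta> x) (- B) = emeasure (\<Theta> x) UNIV"
      using B by (subst plus_emeasure) auto
    then show "emeasure (\<Theta> x) B * indicator A x + emeasure (\<Theta> x) (- B) * indicator A x = 1 * indicator A x"
      using prob_space.emeasure_space_1[OF \<Theta>_prob[OF x]] by (simp add: distrib_right[symmetric])
  qed
  also have "\<dots> = ennreal (\<Lambda> A B) + ennreal (\<Lambda> A (- B))"
    using A \<Lambda>_Compl[OF A, of B] nonneg[OF A]
    by (simp add: E.emeasure_eq_measure flip: ennreal_plus)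
  finally have sum: "?I B + ?I (- B) = ennreal (\<Lambda> A B) + ennreal (\<Lambda> A (- B))" .
  have l1: "?I B \<le> ennreal (\<Lambda> A B)" and l2: "?I (- B) \<le> ennreal (\<Lambda> A (- B))"
    using assms by (auto intro!: le simp: frontier_complement)
  \<comment> \<open>Both integrals are finite, so the comparison can be made in the reals, where
    cancellation is allowed.\<close>
  obtain b where b: "?I B = ennreal b" "0 \<le> b" using l1 by (cases "?I B") (auto simp: top_unique)
  obtain b' where b': "?I (- B) = ennreal b'" "0 \<le> b'" using l2 by (cases "?I (- B)") (auto simp: top_unique)
  have "ennreal (b + b') = ennreal (\<Lambda> A B + \<Lambda> A (- B))"
    using sum b b' nonneg[OF A] by simp
  then have "b + b' = \<Lambda> A B + \<Lambda> A (- B)"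
    using b(2) b'(2) nonneg[OF A] by (simp add: ennreal_inj add_nonneg_nonneg del: ennreal_plus)
  moreover have "b \<le> \<Lambda> A B" "b' \<le> \<Lambda> A (- B)"
    using l1 l2 b b' nonneg[OF A] by (simp_all add: ennreal_le_iff)
  ultimately show ?thesis using b by simp
qed

end

section \<open>Conditioning on completed sigma-fields\<close>

text \<open>Bounded measurable functions are uniform limits of simple ones, and the bound makes the
  functional continuous for the supremum norm. This lifts identities from sets A to bounded
  functions of x while the set B in the other variable stays fixed.\<close>

lemma bounded_functional_eq_zero:
  fixes \<l> :: "('a \<Rightarrow> real) \<Rightarrow> real"
  assumes add: "\<And>f g. f \<in> borel_measurable M \<Longrightarrow> g \<in> borel_measurable M \<Longrightarrow> bounded (range f) \<Longrightarrow>
        bounded (range g) \<Longrightarrow> \<l> (\<lambda>x. f x + g x) = \<l> f + \<l> g"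
    and cmult: "\<And>f a. f \<in> borel_measurable M \<Longrightarrow> bounded (range f) \<Longrightarrow> \<l> (\<lambda>x. a * f x) = a * \<l> f"
    and bound: "\<And>f b. f \<in> borel_measurable M \<Longrightarrow> (\<And>x. \<bar>f x\<bar> \<le> b) \<Longrightarrow> \<bar>\<l> f\<bar> \<le> K * b"
    and indicator: "\<And>A. A \<in> sets M \<Longrightarrow> \<l> (indicator A) = 0"
    and f: "f \<in> borel_measurable M" "bounded (range f)"
    and space: "space M = UNIV"
  shows "\<l> f = 0"
proof -
  obtain b where b: "\<And>x. \<bar>f x\<bar> \<le> b" using f(2) by (auto simp: bounded_iff)
  have small: "\<bar>\<l> f\<bar> \<le> K * e" if e: "e > 0" for e
  proof -
    define s where "s k = (\<lambda>x. indicator {x. \<lfloor>f x / e\<rfloor> = k} x :: real)" for k :: int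
    have m: "{x. \<lfloor>f x / e\<rfloor> = k} \<in> sets M" for k
    proof -
      have "{x\<in>space M. \<lfloor>f x / e\<rfloor> = k} \<in> sets M" using f(1) by measurable
      then show ?thesis by (simp add: space)
    qed
    have bs: "bounded (range (s k))" for k
      by (auto simp: bounded_iff s_def indicator_def intro!: exI[of _ 1])
    have ms: "s k \<in> borel_measurable M" for k unfolding s_def using m by simp
    have sum: "\<l> (\<lambda>x. \<Sum>k\<in>F. (real_of_int k * e) * s k x) = 0 \<and> bounded (range (\<lambda>x. \<Sum>k\<in>F. (real_of_int k * e) * s k x))"
      if "finite F" for F
      using that
    proof (induction F)
      case empty
      have "\<l> (indicator {}) = 0" by (rule indicator) simp
      then show ?case by (simp add: indicator_def[abs_def])
    next
      case (insert k F)
      have b1: "bounded (range (\<lambda>x. (real_of_int k * e) * s k x))"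
        using bounded_scaleR_comp[OF bs[of k], of "real_of_int k * e"] by simp
      have m1: "(\<lambda>x. \<Sum>k\<in>F. (real_of_int k * e) * s k x) \<in> borel_measurable M"
        using ms by measurable
      have "\<l> (\<lambda>x. (real_of_int k * e) * s k x) = 0"
        using cmult[OF ms bs] indicator[OF m[of k]] by (simp add: s_def)
      moreover have "\<l> (\<lambda>x. (real_of_int k * e) * s k x + (\<Sum>k\<in>F. (real_of_int k * e) * s k x))
          = \<l> (\<lambda>x. (real_of_int k * e) * s k x) + \<l> (\<lambda>x. \<Sum>k\<in>F. (real_of_int k * e) * s k x)"
        using insert.IH b1 m1 ms by (intro add) auto
      moreover have "bounded (range (\<lambda>x. (real_of_int k * e) * s k x + (\<Sum>k\<in>F. (real_of_int k * e) * s k x)))"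
        using bounded_plus_comp[OF b1] insert.IH by blast
      ultimately show ?case using insert by simp
    qed
    \<comment> \<open>Boundedness of \<open>f\<close> leaves finitely many levels of mesh
      \<open>e\<close>; rounding down to a level costs at most \<open>e\<close>.\<close>
    define F where "F = {\<lfloor>- b / e\<rfloor>..\<lfloor>b / e\<rfloor>}"
    define g where "g = (\<lambda>x. \<Sum>k\<in>F. (real_of_int k * e) * s k x)"
    have gx: "g x = real_of_int \<lfloor>f x / e\<rfloor> * e" for x
    proof -
      have "- b \<le> f x" "f x \<le> b" using b[of x] by auto
      then have "- b / e \<le> f x / e" "f x / e \<le> b / e"
        using e divide_right_mono[of "- b" "f x" e] by (auto intro: divide_right_mono)
      then have "\<lfloor>f x / e\<rfloor> \<in> F" unfolding F_def by (auto intro: floor_mono)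
      moreover have "g x = (\<Sum>k\<in>F. if \<lfloor>f x / e\<rfloor> = k then real_of_int k * e else 0)"
        unfolding g_def s_def by (intro sum.cong) (auto simp: indicator_def)
      ultimately show ?thesis by (simp add: F_def)
    qed
    have "g \<in> borel_measurable M" unfolding g_def using ms by measurable
    moreover have "bounded (range g)" "\<l> g = 0" using sum[of F] unfolding g_def F_def by auto
    moreover have "bounded (range (\<lambda>x. - 1 * g x))"
      using bounded_scaleR_comp[OF \<open>bounded (range g)\<close>, of "-1"] by simp
    ultimately have "\<l> (\<lambda>x. f x + - 1 * g x) = \<l> f + \<l> (\<lambda>x. - 1 * g x)" "\<l> (\<lambda>x. - 1 * g x) = 0"
      using f by (intro add, simp_all) (simp add: cmult[of g "-1", simplified])
    moreover have "\<bar>\<l> (\<lambda>x. f x + - 1 * g x)\<bar> \<le> K * e"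
    proof (rule bound)
      show "(\<lambda>x. f x + - 1 * g x) \<in> borel_measurable M" using f(1) \<open>g \<in> borel_measurable M\<close> by measurable
      fix x
      have "real_of_int \<lfloor>f x / e\<rfloor> \<le> f x / e" "f x / e < real_of_int \<lfloor>f x / e\<rfloor> + 1" by linarith+
      then have "real_of_int \<lfloor>f x / e\<rfloor> * e \<le> f x" "f x < real_of_int \<lfloor>f x / e\<rfloor> * e + e"
        using e mult_right_mono[of _ "f x / e" e] mult_strict_right_mono[of "f x / e" _ e]
        by (fastforce simp: distrib_right)+
      then show "\<bar>f x + - 1 * g x\<bar> \<le> e" by (simp add: gx)
    qed
    ultimately show ?thesis by simp
  qed
  have "((\<lambda>e. K * e) \<longlongrightarrow> K * 0) (at_right 0)"
    by (intro tendsto_intros)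
  then have "\<bar>\<l> f\<bar> \<le> K * 0"
    by (rule tendsto_lowerbound) (auto simp: eventually_at_right_less small intro: eventually_mono[OF eventually_at_right_less])
  then show ?thesis by simp
qed

definition cond_algebra :: "'a measure \<Rightarrow> 'a set set \<Rightarrow> 'a measure" where
  "cond_algebra \<eta> G = sigma UNIV (sigma_completion \<eta> G)"

lemma space_cond_algebra [simp]: "space (cond_algebra \<eta> G) = UNIV"
  by (simp add: cond_algebra_def space_measure_of_conv)

lemma sets_cond_algebra [simp]: "sets (cond_algebra \<eta> G) = sigma_completion \<eta> G"
  by (simp add: cond_algebra_def sigma_completion_def sigma_sets_sigma_sets_eq)

lemma sigma_completion_null: "N \<in> null_sets (completion \<eta>) \<Longrightarrow> N \<in> sigma_completion \<eta> G"
  by (simp add: sigma_completion_def sigma_sets.Basic)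

lemma sigma_completion_Basic: "A \<in> G \<Longrightarrow> A \<in> sigma_completion \<eta> G"
  by (simp add: sigma_completion_def sigma_sets.Basic)

locale conditioning = prob_space \<eta> for \<eta> :: "'e::topological_space measure" +
  fixes G :: "'e set set"
  assumes sets_\<eta>: "sets \<eta> = sets borel" and G: "G \<subseteq> sets borel"
begin

abbreviation F where "F \<equiv> cond_algebra \<eta> G"
abbreviation E where "E \<equiv> real_cond_exp (completion \<eta>) F"

lemma space_\<eta> [simp]: "space \<eta> = UNIV"
  using sets_eq_imp_space_eq[OF sets_\<eta>] by simp

sublocale c: prob_space "completion \<eta>"
proof (rule prob_spaceI)
  have "UNIV \<in> sets \<eta>" using sets.top[of \<eta>] by simp
  then show "emeasure (completion \<eta>) (space (completion \<eta>)) = 1"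
    using emeasure_space_1 emeasure_completion[OF sets_completionI_sets, of UNIV \<eta>] by simp
qed

sublocale c: finite_measure_subalgebra "completion \<eta>" F
proof
  have "G \<union> null_sets (completion \<eta>) \<subseteq> sets (completion \<eta>)"
    using G sets_\<eta> by (auto intro: sets_completionI_sets)
  then have "sigma_completion \<eta> G \<subseteq> sets (completion \<eta>)"
    using sets.sigma_sets_subset[of _ "completion \<eta>"] by (simp add: sigma_completion_def)
  then show "subalgebra (completion \<eta>) F" by (simp add: subalgebra_def)
qed

lemma integrable_L_infty:
  fixes X :: "'e \<Rightarrow> real"
  assumes "X \<in> borel_measurable (completion \<eta>)" "AE x in \<eta>. \<bar>X x\<bar> \<le> K"
  shows "integrable (completion \<eta>) X"
  using assms by (intro c.integrable_const_bound[of _ K]) (auto simp: AE_completion_iff)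

text \<open>A bounded \<open>F\<close>-measurable factor \<open>W\<close> can be moved through the
  conditional expectation of \<open>X\<close>. This is what makes the maps in \<open>H_maps\<close>
  integrate to zero under causal plans.\<close>

lemma orthogonal_residual:
  assumes X: "X \<in> L_infty \<eta>" and W: "W \<in> borel_measurable F" "W \<in> borel_measurable \<eta>" "\<And>x. \<bar>W x\<bar> \<le> K"
    and g: "g \<in> borel_measurable \<eta>" "AE x in \<eta>. g x = X x - E X x"
  shows "(\<integral>x. g x * W x \<partial>\<eta>) = 0"
proof -
  obtain KX where X': "X \<in> borel_measurable \<eta>" "AE x in \<eta>. \<bar>X x\<bar> \<le> KX" using X by (auto simp: L_infty_def)
  note cX = measurable_completion[OF X'(1)] and cW = measurable_completion[OF W(2)]
    and cg = measurable_completion[OF g(1)]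
  have "K \<ge> 0" using W(3)[of undefined] by simp
  have i: "integrable (completion \<eta>) (\<lambda>x. W x * X x)"
  proof (rule integrable_L_infty)
    show "AE x in \<eta>. \<bar>W x * X x\<bar> \<le> K * KX"
      using X'(2) by eventually_elim (use W(3) \<open>K \<ge> 0\<close> in \<open>auto simp: abs_mult intro!: mult_mono\<close>)
  qed (use cX cW in measurable)
  note ci = c.real_cond_exp_intg[OF i W(1) cX]
  have "(\<integral>x. g x * W x \<partial>\<eta>) = (\<integral>x. g x * W x \<partial>completion \<eta>)"
    by (rule integral_completion[symmetric]) (use g W in measurable)
  also have "\<dots> = (\<integral>x. W x * X x - W x * E X x \<partial>completion \<eta>)"
  proof (rule integral_cong_AE)
    show "AE x in completion \<eta>. g x * W x = W x * X x - W x * E X x"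
      unfolding AE_completion_iff using g(2)
      by eventually_elim (simp add: left_diff_distrib right_diff_distrib mult.commute)
  qed (use cX cW cg in measurable)
  also have "\<dots> = 0" using i ci by simp
  finally show ?thesis .
qed

text \<open>\<open>H_maps\<close> asks for a Borel map that is bounded everywhere, while a
  conditional expectation over the completion is in general neither Borel nor bounded. A Borel
  version exists, and since |X| and |E X| are at most K almost everywhere, clipping it at 2K alters
  it on a null set only.\<close>

lemma L_infty_residual:
  assumes X: "X \<in> borel_measurable \<eta>" "\<And>x. \<bar>X x\<bar> \<le> K"
  obtains g where "g \<in> borel_measurable \<eta>" "bounded (range g)" "AE x in \<eta>. g x = X x - E X x"
proof -
  have i: "integrable (completion \<eta>) X"
    using X measurable_completion by (intro integrable_L_infty[of _ K]) auto
  have "AE x in completion \<eta>. - K \<le> E X x" "AE x in completion \<eta>. E X x \<le> K"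
    using X(2) by (auto intro!: c.real_cond_exp_ge_c[OF i] c.real_cond_exp_le_c[OF i] simp: abs_le_iff minus_le_iff)
  then have b: "AE x in \<eta>. - K \<le> E X x" "AE x in \<eta>. E X x \<le> K" unfolding AE_completion_iff by auto
  have "(\<lambda>x. X x - E X x) \<in> borel_measurable (completion \<eta>)"
    using measurable_completion[OF X(1)] by measurable
  then obtain g where g: "g \<in> borel_measurable \<eta>" "AE x in \<eta>. X x - E X x = g x"
    using completion_ex_borel_measurable_real by blast
  show thesis
  proof (rule that[of "\<lambda>x. max (- 2 * K) (min (2 * K) (g x))"])
    show "(\<lambda>x. max (- 2 * K) (min (2 * K) (g x))) \<in> borel_measurable \<eta>" using g(1) by measurable
    show "bounded (range (\<lambda>x. max (- 2 * K) (min (2 * K) (g x))))"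
      unfolding bounded_iff by (intro exI[of _ "\<bar>2 * K\<bar>"]) auto
    show "AE x in \<eta>. max (- 2 * K) (min (2 * K) (g x)) = X x - E X x"
      using g(2) b
    proof eventually_elim
      fix x assume "X x - E X x = g x" "- K \<le> E X x" "E X x \<le> K"
      moreover have "- K \<le> X x" "X x \<le> K" using X(2)[of x] by auto
      ultimately show "max (- 2 * K) (min (2 * K) (g x)) = X x - E X x" by (simp add: max_def min_def)
    qed
  qed
qed

text \<open>All null sets of the completion belong to the completed sigma-field, so changes on a
  null set do not affect measurability.\<close>

lemma measurable_cond_algebra_AE:
  fixes W Y :: "'e \<Rightarrow> real"
  assumes Y: "Y \<in> borel_measurable F" and ae: "AE x in completion \<eta>. W x = Y x"
  shows "W \<in> borel_measurable F"
proof (rule measurableI)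
  fix A :: "real set" assume A: "A \<in> sets borel"
  obtain N where N: "N \<in> null_sets (completion \<eta>)" "{x. W x \<noteq> Y x} \<subseteq> N"
    using ae unfolding eventually_ae_filter by auto
  have "W -` A \<inter> N \<in> null_sets (completion \<eta>)"
    by (rule null_sets_completion_subset[OF _ N(1)]) auto
  then have 1: "W -` A \<inter> N \<in> sets F" by (simp add: sigma_completion_null)
  have 2: "Y -` A \<in> sets F" using measurable_sets[OF Y A] by simp
  have 3: "N \<in> sets F" using N(1) by (simp add: sigma_completion_null)
  have "(Y -` A - N) \<union> (W -` A \<inter> N) \<in> sets F" by (intro sets.Un sets.Diff 1 2 3)
  moreover have "W -` A = (Y -` A - N) \<union> (W -` A \<inter> N)" using N(2) by auto
  ultimately show "W -` A \<inter> space F \<in> sets F" by simp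
qed simp

text \<open>Converse of \<open>orthogonal_residual\<close>, tested on the residual of
  \<open>W\<close> itself: it is orthogonal to \<open>E W\<close> in any case and to
  \<open>W\<close> by assumption, so its square has integral zero and \<open>W\<close> equals
  \<open>E W\<close> almost everywhere.\<close>

lemma measurable_if_orthogonal:
  assumes W: "W \<in> borel_measurable \<eta>" "\<And>x. \<bar>W x\<bar> \<le> K"
    and orth: "\<And>g. g \<in> borel_measurable \<eta> \<Longrightarrow> bounded (range g) \<Longrightarrow> AE x in \<eta>. g x = W x - E W x \<Longrightarrow>
      (\<integral>x. g x * W x \<partial>\<eta>) = 0"
  shows "W \<in> borel_measurable F"
proof -
  obtain g where g: "g \<in> borel_measurable \<eta>" "bounded (range g)" "AE x in \<eta>. g x = W x - E W x"
    by (rule L_infty_residual[OF W])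
  obtain b where b: "\<And>x. \<bar>g x\<bar> \<le> b" using g(2) by (auto simp: bounded_iff)
  have "K \<ge> 0" "b \<ge> 0" using W(2)[of undefined] b[of undefined] by auto
  note cW = measurable_completion[OF W(1)] and cg = measurable_completion[OF g(1)]
  have ae: "AE x in completion \<eta>. g x = W x - E W x" using g(3) by (simp add: AE_completion_iff)
  have iW: "integrable (completion \<eta>) W"
    using W by (intro integrable_L_infty[of _ K] cW) auto
  have EW: "AE x in \<eta>. \<bar>E W x\<bar> \<le> b + K"
    using g(3)
  proof eventually_elim
    fix x assume "g x = W x - E W x"
    then show "\<bar>E W x\<bar> \<le> b + K" using b[of x] W(2)[of x] by linarith
  qed
  have i1: "integrable (completion \<eta>) (\<lambda>x. E W x * W x)"
  proof (rule integrable_L_infty)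
    show "AE x in \<eta>. \<bar>E W x * W x\<bar> \<le> (b + K) * K"
      using EW by eventually_elim (use W(2) \<open>K \<ge> 0\<close> \<open>b \<ge> 0\<close> in \<open>auto simp: abs_mult intro!: mult_mono\<close>)
  qed (use cW in measurable)
  have "E W \<in> borel_measurable F" by simp
  note ci = c.real_cond_exp_intg[OF i1 this cW]
  have i2: "integrable (completion \<eta>) (\<lambda>x. g x * W x)"
  proof (rule integrable_L_infty)
    show "AE x in \<eta>. \<bar>g x * W x\<bar> \<le> b * K"
      using W(2) b \<open>K \<ge> 0\<close> \<open>b \<ge> 0\<close> by (auto simp: abs_mult intro!: mult_mono)
  qed (use cW cg in measurable)
  \<comment> \<open>The bracket on the right integrates to zero, by the defining property of the
    conditional expectation with the factor \<open>E W\<close>.\<close>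
  have "(\<integral>x. (W x - E W x)\<^sup>2 \<partial>completion \<eta>)
      = (\<integral>x. g x * W x - (E W x * W x - E W x * E W x) \<partial>completion \<eta>)"
  proof (rule integral_cong_AE)
    show "AE x in completion \<eta>. (W x - E W x)\<^sup>2 = g x * W x - (E W x * W x - E W x * E W x)"
      using ae
      by eventually_elim (simp add: power2_eq_square left_diff_distrib right_diff_distrib mult.commute)
  qed (use cW cg in measurable)
  also have "\<dots> = (\<integral>x. g x * W x \<partial>completion \<eta>)"
    using i1 i2 ci by simp
  also have "\<dots> = (\<integral>x. g x * W x \<partial>\<eta>)" by (rule integral_completion) (use g W in measurable)
  also have "\<dots> = 0" by (rule orth[OF g])
  finally have z: "(\<integral>x. (W x - E W x)\<^sup>2 \<partial>completion \<eta>) = 0" .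
  have i3: "integrable (completion \<eta>) (\<lambda>x. g x * W x - (E W x * W x - E W x * E W x))"
    using i1 i2 ci by simp
  have "integrable (completion \<eta>) (\<lambda>x. (W x - E W x)\<^sup>2)"
  proof (rule integrable_cong_AE_imp[OF i3])
    show "AE x in completion \<eta>. g x * W x - (E W x * W x - E W x * E W x) = (W x - E W x)\<^sup>2"
      using ae
      by eventually_elim (simp add: power2_eq_square left_diff_distrib right_diff_distrib mult.commute)
  qed (use cW in measurable)
  then have "AE x in completion \<eta>. (W x - E W x)\<^sup>2 = 0"
    using z by (subst (asm) integral_nonneg_eq_0_iff_AE) auto
  then have "AE x in completion \<eta>. W x = E W x" by eventually_elim simp
  then show ?thesis by (rule measurable_cond_algebra_AE[rotated]) simp
qed

end

section \<open>Causal kernels and weak duality\<close>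

lemma borel_fst [measurable]: "fst \<in> measurable (borel :: ('a::topological_space \<times> 'b::topological_space) measure) borel"
  and borel_snd [measurable]: "snd \<in> measurable (borel :: ('a::topological_space \<times> 'b::topological_space) measure) borel"
  by (auto intro!: borel_measurable_continuous_onI continuous_intros)

lemma borel_probsD:
  assumes "\<mu> \<in> borel_probs"
  shows "prob_space \<mu>" "sets \<mu> = sets borel" "space \<mu> = UNIV"
  using assms sets_eq_imp_space_eq[of \<mu> borel] by (auto simp: borel_probs_def)

lemma transference_plansD:
  assumes "\<gamma> \<in> transference_plans \<eta> \<nu>"
  shows "\<gamma> \<in> borel_probs" "distr \<gamma> borel fst = \<eta>" "distr \<gamma> borel snd = \<nu>"
  using assms by (auto simp: transference_plans_def)

text \<open>Both integrals are linear in \<open>f\<close> and bounded by its supremum, and the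
  kernel equation makes them agree on indicators. The constant 2 below adds the two bounds.\<close>

lemma kernel_integral:
  fixes \<eta> :: "'e::topological_space measure" and \<gamma> :: "('e \<times> 's::topological_space) measure"
  assumes \<eta>: "\<eta> \<in> borel_probs" and \<gamma>: "\<gamma> \<in> borel_probs" and ker: "is_kernel \<eta> \<gamma> \<Theta>"
    and B: "B \<in> sets borel" and f: "f \<in> borel_measurable borel" "bounded (range f)"
  shows "integrable \<gamma> (\<lambda>z. f (fst z) * indicator B (snd z))"
    and "(\<integral>z. f (fst z) * indicator B (snd z) \<partial>\<gamma>) = (\<integral>x. f x * measure (\<Theta> x) B \<partial>\<eta>)"
proof -
  interpret E: prob_space \<eta> using borel_probsD[OF \<eta>] by simp
  interpret G: prob_space \<gamma> using borel_probsD[OF \<gamma>] by simp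
  note [measurable_cong] = borel_probsD(2)[OF \<eta>] borel_probsD(2)[OF \<gamma>]
  note [simp] = borel_probsD(3)[OF \<eta>] borel_probsD(3)[OF \<gamma>]
  have [measurable]: "(\<lambda>x. measure (\<Theta> x) B) \<in> borel_measurable borel"
    using ker B unfolding is_kernel_def by blast
  have W: "\<bar>measure (\<Theta> x) B\<bar> \<le> 1" for x
    using ker prob_space.prob_le_1[of "\<Theta> x" B] unfolding is_kernel_def borel_probs_def by auto
  note [measurable] = B
  have i1: "integrable \<gamma> (\<lambda>z. f (fst z) * indicator B (snd z))"
    if [measurable]: "f \<in> borel_measurable borel" and b: "bounded (range f)" for f :: "'e \<Rightarrow> real"
  proof -
    obtain b where "\<And>x. \<bar>f x\<bar> \<le> b" using b by (auto simp: bounded_iff)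
    then show ?thesis
      by (intro G.integrable_const_bound[of _ b]) (auto simp: indicator_def intro: order_trans[OF abs_ge_zero])
  qed
  have i2: "integrable \<eta> (\<lambda>x. f x * measure (\<Theta> x) B)"
    if [measurable]: "f \<in> borel_measurable borel" and b: "bounded (range f)" for f :: "'e \<Rightarrow> real"
  proof -
    obtain b where b: "\<And>x. \<bar>f x\<bar> \<le> b" using b by (auto simp: bounded_iff)
    have "\<bar>f x * measure (\<Theta> x) B\<bar> \<le> b * 1" for x
      unfolding abs_mult by (intro mult_mono b W) (use b[of x] in auto)
    then show ?thesis by (intro E.integrable_const_bound[of _ b]) auto
  qed
  show "integrable \<gamma> (\<lambda>z. f (fst z) * indicator B (snd z))" by (rule i1[OF f])
  have fe: "f \<in> borel_measurable \<eta> \<longleftrightarrow> f \<in> borel_measurable borel" for f :: "'e \<Rightarrow> real"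
    by (simp cong: measurable_cong_sets add: borel_probsD(2)[OF \<eta>])
  define \<l> where "\<l> f = (\<integral>z. f (fst z) * indicator B (snd z) \<partial>\<gamma>) - (\<integral>x. f x * measure (\<Theta> x) B \<partial>\<eta>)"
    for f :: "'e \<Rightarrow> real"
  have "\<l> f = 0"
  proof (rule bounded_functional_eq_zero[where \<l> = \<l> and f = f and M = \<eta> and K = 2])
    fix f :: "'e \<Rightarrow> real" and a
    assume f: "f \<in> borel_measurable \<eta>" "bounded (range f)"
    show "\<l> (\<lambda>x. a * f x) = a * \<l> f"
      by (simp add: \<l>_def mult.assoc right_diff_distrib)
  next
    fix f g :: "'e \<Rightarrow> real"
    assume "f \<in> borel_measurable \<eta>" "g \<in> borel_measurable \<eta>" "bounded (range f)" "bounded (range g)"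
    then show "\<l> (\<lambda>x. f x + g x) = \<l> f + \<l> g"
      using i1[of f] i1[of g] i2[of f] i2[of g] by (simp add: \<l>_def fe distrib_right)
  next
    fix f :: "'e \<Rightarrow> real" and b
    assume f: "f \<in> borel_measurable \<eta>" and b: "\<And>x. \<bar>f x\<bar> \<le> b"
    have f': "f \<in> borel_measurable borel" "bounded (range f)" using f b by (auto simp: fe bounded_iff)
    have b0: "0 \<le> b" using b[of undefined] by simp
    have "\<bar>\<integral>z. f (fst z) * indicator B (snd z) \<partial>\<gamma>\<bar> \<le> (\<integral>z. \<bar>f (fst z) * indicator B (snd z)\<bar> \<partial>\<gamma>)"
      by (rule integral_abs_bound)
    also have "\<dots> \<le> (\<integral>z. b \<partial>\<gamma>)"
      using i1[OF f'] b b0 by (intro integral_mono) (simp_all add: indicator_def)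
    finally have 1: "\<bar>\<integral>z. f (fst z) * indicator B (snd z) \<partial>\<gamma>\<bar> \<le> b" using G.prob_space by simp
    have "\<bar>\<integral>x. f x * measure (\<Theta> x) B \<partial>\<eta>\<bar> \<le> (\<integral>x. \<bar>f x * measure (\<Theta> x) B\<bar> \<partial>\<eta>)"
      by (rule integral_abs_bound)
    also have "\<dots> \<le> (\<integral>x. b \<partial>\<eta>)"
    proof (rule integral_mono)
      fix x
      have "\<bar>f x * measure (\<Theta> x) B\<bar> \<le> b * 1"
        unfolding abs_mult by (intro mult_mono b W b0) simp
      then show "\<bar>f x * measure (\<Theta> x) B\<bar> \<le> b" by simp
    qed (use i2[OF f'] in simp_all)
    finally have 2: "\<bar>\<integral>x. f x * measure (\<Theta> x) B \<partial>\<eta>\<bar> \<le> b" using E.prob_space by simp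
    show "\<bar>\<l> f\<bar> \<le> 2 * b"
      using 1 2 unfolding \<l>_def by linarith
  next
    fix A assume "A \<in> sets \<eta>"
    then have A: "A \<in> sets borel" by (simp add: borel_probsD(2)[OF \<eta>])
    have "(\<integral>z. (indicator A (fst z) * indicator B (snd z) :: real) \<partial>\<gamma>) = (\<integral>z. indicator (A \<times> B) z \<partial>\<gamma>)"
      by (intro Bochner_Integration.integral_cong) (auto simp: indicator_def mem_Times_iff)
    also have "\<dots> = measure \<gamma> (A \<times> B)" by simp
    also have "\<dots> = (\<integral>x. indicator A x * measure (\<Theta> x) B \<partial>\<eta>)"
      using ker A B by (simp add: is_kernel_def set_lebesgue_integral_def)
    finally show "\<l> (indicator A) = 0" by (simp add: \<l>_def)
  qed (use f in \<open>simp_all add: fe\<close>)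
  then show "(\<integral>z. f (fst z) * indicator B (snd z) \<partial>\<gamma>) = (\<integral>x. f x * measure (\<Theta> x) B \<partial>\<eta>)"
    by (simp add: \<l>_def)
qed

text \<open>Causality controls only the \<nu>-continuity sets in \<open>BS t\<close>. As
  \<open>BS t\<close> consists of preimages under a continuous \<rho>, the frontier of the preimage
  of a ball lies over its sphere, and balls whose spheres are null for the image of \<nu> generate
  the Borel sets. A Dynkin argument then reaches all of \<open>BS t\<close>.\<close>

lemma causal_kernel_measurable:
  fixes BS :: "'i::linorder \<Rightarrow> 's::polish_space set set"
  assumes reg: "regular_filtration I BS" and t: "t \<in> I"
    and \<nu>: "\<nu> \<in> borel_probs" and \<Theta>: "\<And>x. \<Theta> x \<in> borel_probs"
    and causal: "kernel_sigma BS \<eta> \<nu> \<Theta> t \<subseteq> sigma_completion \<eta> G" and A: "A \<in> BS t"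
  shows "(\<lambda>x. measure (\<Theta> x) A) \<in> borel_measurable (cond_algebra \<eta> G)"
proof -
  obtain \<rho>' :: "'i \<Rightarrow> 's \<Rightarrow> 's"
    where \<rho>': "\<forall>t\<in>I. continuous_on UNIV (\<rho>' t) \<and> BS t = {\<rho>' t -` A | A. A \<in> sets borel}"
    using reg unfolding regular_filtration_def by (elim exE conjE)
  define \<rho> where "\<rho> = \<rho>' t"
  have \<rho>: "continuous_on UNIV \<rho>" "BS t = {\<rho> -` A | A. A \<in> sets borel}"
    using bspec[OF \<rho>' t] by (simp_all only: \<rho>_def)
  have [measurable]: "\<rho> \<in> borel_measurable borel" using \<rho>(1) by (rule borel_measurable_continuous_onI)
  interpret N: prob_space \<nu> using borel_probsD[OF \<nu>] by simp
  note [measurable_cong] = borel_probsD(2)[OF \<nu>]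
  note [simp] = borel_probsD(3)[OF \<nu>]
  have prob: "prob_space (\<Theta> x)" and sets: "sets (\<Theta> x) = sets borel" and space: "space (\<Theta> x) = UNIV" for x
    using borel_probsD[OF \<Theta>] by auto
  \<comment> \<open>The frontier is taken after pulling back, as in the definition of
    causality.\<close>
  define Q where "Q = {C \<in> sets borel. measure \<nu> (frontier (\<rho> -` C)) = 0}"
  have pre: "\<rho> -` C \<in> sets borel" if "C \<in> sets borel" for C
    using measurable_sets[of \<rho> borel borel, OF _ that] by simp
  have Qb: "sigma_sets UNIV Q \<subseteq> sets borel"
    using sets.sigma_sets_subset[of Q borel] by (auto simp: Q_def)
  have "Int_stable Q"
    unfolding Int_stable_def
  proof safe
    fix C D assume CD: "C \<in> Q" "D \<in> Q"
    have "measure \<nu> (frontier (\<rho> -` (C \<inter> D))) \<le> measure \<nu> (frontier (\<rho> -` C) \<union> frontier (\<rho> -` D))"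
      unfolding vimage_Int
      by (rule N.finite_measure_mono[OF frontier_Int_subset]) (simp add: borel_probsD(2)[OF \<nu>] borel_closed)
    also have "\<dots> \<le> measure \<nu> (frontier (\<rho> -` C)) + measure \<nu> (frontier (\<rho> -` D))"
      by (rule measure_Un_le) (simp_all add: borel_probsD(2)[OF \<nu>] borel_closed)
    finally show "C \<inter> D \<in> Q" using CD by (auto simp: Q_def measure_le_0_iff)
  qed
  have gen: "sets borel \<subseteq> sigma_sets UNIV Q"
  proof -
    interpret D: prob_space "distr \<nu> borel \<rho>" by (rule N.prob_space_distr) measurable
    \<comment> \<open>The balls are adapted to the image measure, so that the preimages of their
      spheres are \<nu>-null.\<close>
    obtain a :: "nat \<Rightarrow> 's" and r where a: "\<And>n. measure (distr \<nu> borel \<rho>) {y. dist (a n) y = r n} = 0"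
      and base: "\<And>y \<epsilon>. \<epsilon> > 0 \<Longrightarrow> \<exists>n. dist (a n) y < r n \<and> r n < \<epsilon>"
      using continuity_ball_base[OF D.finite_measure_axioms] by auto
    have "ball (a n) (r n) \<in> Q" for n
    proof -
      have c: "closed {y. dist (a n) y = r n}" by (intro closed_Collect_eq continuous_intros)
      have "frontier (\<rho> -` ball (a n) (r n)) \<subseteq> \<rho> -` {y. dist (a n) y = r n}"
      proof
        fix y assume y: "y \<in> frontier (\<rho> -` ball (a n) (r n))"
        have "open (\<rho> -` ball (a n) (r n))" using \<rho>(1) by (simp add: open_vimage)
        then have "y \<notin> \<rho> -` ball (a n) (r n)" using y by (simp add: frontier_def interior_open)
        moreover have "closure (\<rho> -` ball (a n) (r n)) \<subseteq> \<rho> -` cball (a n) (r n)"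
          by (rule closure_minimal) (use \<rho>(1) in \<open>auto intro: closed_vimage\<close>)
        then have "y \<in> \<rho> -` cball (a n) (r n)" using y by (auto simp: frontier_def)
        ultimately show "y \<in> \<rho> -` {y. dist (a n) y = r n}" by auto
      qed
      then have "measure \<nu> (frontier (\<rho> -` ball (a n) (r n))) \<le> measure \<nu> (\<rho> -` {y. dist (a n) y = r n})"
        using c by (intro N.finite_measure_mono) (auto simp: borel_probsD(2)[OF \<nu>] borel_closed intro!: pre)
      also have "\<dots> = 0"
        using a[of n] c by (subst (asm) measure_distr) (auto simp: borel_closed)
      finally show ?thesis by (simp add: Q_def measure_le_0_iff)
    qed
    then have b: "ball (a n) (r n) \<in> sigma_sets UNIV Q" for n by (rule sigma_sets.Basic)
    have "O' \<in> sigma_sets UNIV Q" if "open O'" for O'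
    proof -
      interpret SA: sigma_algebra UNIV "sigma_sets UNIV Q" by (rule sigma_algebra_sigma_sets) simp
      have "(\<Union>n\<in>{n. ball (a n) (r n) \<subseteq> O'}. ball (a n) (r n)) \<in> sigma_sets UNIV Q"
        by (intro SA.countable_UN'') (use b in auto)
      then show ?thesis using open_eq_Union_balls[OF base that] by metis
    qed
    then have "{S. open S} \<subseteq> sigma_sets UNIV Q" by blast
    then have "sigma_sets UNIV {S. open S} \<subseteq> sigma_sets UNIV Q" by (rule sigma_sets_mono)
    then show ?thesis by (simp add: borel_def)
  qed
  have meas: "(\<lambda>x. measure (\<Theta> x) (\<rho> -` C)) \<in> borel_measurable (cond_algebra \<eta> G)"
    if "C \<in> sigma_sets UNIV Q" for C
    using \<open>Int_stable Q\<close> subset_Pow_Union[of Q, THEN subset_trans, OF Pow_mono[OF subset_UNIV]] that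
  proof (induction rule: sigma_sets_induct_disjoint)
    case (basic C)
    show ?case
    proof (rule measurableI)
      fix V :: "real set" assume V: "V \<in> sets borel"
      have "(\<lambda>x. measure (\<Theta> x) (\<rho> -` C)) -` V \<in> kernel_sigma BS \<eta> \<nu> \<Theta> t"
        unfolding kernel_sigma_def
        by (rule sigma_completion_Basic, rule sigma_sets.Basic) (use basic V \<rho>(2) in \<open>auto simp: Q_def\<close>)
      then show "(\<lambda>x. measure (\<Theta> x) (\<rho> -` C)) -` V \<inter> space (cond_algebra \<eta> G) \<in> sets (cond_algebra \<eta> G)"
        using causal by auto
    qed simp
  next
    case (compl C)
    have "measure (\<Theta> x) (\<rho> -` (UNIV - C)) = 1 - measure (\<Theta> x) (\<rho> -` C)" for x
    proof -
      interpret prob_space "\<Theta> x" by (rule prob)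
      have "C \<in> sets borel"
        using compl(1) Qb by blast
      then show ?thesis using prob_compl[of "\<rho> -` C"] pre by (simp add: sets space vimage_Diff)
    qed
    then show ?case using compl by simp
  next
    case (union D)
    have D: "D i \<in> sets borel" for i
      using union(2) Qb by blast
    have "measure (\<Theta> x) (\<rho> -` (\<Union>i. D i)) = (\<Sum>i. measure (\<Theta> x) (\<rho> -` D i))" for x
    proof -
      interpret prob_space "\<Theta> x" by (rule prob)
      have "(\<lambda>i. measure (\<Theta> x) (\<rho> -` D i)) sums measure (\<Theta> x) (\<Union>i. \<rho> -` D i)"
      proof (rule finite_measure_UNION)
        show "disjoint_family (\<lambda>i. \<rho> -` D i)"
          using union(1) unfolding disjoint_family_on_def by blast
      qed (use D pre sets in auto)
      then show ?thesis by (simp add: sums_iff vimage_UN)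
    qed
    then show ?case using union by simp
  qed (simp_all)
  obtain C where "A = \<rho> -` C" "C \<in> sets borel" using A unfolding \<rho>(2) by (elim CollectE exE conjE)
  then show ?thesis using meas[of C] gen by auto
qed

section \<open>The linear space of test maps\<close>

text \<open>Isolates the requirement on one summand together with its index, so that closure
  properties and integrals can be treated term by term.\<close>

definition H_term ::
    "'i set \<Rightarrow> ('i \<Rightarrow> 'e::topological_space set set) \<Rightarrow> ('i \<Rightarrow> 's set set)
     \<Rightarrow> 'e measure \<Rightarrow> 'i option \<Rightarrow> ('e \<Rightarrow> real) \<Rightarrow> 's set \<Rightarrow> bool" where
  "H_term I BE BS \<eta> t g A \<longleftrightarrow>
     t \<in> insert None (Some ` I) \<and> A \<in> with_trivial BS t \<and>
     g \<in> borel_measurable borel \<and> bounded (range g) \<and>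
     (\<exists>X\<in>L_infty \<eta>. AE x in \<eta>. g x =
        X x - real_cond_exp (completion \<eta>) (cond_algebra \<eta> (with_trivial BE t)) X x)"

definition H_sum ::
    "'i set \<Rightarrow> ('i \<Rightarrow> 'e::topological_space set set) \<Rightarrow> ('i \<Rightarrow> 's set set) \<Rightarrow> 'e measure \<Rightarrow> ('e \<times> 's \<Rightarrow> real)
     \<Rightarrow> nat \<Rightarrow> (nat \<Rightarrow> 'e \<Rightarrow> real) \<Rightarrow> (nat \<Rightarrow> 's set) \<Rightarrow> (nat \<Rightarrow> 'i option) \<Rightarrow> bool" where
  "H_sum I BE BS \<eta> h N g A t \<longleftrightarrow>
     (\<forall>x y. h (x, y) = (\<Sum>i=1..N. g i x * indicator (A i) y)) \<and>
     (\<forall>i\<in>{1..N}. H_term I BE BS \<eta> (t i) (g i) (A i))"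

lemma H_sumD:
  assumes "H_sum I BE BS \<eta> h N g A t"
  shows "h (x, y) = (\<Sum>i=1..N. g i x * indicator (A i) y)"
    and "i \<in> {1..N} \<Longrightarrow> H_term I BE BS \<eta> (t i) (g i) (A i)"
  using assms unfolding H_sum_def by blast+

lemma H_maps_iff:
  "h \<in> H_maps I BE BS \<eta> \<longleftrightarrow> h \<in> borel_measurable borel \<and> (\<exists>N g A t. H_sum I BE BS \<eta> h N g A t)"
proof -
  have "h = (\<lambda>(x, y). \<Sum>i=1..N. g i x * indicator (A i) y) \<longleftrightarrow>
      (\<forall>x y. h (x, y) = (\<Sum>i=1..N. g i x * indicator (A i) y))" for N :: nat and g A
    unfolding fun_eq_iff split_paired_All prod.case ..
  then show ?thesis unfolding H_maps_def H_sum_def H_term_def cond_algebra_def by simp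
qed

lemma H_mapsI:
  fixes N :: nat
  assumes "h \<in> borel_measurable borel"
    and "\<And>x y. h (x, y) = (\<Sum>i=1..N. g i x * indicator (A i) y)"
    and "\<And>i. i \<in> {1..N} \<Longrightarrow> H_term I BE BS \<eta> (t i) (g i) (A i)"
  shows "h \<in> H_maps I BE BS \<eta>"
proof -
  have "H_sum I BE BS \<eta> h N g A t" unfolding H_sum_def using assms(2,3) by blast
  then show ?thesis unfolding H_maps_iff using assms(1) by blast
qed

lemma with_trivial_subset_borel:
  assumes "borel_filtration I B" and "t \<in> insert None (Some ` I)"
  shows "with_trivial B t \<subseteq> sets borel"
  using assms by (auto simp: with_trivial_def borel_filtration_def split: option.splits)

lemma conditioning_with_trivial:
  assumes "borel_filtration I BE" and "\<eta> \<in> borel_probs" and "t \<in> insert None (Some ` I)"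
  shows "conditioning \<eta> (with_trivial BE t)"
  using borel_probsD[OF assms(2)] with_trivial_subset_borel[OF assms(1,3)]
  by (intro conditioning.intro conditioning_axioms.intro)

lemma H_maps_zero: "(\<lambda>z. 0) \<in> H_maps I BE BS \<eta>"
  by (rule H_mapsI[where N = 0 and g = "\<lambda>_ _. 0" and A = "\<lambda>_. {}" and t = "\<lambda>_. None"]) simp_all

lemma H_maps_single:
  assumes t: "H_term I BE BS \<eta> t g A" and m: "(\<lambda>z. g (fst z) * indicator A (snd z)) \<in> borel_measurable borel"
  shows "(\<lambda>z. g (fst z) * indicator A (snd z)) \<in> H_maps I BE BS \<eta>"
  by (rule H_mapsI[OF m, where N = 1 and g = "\<lambda>_. g" and A = "\<lambda>_. A" and t = "\<lambda>_. t"])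
    (use t in \<open>simp_all del: sum_mult_indicator\<close>)

lemma H_maps_add:
  assumes "h1 \<in> H_maps I BE BS \<eta>" "h2 \<in> H_maps I BE BS \<eta>"
  shows "(\<lambda>z. h1 z + h2 z) \<in> H_maps I BE BS \<eta>"
proof -
  obtain N1 g1 A1 t1 where r1: "H_sum I BE BS \<eta> h1 N1 g1 A1 t1"
    using assms(1) unfolding H_maps_iff by blast
  have hm1: "h1 \<in> borel_measurable borel" using assms(1) unfolding H_maps_iff by blast
  obtain N2 g2 A2 t2 where r2: "H_sum I BE BS \<eta> h2 N2 g2 A2 t2"
    using assms(2) unfolding H_maps_iff by blast
  have hm2: "h2 \<in> borel_measurable borel" using assms(2) unfolding H_maps_iff by blast
  \<comment> \<open>Concatenation of the two sums: indices above \<open>N1\<close> are shifted down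
    into the second one.\<close>
  define g where "g i = (if i \<le> N1 then g1 i else g2 (i - N1))" for i
  define A where "A i = (if i \<le> N1 then A1 i else A2 (i - N1))" for i
  define t where "t i = (if i \<le> N1 then t1 i else t2 (i - N1))" for i
  have "(\<Sum>i=1..N1 + N2. g i x * indicator (A i) y)
      = (\<Sum>i=1..N1. g1 i x * indicator (A1 i) y) + (\<Sum>i=1..N2. g2 i x * indicator (A2 i) y)" for x y
  proof -
    have "(\<Sum>i=1..N1 + N2. g i x * indicator (A i) y)
        = (\<Sum>i=1..N1. g i x * indicator (A i) y) + (\<Sum>i=N1+1..N1+N2. g i x * indicator (A i) y)"
      by (rule sum.ub_add_nat) simp
    also have "(\<Sum>i=1..N1. g i x * indicator (A i) y) = (\<Sum>i=1..N1. g1 i x * indicator (A1 i) y)"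
      by (intro sum.cong) (auto simp: g_def A_def)
    also have "(\<Sum>i=N1+1..N1+N2. g i x * indicator (A i) y) = (\<Sum>i=1..N2. g (i + N1) x * indicator (A (i + N1)) y)"
      using sum.shift_bounds_cl_nat_ivl[of "\<lambda>i. g i x * indicator (A i) y" 1 N1 N2] by (simp add: add.commute)
    also have "\<dots> = (\<Sum>i=1..N2. g2 i x * indicator (A2 i) y)"
      by (intro sum.cong) (auto simp: g_def A_def)
    finally show ?thesis .
  qed
  note sum = this
  show ?thesis
  proof (rule H_mapsI)
    show "(\<lambda>z. h1 z + h2 z) \<in> borel_measurable borel" using hm1 hm2 by measurable
    show "h1 (x, y) + h2 (x, y) = (\<Sum>i=1..N1 + N2. g i x * indicator (A i) y)" for x y
      unfolding sum H_sumD(1)[OF r1] H_sumD(1)[OF r2] ..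
    show "H_term I BE BS \<eta> (t i) (g i) (A i)" if "i \<in> {1..N1 + N2}" for i
    proof (cases "i \<le> N1")
      case True
      then show ?thesis using H_sumD(2)[OF r1, of i] that by (simp add: t_def g_def A_def)
    next
      case False
      then have "i - N1 \<in> {1..N2}" using that by auto
      then show ?thesis using H_sumD(2)[OF r2] False by (simp add: t_def g_def A_def)
    qed
  qed
qed

lemma H_term_scale:
  assumes "borel_filtration I BE" and "\<eta> \<in> borel_probs" and t: "H_term I BE BS \<eta> t g A"
  shows "H_term I BE BS \<eta> t (\<lambda>x. a * g x) A"
proof -
  interpret conditioning \<eta> "with_trivial BE t"
    using assms by (intro conditioning_with_trivial) (auto simp: H_term_def)
  obtain X where X: "X \<in> L_infty \<eta>" "AE x in \<eta>. g x = X x - E X x"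
    using t unfolding H_term_def by blast
  obtain K where K: "X \<in> borel_measurable \<eta>" "AE x in \<eta>. \<bar>X x\<bar> \<le> K"
    using X(1) by (auto simp: L_infty_def)
  have "AE x in completion \<eta>. E (\<lambda>x. a * X x) x = a * E X x"
    by (rule c.real_cond_exp_cmult, rule integrable_L_infty[OF measurable_completion]) (use K in auto)
  then have "AE x in \<eta>. E (\<lambda>x. a * X x) x = a * E X x" by (simp add: AE_completion_iff)
  then have "AE x in \<eta>. a * g x = a * X x - E (\<lambda>x. a * X x) x"
    using X(2) by eventually_elim (simp add: right_diff_distrib)
  moreover have "(\<lambda>x. a * X x) \<in> L_infty \<eta>"
  proof -
    have "AE x in \<eta>. \<bar>a * X x\<bar> \<le> \<bar>a\<bar> * K"
      using K(2) by eventually_elim (simp add: abs_mult mult_left_mono)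
    then show ?thesis using K(1) by (auto simp: L_infty_def)
  qed
  moreover have "bounded (range (\<lambda>x. a * g x))"
    using t bounded_scaleR_comp[of g UNIV a] by (simp add: H_term_def)
  ultimately show ?thesis using t unfolding H_term_def by auto
qed

lemma H_maps_scale:
  assumes "borel_filtration I BE" and "\<eta> \<in> borel_probs" and "h \<in> H_maps I BE BS \<eta>"
  shows "(\<lambda>z. a * h z) \<in> H_maps I BE BS \<eta>"
proof -
  obtain N g A t where "H_sum I BE BS \<eta> h N g A t"
    using assms(3) unfolding H_maps_iff by blast
  note h = H_sumD[OF this]
  show ?thesis
  proof (rule H_mapsI)
    show "(\<lambda>z. a * h z) \<in> borel_measurable borel"
      using assms(3) unfolding H_maps_iff by (intro borel_measurable_times borel_measurable_const) blast
    show "a * h (x, y) = (\<Sum>i=1..N. (a * g i x) * indicator (A i) y)" for x y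
      by (simp only: h(1) sum_distrib_left mult.assoc)
    show "H_term I BE BS \<eta> (t i) (\<lambda>x. a * g i x) (A i)" if "i \<in> {1..N}" for i
      by (rule H_term_scale[OF assms(1,2) h(2)[OF that]])
  qed
qed

lemma H_maps_bounded:
  assumes "h \<in> H_maps I BE BS \<eta>"
  shows "\<exists>b. \<forall>z. \<bar>h z\<bar> \<le> b"
proof -
  obtain N g A t where "H_sum I BE BS \<eta> h N g A t"
    using assms unfolding H_maps_iff by blast
  note h = H_sumD[OF this]
  have "\<exists>b. \<forall>x. \<bar>g i x\<bar> \<le> b" if "i \<in> {1..N}" for i
    using h(2)[OF that] by (auto simp: H_term_def bounded_iff)
  then obtain b where b: "\<And>i x. i \<in> {1..N} \<Longrightarrow> \<bar>g i x\<bar> \<le> b i" by metis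
  have "\<bar>h (x, y)\<bar> \<le> (\<Sum>i=1..N. b i)" for x y
  proof -
    have "\<bar>h (x, y)\<bar> \<le> (\<Sum>i=1..N. \<bar>g i x * indicator (A i) y\<bar>)" unfolding h(1) by (rule sum_abs)
    also have "\<dots> \<le> (\<Sum>i=1..N. b i)"
    proof (rule sum_mono)
      fix i assume "i \<in> {1..N}"
      then show "\<bar>g i x * indicator (A i) y\<bar> \<le> b i"
        using b[of i x] by (auto simp: indicator_def)
    qed
    finally show ?thesis .
  qed
  then show ?thesis by force
qed

text \<open>A summand integrates to the \<eta>-integral of \<open>g\<close> times the kernel mass of
  \<open>A\<close>. Causality makes this mass measurable for the completed sigma-field at
  \<open>t\<close>, and \<open>g\<close>, a residual for the same sigma-field, is orthogonal to
  it.\<close>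

lemma causal_plans_integral_H:
  fixes BS :: "'i::linorder \<Rightarrow> 's::polish_space set set"
  assumes BE: "borel_filtration I BE" and BS: "borel_filtration I BS"
    and reg: "regular_filtration I BS" and \<eta>: "\<eta> \<in> borel_probs" and \<nu>: "\<nu> \<in> borel_probs"
    and \<gamma>: "\<gamma> \<in> causal_plans I BE BS \<eta> \<nu>" and h: "h \<in> H_maps I BE BS \<eta>"
  shows "(\<integral>z. h z \<partial>\<gamma>) = 0"
proof -
  have plan: "\<gamma> \<in> transference_plans \<eta> \<nu>" using \<gamma> by (simp add: causal_plans_def)
  note \<gamma>b = transference_plansD(1)[OF plan]
  obtain \<Theta> where ker: "is_kernel \<eta> \<gamma> \<Theta>"
    and causal: "\<And>t. t \<in> I \<Longrightarrow> kernel_sigma BS \<eta> \<nu> \<Theta> t \<subseteq> sigma_completion \<eta> (BE t)"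
    using \<gamma> unfolding causal_plans_def by blast
  have \<Theta>: "\<And>x. \<Theta> x \<in> borel_probs" using ker by (simp add: is_kernel_def)
  obtain N g A t where "H_sum I BE BS \<eta> h N g A t"
    using h unfolding H_maps_iff by blast
  note h' = H_sumD[OF this]
  have summand: "integrable \<gamma> (\<lambda>z. g (fst z) * indicator A (snd z)) \<and>
      (\<integral>z. g (fst z) * indicator A (snd z) \<partial>\<gamma>) = 0" if T: "H_term I BE BS \<eta> t g A" for t g A
  proof -
    have t: "t \<in> insert None (Some ` I)" and A: "A \<in> with_trivial BS t" and g: "g \<in> borel_measurable borel" "bounded (range g)"
      using T by (auto simp: H_term_def)
    interpret conditioning \<eta> "with_trivial BE t" by (rule conditioning_with_trivial[OF BE \<eta> t])
    have Ab: "A \<in> sets borel" using with_trivial_subset_borel[OF BS t] A by blast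
    have W: "(\<lambda>x. measure (\<Theta> x) A) \<in> borel_measurable F"
    proof (cases t)
      case None
      \<comment> \<open>At the extra index the kernel mass is constant, 0 or 1.\<close>
      then have "A = {} \<or> A = UNIV" using A by (simp add: with_trivial_def)
      moreover have "measure (\<Theta> x) UNIV = 1" for x
        using prob_space.prob_space[of "\<Theta> x"] borel_probsD[OF \<Theta>[of x]] by simp
      ultimately show ?thesis by auto
    next
      case (Some s)
      then have "s \<in> I" "A \<in> BS s" using t A by (auto simp: with_trivial_def)
      then show ?thesis
        using causal_kernel_measurable[OF reg _ \<nu> \<Theta> causal] Some by (simp add: with_trivial_def)
    qed
    have "(\<integral>x. g x * measure (\<Theta> x) A \<partial>\<eta>) = 0"
    proof -
      obtain X where X: "X \<in> L_infty \<eta>" "AE x in \<eta>. g x = X x - E X x" using T unfolding H_term_def by blast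
      show ?thesis
      proof (rule orthogonal_residual[OF X(1) W _ _ _ X(2)])
        show "(\<lambda>x. measure (\<Theta> x) A) \<in> borel_measurable \<eta>" "g \<in> borel_measurable \<eta>"
          using ker Ab g(1) by (simp_all add: is_kernel_def sets_\<eta> cong: measurable_cong_sets)
        show "\<bar>measure (\<Theta> x) A\<bar> \<le> 1" for x
          using prob_space.prob_le_1 borel_probsD(1)[OF \<Theta>[of x]] by (simp add: measure_nonneg)
      qed
    qed
    then show ?thesis
      using kernel_integral[OF \<eta> \<gamma>b ker Ab g] by simp
  qed
  have "(\<integral>z. h z \<partial>\<gamma>) = (\<integral>z. (\<Sum>i=1..N. g i (fst z) * indicator (A i) (snd z)) \<partial>\<gamma>)"
    by (rule Bochner_Integration.integral_cong) (simp_all only: h'(1) split_paired_all fst_conv snd_conv)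
  also have "\<dots> = (\<Sum>i=1..N. \<integral>z. g i (fst z) * indicator (A i) (snd z) \<partial>\<gamma>)"
    by (rule Bochner_Integration.integral_sum) (use summand[OF h'(2)] in blast)
  also have "\<dots> = 0"
    by (rule sum.neutral) (use summand[OF h'(2)] in blast)
  finally show ?thesis .
qed

lemma weak_duality:
  fixes BS :: "'i::linorder \<Rightarrow> 's::polish_space set set" and c :: "'e::polish_space \<times> 's \<Rightarrow> ereal"
  assumes BE: "borel_filtration I BE" and BS: "borel_filtration I BS"
    and reg: "regular_filtration I BS" and \<eta>: "\<eta> \<in> borel_probs" and \<nu>: "\<nu> \<in> borel_probs"
    and \<gamma>: "\<gamma> \<in> causal_plans I BE BS \<eta> \<nu>" and h: "h \<in> H_maps I BE BS \<eta>"
    and g: "g \<in> bcontfun" and le: "\<And>x y. ereal (g y + h (x, y)) \<le> c (x, y)"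
  shows "ereal (\<integral>y. g y \<partial>\<nu>) \<le> enn2ereal (\<integral>\<^sup>+z. e2ennreal (c z) \<partial>\<gamma>)"
proof -
  have plan: "\<gamma> \<in> transference_plans \<eta> \<nu>" using \<gamma> by (simp add: causal_plans_def)
  note \<gamma>b = transference_plansD(1)[OF plan] and marg = transference_plansD(3)[OF plan]
  interpret G: prob_space \<gamma> by (rule borel_probsD(1)[OF \<gamma>b])
  note [measurable_cong] = borel_probsD(2)[OF \<gamma>b]
  have gm [measurable]: "g \<in> borel_measurable borel" and gb: "bounded (range g)"
    using g by (auto simp: bcontfun_def intro: borel_measurable_continuous_onI)
  have hm [measurable]: "h \<in> borel_measurable borel" using h by (simp add: H_maps_iff)
  obtain b where b: "\<And>y. \<bar>g y\<bar> \<le> b" using gb by (auto simp: bounded_iff)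
  obtain b' where b': "\<And>z. \<bar>h z\<bar> \<le> b'" using H_maps_bounded[OF h] by blast
  have ig: "integrable \<gamma> (\<lambda>z. g (snd z))" by (rule G.integrable_const_bound[of _ b]) (auto simp: b)
  have ih: "integrable \<gamma> h" by (rule G.integrable_const_bound[of _ b']) (auto simp: b')
  define f where "f z = g (snd z) + h z" for z
  have f: "integrable \<gamma> f" unfolding f_def using ig ih by simp
  have "(\<integral>y. g y \<partial>\<nu>) = (\<integral>z. g (snd z) \<partial>\<gamma>)"
    unfolding marg[symmetric] by (rule integral_distr) measurable
  also have "\<dots> = (\<integral>z. f z \<partial>\<gamma>)"
    unfolding f_def using ig ih causal_plans_integral_H[OF BE BS reg \<eta> \<nu> \<gamma> h] by simp
  \<comment> \<open>The cost integral is formed in the non-negative extended reals, so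
    \<open>f\<close> gives way to its positive part, which still lies below \<open>c\<close> because
    negative parts are truncated on both sides.\<close>
  also have "\<dots> \<le> (\<integral>z. max 0 (f z) \<partial>\<gamma>)" using f by (intro integral_mono) auto
  finally have "ereal (\<integral>y. g y \<partial>\<nu>) \<le> ereal (\<integral>z. max 0 (f z) \<partial>\<gamma>)" by simp
  also have "\<dots> = enn2ereal (ennreal (\<integral>z. max 0 (f z) \<partial>\<gamma>))"
    by (simp add: enn2ereal_ennreal)
  also have "ennreal (\<integral>z. max 0 (f z) \<partial>\<gamma>) = (\<integral>\<^sup>+z. ennreal (max 0 (f z)) \<partial>\<gamma>)"
    using f by (intro nn_integral_eq_integral[symmetric]) auto
  also have "enn2ereal \<dots> \<le> enn2ereal (\<integral>\<^sup>+z. e2ennreal (c z) \<partial>\<gamma>)"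
  proof -
    have "ennreal (max 0 (f z)) \<le> e2ennreal (c z)" for z
    proof -
      have "ereal (f z) \<le> c z" using le[of "snd z" "fst z"] by (simp add: f_def)
      then have "e2ennreal (ereal (f z)) \<le> e2ennreal (c z)" by (rule e2ennreal_mono)
      moreover have "ennreal (max 0 (f z)) = e2ennreal (ereal (f z))"
        by (simp add: max_def ennreal_neg)
      ultimately show ?thesis by simp
    qed
    then have "(\<integral>\<^sup>+z. ennreal (max 0 (f z)) \<partial>\<gamma>) \<le> (\<integral>\<^sup>+z. e2ennreal (c z) \<partial>\<gamma>)"
      by (intro nn_integral_mono)
    then show ?thesis by (simp add: less_eq_ennreal.rep_eq)
  qed
  finally show ?thesis .
qed

section \<open>The dual functional\<close>

lemma bcontfun_scale: "g \<in> bcontfun \<Longrightarrow> (\<lambda>y. a * g y :: real) \<in> bcontfun"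
  using bounded_scaleR_comp[of g UNIV a] by (auto simp: bcontfun_def intro!: continuous_intros)

lemma bcontfun_add: "g \<in> bcontfun \<Longrightarrow> g' \<in> bcontfun \<Longrightarrow> (\<lambda>y. g y + g' y :: real) \<in> bcontfun"
  using bounded_plus_comp[of g UNIV g'] by (auto simp: bcontfun_def intro!: continuous_intros)

lemma bcontfun_const: "(\<lambda>y. a :: real) \<in> bcontfun"
  by (auto simp: bcontfun_def)

lemma bcontfun_integrable:
  assumes "\<mu> \<in> borel_probs" and "g \<in> bcontfun"
  shows "integrable \<mu> (g :: _ \<Rightarrow> real)"
proof -
  interpret prob_space \<mu> by (rule borel_probsD(1)[OF assms(1)])
  have g: "g \<in> borel_measurable borel" "bounded (range g)"
    using assms(2) by (auto simp: bcontfun_def intro: borel_measurable_continuous_onI)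
  obtain b where "\<And>y. \<bar>g y\<bar> \<le> b" using g(2) by (auto simp: bounded_iff)
  then show ?thesis
    using g(1) borel_probsD(2)[OF assms(1)]
    by (intro integrable_const_bound[of _ b]) (auto cong: measurable_cong_sets)
qed

lemma function_subspace_bounded: "function_subspace {f :: 'a \<Rightarrow> real. bounded (range f)}"
  unfolding function_subspace_def
  using bounded_plus_comp bounded_scaleR_comp[where 'b = real] by auto

text \<open>The crux is that every majorant of 0 has non-negative price: there the finite dual value
  enters, and it keeps the infimum of prices finite and zero at 0. The bounds on \<open>L\<close>
  are then read off by exhibiting one majorant each.\<close>

lemma dual_functional:
  fixes c :: "'e::polish_space \<times> 's::polish_space \<Rightarrow> ereal"
  assumes BE: "borel_filtration I BE" and \<eta>: "\<eta> \<in> borel_probs" and \<nu>: "\<nu> \<in> borel_probs"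
    and c: "\<And>z. 0 \<le> c z" and d: "dual_value I BE BS c \<eta> \<nu> = ereal d"
  obtains L :: "('e \<times> 's \<Rightarrow> real) \<Rightarrow> real" where
    "\<And>f g. bounded (range f) \<Longrightarrow> bounded (range g) \<Longrightarrow> L (\<lambda>z. f z + g z) = L f + L g"
    "\<And>f a. bounded (range f) \<Longrightarrow> L (\<lambda>z. a * f z) = a * L f"
    "\<And>f. bounded (range f) \<Longrightarrow> (\<And>z. 0 \<le> f z) \<Longrightarrow> 0 \<le> L f"
    "\<And>g. g \<in> bcontfun \<Longrightarrow> L (\<lambda>z. g (snd z)) = (\<integral>y. g y \<partial>\<nu>)"
    "\<And>h. h \<in> H_maps I BE BS \<eta> \<Longrightarrow> L h = 0"
    "\<And>f. bounded (range f) \<Longrightarrow> (\<And>z. ereal (f z) \<le> c z) \<Longrightarrow> L f \<le> d"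
proof -
  interpret N: prob_space \<nu> by (rule borel_probsD(1)[OF \<nu>])
  let ?H = "H_maps I BE BS \<eta>"
  have [simp]: "ereal 0 * v = 0" "ereal 1 * v = v" for v
    by (simp_all flip: zero_ereal_def one_ereal_def)
  note Hs = H_maps_scale[OF BE \<eta>]
  note int = bcontfun_integrable[OF \<nu>]
  have dual: "(\<integral>y. g y \<partial>\<nu>) \<le> d" if "g \<in> bcontfun" "h \<in> ?H" "\<And>x y. ereal (g y + h (x, y)) \<le> c (x, y)" for g h
  proof -
    have "ereal (\<integral>y. g y \<partial>\<nu>) \<le> dual_value I BE BS c \<eta> \<nu>"
      unfolding dual_value_def using that by (intro SUP_upper2[of "(g, h)"]) auto
    then show ?thesis by (simp add: d)
  qed
  \<comment> \<open>\<open>r\<close> is the price of the majorant g + h + l c of \<open>f\<close>,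
    the cost itself being priced at \<open>d\<close>.\<close>
  define Q where "Q f r g h l \<longleftrightarrow> g \<in> bcontfun \<and> h \<in> ?H \<and> 0 \<le> l \<and> r = (\<integral>y. g y \<partial>\<nu>) + l * d \<and>
      (\<forall>x y. ereal (f (x, y)) \<le> ereal (g y + h (x, y)) + ereal l * c (x, y))" for f r g h l
  define R where "R f r \<longleftrightarrow> (\<exists>g h l. Q f r g h l)" for f r
  have QD: "g \<in> bcontfun" "h \<in> ?H" "0 \<le> l" "r = (\<integral>y. g y \<partial>\<nu>) + l * d"
      "ereal (f (x, y)) \<le> ereal (g y + h (x, y)) + ereal l * c (x, y)" if "Q f r g h l" for f r g h l x y
    using that unfolding Q_def by blast+
  have RI: "R f r" if "g \<in> bcontfun" "h \<in> ?H" "0 \<le> l" "r = (\<integral>y. g y \<partial>\<nu>) + l * d"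
    "\<And>x y. ereal (f (x, y)) \<le> ereal (g y + h (x, y)) + ereal l * c (x, y)" for f r g h l
  proof -
    have "Q f r g h l" unfolding Q_def using that by blast
    then show ?thesis unfolding R_def by blast
  qed
  have R_mono: "R f' r" if r: "R f r" and le: "\<And>z. f' z \<le> f z" for f f' r
  proof -
    obtain g h l where "Q f r g h l"
      using r unfolding R_def by blast
    note 1 = QD[OF this]
    have "ereal (f' z) \<le> ereal (f z)" for z using le by simp
    from order_trans[OF this 1(5)] show ?thesis by (rule RI[OF 1(1-4)])
  qed
  have R_add: "R (\<lambda>z. f z + f' z) (r + r')" if r: "R f r" and r': "R f' r'" for f f' r r'
  proof -
    obtain g h l where "Q f r g h l"
      using r unfolding R_def by blast
    note 1 = QD[OF this]
    obtain g' h' l' where "Q f' r' g' h' l'"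
      using r' unfolding R_def by blast
    note 2 = QD[OF this]
    show ?thesis
    proof (rule RI[of _ _ "l + l'", OF bcontfun_add[OF 1(1) 2(1)] H_maps_add[OF 1(2) 2(2)]])
      show "r + r' = (\<integral>y. g y + g' y \<partial>\<nu>) + (l + l') * d"
        using int[OF 1(1)] int[OF 2(1)] by (simp add: 1(4) 2(4) algebra_simps)
      fix x y
      have "ereal (f (x, y) + f' (x, y)) \<le> (ereal (g y + h (x, y)) + ereal l * c (x, y))
          + (ereal (g' y + h' (x, y)) + ereal l' * c (x, y))"
        using add_mono[OF 1(5)[of x y] 2(5)[of x y]] by simp
      also have "\<dots> = ereal ((g y + g' y) + (h (x, y) + h' (x, y))) + (ereal l * c (x, y) + ereal l' * c (x, y))"
        using 1(3) 2(3) c[of "(x, y)"] by (cases "c (x, y)") (auto simp: algebra_simps)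
      also have "ereal l * c (x, y) + ereal l' * c (x, y) = ereal (l + l') * c (x, y)"
        using 1(3) 2(3) c[of "(x, y)"] by (subst ereal_left_distrib[symmetric]) auto
      finally show "ereal (f (x, y) + f' (x, y)) \<le> ereal ((g y + g' y) + (h (x, y) + h' (x, y))) + ereal (l + l') * c (x, y)" .
    qed (use 1 2 in auto)
  qed
  have R_scale: "R (\<lambda>z. a * f z) (a * r)" if r: "R f r" and a: "a > 0" for f r a
  proof -
    obtain g h l where "Q f r g h l"
      using r unfolding R_def by blast
    note 1 = QD[OF this]
    show ?thesis
    proof (rule RI[of _ _ "a * l", OF bcontfun_scale[OF 1(1)] Hs[OF 1(2)]])
      show "a * r = (\<integral>y. a * g y \<partial>\<nu>) + (a * l) * d" by (simp add: 1(4) algebra_simps)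
      fix x y
      show "ereal (a * f (x, y)) \<le> ereal (a * g y + a * h (x, y)) + ereal (a * l) * c (x, y)"
      proof (cases "c (x, y)")
        case (real v)
        then have "f (x, y) \<le> g y + h (x, y) + l * v" using 1(5)[of x y] by simp
        then have "a * f (x, y) \<le> a * (g y + h (x, y) + l * v)" using a by simp
        then show ?thesis by (simp add: real algebra_simps)
      next
        case PInf
        then show ?thesis using 1(5)[of x y] 1(3) a by (cases "l = 0") (auto simp flip: distrib_left)
      next
        case MInf
        then show ?thesis using c[of "(x, y)"] by simp
      qed
    qed (use 1 a in auto)
  qed
  have R_const: "R f b" if "\<And>z. f z \<le> b" for f b
    by (rule RI[of _ _ 0, OF bcontfun_const[of b] H_maps_zero]) (use that N.prob_space in auto)
  have R_nonneg: "0 \<le> r" if r: "R (\<lambda>z. 0) r" for r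
  proof -
    obtain g h l where "Q (\<lambda>z. 0) r g h l"
      using r unfolding R_def by blast
    note 1 = QD[OF this]
    show ?thesis
    proof (cases "l = 0")
      case True
      \<comment> \<open>Without a cost term every multiple -n (g, h) lies below 0 \<le> c and is
        admissible, so a negative integral of \<open>g\<close> would make the dual value
        infinite.\<close>
      have gh: "0 \<le> g y + h (x, y)" for x y using 1(5)[of y x] True by simp
      have *: "- n * (\<integral>y. g y \<partial>\<nu>) \<le> d" if "n \<ge> 0" for n
      proof -
        have "(\<integral>y. - n * g y \<partial>\<nu>) \<le> d"
        proof (rule dual[OF bcontfun_scale[OF 1(1)] Hs[OF 1(2), of "- n"]])
          fix x y
          have "- n * g y + - n * h (x, y) \<le> 0"
            using mult_nonneg_nonneg[OF that gh[of y x]] by (simp add: distrib_left)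
          then have "ereal (- n * g y + - n * h (x, y)) \<le> 0" by simp
          then show "ereal (- n * g y + - n * h (x, y)) \<le> c (x, y)" using c by (rule order_trans)
        qed
        then show ?thesis by simp
      qed
      have "0 \<le> (\<integral>y. g y \<partial>\<nu>)"
      proof (rule ccontr)
        assume "\<not> 0 \<le> (\<integral>y. g y \<partial>\<nu>)"
        then have neg: "(\<integral>y. g y \<partial>\<nu>) < 0" by simp
        \<comment> \<open>This multiple makes the left side equal to \<bar>d\<bar> + 1, which
          exceeds \<open>d\<close>.\<close>
        have "- ((\<bar>d\<bar> + 1) / - (\<integral>y. g y \<partial>\<nu>)) * (\<integral>y. g y \<partial>\<nu>) \<le> d"
          by (rule *) (use neg in \<open>simp add: divide_nonneg_neg\<close>)
        then have "\<bar>d\<bar> + 1 \<le> d" using neg by simp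
        then show False by simp
      qed
      then show ?thesis using 1(4) True by simp
    next
      case False
      then have l: "l > 0" using 1(3) by simp
      \<comment> \<open>For l > 0 the pair -(g, h) / l is admissible, so the integral of
        \<open>g\<close> is at least -l d and the price is non-negative.\<close>
      have "(\<integral>y. - inverse l * g y \<partial>\<nu>) \<le> d"
      proof (rule dual[OF bcontfun_scale[OF 1(1)] Hs[OF 1(2), of "- inverse l"]])
        fix x y
        show "ereal (- inverse l * g y + - inverse l * h (x, y)) \<le> c (x, y)"
        proof (cases "c (x, y)")
          case (real v)
          then have "0 \<le> g y + h (x, y) + l * v" using 1(5)[of y x] by simp
          then have "0 \<le> inverse l * (g y + h (x, y) + l * v)" using l by simp
          also have "\<dots> = inverse l * g y + inverse l * h (x, y) + v" using l by (simp add: distrib_left)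
          finally show ?thesis by (simp add: real)
        qed (use c[of "(x, y)"] in auto)
      qed
      then have "l * - (inverse l * (\<integral>y. g y \<partial>\<nu>)) \<le> l * d" using l by (intro mult_left_mono) auto
      then show ?thesis using l by (simp add: 1(4) flip: mult.assoc)
    qed
  qed
  define V where "V = {f :: 'e \<times> 's \<Rightarrow> real. bounded (range f)}"
  define p where "p f = Inf {r. R f r}" for f
  have bound: "\<exists>b. \<forall>z. \<bar>f z\<bar> \<le> b" if "f \<in> V" for f using that by (auto simp: V_def bounded_iff)
  have bdd: "bdd_below {r. R f r}" if f: "f \<in> V" for f
  proof -
    obtain b where b: "\<And>z. \<bar>f z\<bar> \<le> b" using bound[OF f] by blast
    have "- b \<le> r" if r: "R f r" for r
    proof -
      have "- f z \<le> b" for z using b[of z] by linarith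
      \<comment> \<open>A majorant of \<open>f\<close> plus the constant majorant \<open>b\<close>
        of -f is a majorant of 0.\<close>
      then have "R (\<lambda>z. f z + - f z) (r + b)" by (intro R_add[OF r] R_const)
      then show ?thesis using R_nonneg[of "r + b"] by simp
    qed
    then show ?thesis by (intro bdd_belowI[of _ "- b"]) simp
  qed
  have ne: "{r. R f r} \<noteq> {}" if f: "f \<in> V" for f
  proof -
    obtain b where b: "\<And>z. \<bar>f z\<bar> \<le> b" using bound[OF f] by blast
    have "R f b" by (rule R_const) (use b abs_le_D1 in blast)
    then show ?thesis by blast
  qed
  have p_le: "p f \<le> r" if "f \<in> V" "R f r" for f r
    unfolding p_def using bdd[OF that(1)] that(2) by (intro cInf_lower) auto
  have p_ge: "b \<le> p f" if "f \<in> V" "\<And>r. R f r \<Longrightarrow> b \<le> r" for f b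
    unfolding p_def using ne[OF that(1)] that(2) by (intro cInf_greatest) auto
  have subV: "function_subspace V" unfolding V_def by (rule function_subspace_bounded)
  have "sublinear_on V p"
  proof (rule sublinear_onI[OF subV])
    fix f f' assume f: "f \<in> V" and f': "f' \<in> V"
    then have ff: "(\<lambda>z. f z + f' z) \<in> V" using subV unfolding function_subspace_def by blast
    have *: "p (\<lambda>z. f z + f' z) - r \<le> p f'" if r: "R f r" for r
    proof (rule p_ge[OF f'])
      fix r' assume "R f' r'"
      then have "p (\<lambda>z. f z + f' z) \<le> r + r'" by (intro p_le[OF ff] R_add[OF r])
      then show "p (\<lambda>z. f z + f' z) - r \<le> r'" by simp
    qed
    have "p (\<lambda>z. f z + f' z) - p f' \<le> p f"
    proof (rule p_ge[OF f])
      fix r assume "R f r"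
      from *[OF this] show "p (\<lambda>z. f z + f' z) - p f' \<le> r" by simp
    qed
    then show "p (\<lambda>z. f z + f' z) \<le> p f + p f'" by simp
  next
    fix f and a :: real assume f: "f \<in> V" and a: "a > 0"
    then have af: "(\<lambda>z. a * f z) \<in> V" using subV unfolding function_subspace_def by blast
    have "p (\<lambda>z. a * f z) / a \<le> p f"
    proof (rule p_ge[OF f])
      fix r assume "R f r"
      then have "p (\<lambda>z. a * f z) \<le> a * r" by (intro p_le[OF af] R_scale a)
      then show "p (\<lambda>z. a * f z) / a \<le> r" using a by (simp add: field_simps)
    qed
    then show "p (\<lambda>z. a * f z) \<le> a * p f" using a by (simp add: field_simps)
  next
    have z: "(\<lambda>z. 0) \<in> V" by (simp add: V_def)
    show "p (\<lambda>z. 0) = 0"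
      using p_le[OF z R_const[of "\<lambda>z. 0" 0]] p_ge[OF z R_nonneg] by (intro antisym) simp_all
  qed
  then obtain L where L: "\<And>f g. f \<in> V \<Longrightarrow> g \<in> V \<Longrightarrow> L (\<lambda>z. f z + g z) = L f + L g"
    "\<And>f a. f \<in> V \<Longrightarrow> L (\<lambda>z. a * f z) = a * L f" "\<And>f. f \<in> V \<Longrightarrow> L f \<le> p f"
    using sublinear_dominates_linear[OF subV] by blast
  have LR: "L f \<le> r" if "f \<in> V" "R f r" for f r using L(3)[OF that(1)] p_le[OF that] by simp
  have neg: "(\<lambda>z. - 1 * f z) \<in> V" "L (\<lambda>z. - 1 * f z) = - L f" if f: "f \<in> V" for f
  proof -
    show "(\<lambda>z. - 1 * f z) \<in> V" using subV f unfolding function_subspace_def by blast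
    show "L (\<lambda>z. - 1 * f z) = - L f" using L(2)[OF f, of "- 1"] by simp
  qed
  have pos: "0 \<le> L f" if f: "f \<in> V" "\<And>z. 0 \<le> f z" for f
  proof -
    have "L (\<lambda>z. - 1 * f z) \<le> 0"
      by (rule LR[OF neg(1)[OF f(1)]], rule R_const) (use f(2) in simp)
    then show ?thesis using neg(2)[OF f(1)] by simp
  qed
  have gV: "(\<lambda>z. g (snd z)) \<in> V" if "g \<in> bcontfun" for g
    using that by (auto simp: V_def bcontfun_def bounded_iff)
  \<comment> \<open>The upper bound suffices: \<open>bcontfun\<close> is closed under negation, so
    applying it to -g gives the reverse inequality. The same is done for
    \<open>H_maps\<close>.\<close>
  have Lg_le: "L (\<lambda>z. g (snd z)) \<le> (\<integral>y. g y \<partial>\<nu>)" if g: "g \<in> bcontfun" for g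
    by (rule LR[OF gV[OF g]], rule RI[of _ _ 0, OF g H_maps_zero]) simp_all
  have Lg: "L (\<lambda>z. g (snd z)) = (\<integral>y. g y \<partial>\<nu>)" if g: "g \<in> bcontfun" for g
  proof -
    from neg(2)[OF gV[OF g]] have "L (\<lambda>z. - 1 * g (snd z)) = - L (\<lambda>z. g (snd z))" .
    then show ?thesis using Lg_le[OF bcontfun_scale[OF g, of "- 1"]] Lg_le[OF g] by simp
  qed
  have Hb: "h \<in> V" if "h \<in> ?H" for h using H_maps_bounded[OF that] by (auto simp: V_def bounded_iff)
  have Lh_le: "L h \<le> 0" if h: "h \<in> ?H" for h
    by (rule LR[OF Hb[OF h]], rule RI[of _ _ 0, OF bcontfun_const[of 0] h]) simp_all
  have Lh: "L h = 0" if h: "h \<in> ?H" for h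
    using Lh_le[OF h] Lh_le[OF Hs[OF h, of "- 1"]] neg(2)[OF Hb[OF h]] by simp
  have Lc: "L f \<le> d" if f: "f \<in> V" "\<And>z. ereal (f z) \<le> c z" for f
    by (rule LR[OF f(1)], rule RI[of _ _ 1, OF bcontfun_const[of 0] H_maps_zero]) (use f(2) in auto)
  show thesis
    by (rule that[of L]) (use L(1,2) pos Lg Lh Lc in \<open>auto simp: V_def\<close>)
qed

section \<open>The optimal plan\<close>

text \<open>The tents decrease to the indicator of a closed set. \<open>C\<close> is taken non-empty
  because the distance to the empty set is 0 by convention, which would make every tent equal to
  1.\<close>

lemma limit_infdist_tents:
  fixes M :: "'a::metric_space measure"
  assumes "prob_space M" and sets: "sets M = sets borel" and C: "closed C" "C \<noteq> {}"
  shows "(\<lambda>k. \<integral>y. max 0 (1 - real k * infdist y C) \<partial>M) \<longlonglongrightarrow> measure M C"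
proof -
  interpret prob_space M by fact
  have sp: "space M = UNIV" using sets_eq_imp_space_eq[OF sets] by simp
  have m: "f \<in> borel_measurable M" if "continuous_on UNIV f" for f :: "'a \<Rightarrow> real"
    using borel_measurable_continuous_onI[OF that] sets by (simp cong: measurable_cong_sets)
  have "(\<lambda>k. \<integral>y. max 0 (1 - real k * infdist y C) \<partial>M) \<longlonglongrightarrow> (\<integral>y. indicator C y \<partial>M)"
  proof (rule integral_dominated_convergence[where w = "\<lambda>_. 1"])
    show "(indicator C :: 'a \<Rightarrow> real) \<in> borel_measurable M"
      using C(1) by (intro borel_measurable_indicator) (simp add: sets borel_closed)
    show "(\<lambda>y. max 0 (1 - real k * infdist y C)) \<in> borel_measurable M" for k
      by (intro m continuous_intros)
    show "AE y in M. (\<lambda>k. max 0 (1 - real k * infdist y C)) \<longlonglongrightarrow> indicator C y"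
    proof (rule AE_I2)
      fix y
      show "(\<lambda>k. max 0 (1 - real k * infdist y C)) \<longlonglongrightarrow> indicator C y"
      proof (cases "y \<in> C")
        case True
        then show ?thesis by simp
      next
        case False
        then have pos: "infdist y C > 0" using C infdist_pos_not_in_closed by blast
        obtain K where K: "real K > 1 / infdist y C" using reals_Archimedean2 by blast
        have "max 0 (1 - real k * infdist y C) = 0" if "k \<ge> K" for k
        proof -
          have "1 / infdist y C < real k" using K that by simp
          then show ?thesis using pos by (simp add: field_simps)
        qed
        then have "eventually (\<lambda>k. max 0 (1 - real k * infdist y C) = 0) sequentially"
          unfolding eventually_sequentially by blast
        then show ?thesis using False by (simp add: tendsto_eventually)
      qed
    qed
    show "AE y in M. norm (max 0 (1 - real k * infdist y C)) \<le> 1" for k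
      by (rule AE_I2) (simp add: infdist_nonneg)
  qed simp
  then show ?thesis using C(1) by (simp add: sets borel_closed)
qed

locale plan_functional =
  fixes \<eta> :: "'e::polish_space measure" and \<nu> :: "'s::polish_space measure"
    and L :: "('e \<times> 's \<Rightarrow> real) \<Rightarrow> real"
  assumes \<eta>: "\<eta> \<in> borel_probs" and \<nu>: "\<nu> \<in> borel_probs"
    and L_add: "\<And>f g. bounded (range f) \<Longrightarrow> bounded (range g) \<Longrightarrow> L (\<lambda>z. f z + g z) = L f + L g"
    and L_cmult: "\<And>f a. bounded (range f) \<Longrightarrow> L (\<lambda>z. a * f z) = a * L f"
    and L_nonneg: "\<And>f. bounded (range f) \<Longrightarrow> (\<And>z. 0 \<le> f z) \<Longrightarrow> 0 \<le> L f"
    and L_fst: "\<And>A. A \<in> sets borel \<Longrightarrow> L (\<lambda>z. indicator A (fst z)) = measure \<eta> A"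
    and L_snd: "\<And>g. g \<in> bcontfun \<Longrightarrow> L (\<lambda>z. g (snd z)) = (\<integral>y. g y \<partial>\<nu>)"
begin

sublocale E: prob_space \<eta> by (rule borel_probsD(1)[OF \<eta>])
sublocale S: prob_space \<nu> by (rule borel_probsD(1)[OF \<nu>])

lemma sets_\<eta>: "sets \<eta> = sets borel" and space_\<eta>: "space \<eta> = UNIV"
  using borel_probsD[OF \<eta>] by auto

definition \<Lambda> :: "'e set \<Rightarrow> 's set \<Rightarrow> real" where
  "\<Lambda> A B = L (\<lambda>z. indicator A (fst z) * indicator B (snd z))"

lemma L_mono:
  assumes f: "bounded (range f)" and g: "bounded (range g)" and le: "\<And>z. f z \<le> g z"
  shows "L f \<le> L g"
proof -
  have nf: "bounded (range (\<lambda>z. - 1 * f z))" using bounded_scaleR_comp[OF f, of "- 1"] by simp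
  have "0 \<le> L (\<lambda>z. g z + - 1 * f z)"
    using bounded_plus_comp[OF g nf] by (intro L_nonneg) (simp_all add: le)
  also have "\<dots> = L g + - 1 * L f" by (simp only: L_add[OF g nf] L_cmult[OF f])
  finally show ?thesis by simp
qed

lemma L_const: "L (\<lambda>z. b) = b"
  using L_snd[OF bcontfun_const[of b]] S.prob_space by simp

lemma L_bound:
  assumes "\<And>z. \<bar>f z\<bar> \<le> b"
  shows "\<bar>L f\<bar> \<le> b"
proof -
  have f: "bounded (range f)" using assms by (auto simp: bounded_iff)
  have c: "bounded (range (\<lambda>z::'e \<times> 's. v))" for v :: real by simp
  have "L f \<le> L (\<lambda>z. b)" "L (\<lambda>z. - b) \<le> L f"
    using assms by (auto intro!: L_mono f c simp: abs_le_iff minus_le_iff)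
  then show ?thesis by (simp add: L_const)
qed

lemma bounded_rectangle: "bounded (range (\<lambda>z. indicator A (fst z) * indicator B (snd z) :: real))"
  by (auto simp: bounded_iff indicator_def intro!: exI[of _ 1])

text \<open>Tents are bounded continuous majorants of the indicator of \<open>C\<close>, on which
  \<open>L\<close> is integration against \<nu>; then they shrink to \<open>C\<close>.\<close>

lemma \<Lambda>_closed:
  assumes C: "closed C"
  shows "\<Lambda> UNIV C \<le> measure \<nu> C"
proof (cases "C = {}")
  case True
  then show ?thesis using L_const[of 0] by (simp add: \<Lambda>_def)
next
  case False
  have "\<Lambda> UNIV C \<le> (\<integral>y. max 0 (1 - real k * infdist y C) \<partial>\<nu>)" for k
  proof -
    have b: "bounded (range (\<lambda>y. max 0 (1 - real k * infdist y C)))"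
      by (auto simp: bounded_iff infdist_nonneg intro!: exI[of _ 1])
    have "(\<lambda>y. max 0 (1 - real k * infdist y C)) \<in> bcontfun"
      using b by (auto simp: bcontfun_def intro!: continuous_intros)
    from L_snd[OF this] have "(\<integral>y. max 0 (1 - real k * infdist y C) \<partial>\<nu>) = L (\<lambda>z. max 0 (1 - real k * infdist (snd z) C))"
      by simp
    moreover have "bounded (range (\<lambda>z::'e \<times> 's. max 0 (1 - real k * infdist (snd z) C)))"
      by (rule bounded_subset[OF b]) auto
    then have "\<Lambda> UNIV C \<le> L (\<lambda>z. max 0 (1 - real k * infdist (snd z) C))"
      unfolding \<Lambda>_def by (rule L_mono[OF bounded_rectangle]) (auto simp: indicator_def)
    ultimately show ?thesis by simp
  qed
  then show ?thesis
    using limit_infdist_tents[OF borel_probsD(1,2)[OF \<nu>] C False] by (intro LIMSEQ_le_const) auto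
qed

lemma additive_plan_\<Lambda>:
  assumes "ball_base a r" and "\<And>n. measure \<nu> {y. dist (a n) y = r n} = 0"
  shows "additive_plan a r \<eta> \<nu> \<Lambda>"
proof (intro additive_plan.intro additive_plan_axioms.intro assms)
  show "prob_space \<eta>" "prob_space \<nu>" by unfold_locales
  show "sets \<nu> = sets borel" by (rule borel_probsD(2)[OF \<nu>])
  show "0 \<le> \<Lambda> A B" for A B unfolding \<Lambda>_def by (intro L_nonneg bounded_rectangle) simp
  show "\<Lambda> (A \<union> A') B = \<Lambda> A B + \<Lambda> A' B" if "A \<inter> A' = {}" for A A' B
    unfolding \<Lambda>_def indicator_add[OF that, symmetric] distrib_right
    by (rule L_add[OF bounded_rectangle bounded_rectangle])
  show "\<Lambda> A (B \<union> B') = \<Lambda> A B + \<Lambda> A B'" if "B \<inter> B' = {}" for A B B'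
    unfolding \<Lambda>_def indicator_add[OF that, symmetric] distrib_left
    by (rule L_add[OF bounded_rectangle bounded_rectangle])
  show "\<Lambda> A UNIV = measure \<eta> A" if "A \<in> sets \<eta>" for A
    using L_fst[of A] that by (simp add: \<Lambda>_def sets_\<eta>)
  show "\<Lambda> (space \<eta>) B \<le> measure \<nu> B" if "closed B" for B
    using \<Lambda>_closed[OF that] by (simp add: space_\<eta>)
qed

end

section \<open>The plan glued from the kernel\<close>

locale plan_kernel = plan_functional \<eta> \<nu> L + K: additive_plan a r \<eta> \<nu> "plan_functional.\<Lambda> L"
  for \<eta> :: "'e::polish_space measure" and \<nu> :: "'s::polish_space measure"
    and L :: "('e \<times> 's \<Rightarrow> real) \<Rightarrow> real" and a :: "nat \<Rightarrow> 's" and r :: "nat \<Rightarrow> real"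
begin

abbreviation \<Theta> where "\<Theta> \<equiv> K.\<Theta>"

lemma \<Theta>_borel_probs: "\<Theta> x \<in> borel_probs"
  using K.\<Theta>_prob[of x] by (simp add: borel_probs_def space_\<eta>)

lemma prob_space_\<Theta>: "prob_space (\<Theta> x)"
  using K.\<Theta>_prob[of x] by (simp add: space_\<eta>)

definition \<gamma> :: "('e \<times> 's) measure" where
  "\<gamma> = \<eta> \<bind> (\<lambda>x. distr (\<Theta> x) borel (Pair x))"

lemma measurable_slices: "(\<lambda>x. distr (\<Theta> x) borel (Pair x)) \<in> measurable \<eta> (subprob_algebra borel)"
proof (rule measurable_distr2)
  have "sets (\<eta> \<Otimes>\<^sub>M (borel :: 's measure)) = sets (borel :: ('e \<times> 's) measure)"
    using sets_pair_measure_cong[OF sets_\<eta>, of "borel :: 's measure" borel]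
    by (metis borel_prod)
  then have "(\<lambda>z. z) \<in> measurable (\<eta> \<Otimes>\<^sub>M (borel :: 's measure)) (borel :: ('e \<times> 's) measure)"
    by (rule measurable_ident_sets)
  then show "case_prod Pair \<in> measurable (\<eta> \<Otimes>\<^sub>M (borel :: 's measure)) (borel :: ('e \<times> 's) measure)"
    by (simp add: id_def)
qed (rule K.\<Theta>_measurable)

lemma measurable_Pair_borel: "Pair x \<in> measurable borel (borel :: ('e \<times> 's) measure)"
  by (intro borel_measurable_continuous_onI continuous_intros)

lemma sets_\<gamma> [measurable_cong]: "sets \<gamma> = sets borel"
  unfolding \<gamma>_def by (rule sets_bind[OF sets_kernel[OF measurable_slices]]) (simp_all add: space_\<eta>)

lemma space_\<gamma> [simp]: "space \<gamma> = UNIV"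
  using sets_eq_imp_space_eq[OF sets_\<gamma>] by simp

lemma emeasure_\<gamma>: "Z \<in> sets borel \<Longrightarrow> emeasure \<gamma> Z = (\<integral>\<^sup>+x. emeasure (\<Theta> x) (Pair x -` Z) \<partial>\<eta>)"
  unfolding \<gamma>_def
  by (subst emeasure_bind[OF _ measurable_slices])
    (auto simp: space_\<eta> intro!: nn_integral_cong emeasure_distr[THEN trans] measurable_Pair_borel)

lemma times_borel: "A \<in> sets borel \<Longrightarrow> B \<in> sets borel \<Longrightarrow> (A \<times> B :: ('e \<times> 's) set) \<in> sets borel"
  by (rule borel_Times)

lemma emeasure_\<gamma>_times:
  assumes "A \<in> sets borel" "B \<in> sets borel"
  shows "emeasure \<gamma> (A \<times> B) = (\<integral>\<^sup>+x\<in>A. emeasure (\<Theta> x) B \<partial>\<eta>)"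
  unfolding emeasure_\<gamma>[OF times_borel[OF assms]]
  by (intro nn_integral_cong) (auto simp: indicator_def Pair_vimage_Sigma)

lemma \<gamma>_plan: "\<gamma> \<in> transference_plans \<eta> \<nu>"
proof -
  have 1: "emeasure \<gamma> (A \<times> UNIV) = emeasure \<eta> A" if "A \<in> sets borel" for A
    using that prob_space.emeasure_space_1[OF prob_space_\<Theta>]
    by (simp add: emeasure_\<gamma>_times sets_\<eta>)
  have 2: "emeasure \<gamma> (UNIV \<times> B) = emeasure \<nu> B" if "B \<in> sets borel" for B
    using K.\<Theta>_marginal[OF that] that by (simp add: emeasure_\<gamma>_times)
  have "emeasure \<gamma> UNIV = 1"
    using 1[of UNIV] E.emeasure_space_1 by (simp add: space_\<eta>)
  then have "prob_space \<gamma>" by (intro prob_spaceI) simp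
  moreover have "distr \<gamma> borel fst = \<eta>"
  proof (rule measure_eqI)
    fix A assume "A \<in> sets (distr \<gamma> borel fst)"
    then have A: "A \<in> sets borel" by simp
    have "fst -` A = A \<times> (UNIV :: 's set)" by auto
    then show "emeasure (distr \<gamma> borel fst) A = emeasure \<eta> A"
      using A 1[OF A] by (subst emeasure_distr) auto
  qed (simp add: sets_\<eta>)
  moreover have "distr \<gamma> borel snd = \<nu>"
  proof (rule measure_eqI)
    fix B assume "B \<in> sets (distr \<gamma> borel snd)"
    then have B: "B \<in> sets borel" by simp
    have "snd -` B = (UNIV :: 'e set) \<times> B" by auto
    then show "emeasure (distr \<gamma> borel snd) B = emeasure \<nu> B"
      using B 2[OF B] by (subst emeasure_distr) auto
  qed (simp add: borel_probsD(2)[OF \<nu>])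
  ultimately show ?thesis by (simp add: transference_plans_def borel_probs_def sets_\<gamma>)
qed

sublocale G: prob_space \<gamma>
  using borel_probsD(1)[OF transference_plansD(1)[OF \<gamma>_plan]] .

lemma measure_\<Theta>_measurable: "B \<in> sets borel \<Longrightarrow> (\<lambda>x. measure (\<Theta> x) B) \<in> borel_measurable \<eta>"
  unfolding measure_def by (intro measurable_compose[OF K.emeasure_\<Theta>_measurable]) auto

lemma integral_measure_\<Theta>:
  assumes A: "A \<in> sets borel" and B: "B \<in> sets borel"
  shows "(\<integral>x. indicator A x * measure (\<Theta> x) B \<partial>\<eta>) = enn2real (\<integral>\<^sup>+x\<in>A. emeasure (\<Theta> x) B \<partial>\<eta>)"
proof -
  have "(\<integral>x. indicator A x * measure (\<Theta> x) B \<partial>\<eta>) = enn2real (\<integral>\<^sup>+x. ennreal (indicator A x * measure (\<Theta> x) B) \<partial>\<eta>)"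
    using A measure_\<Theta>_measurable[OF B]
    by (intro integral_eq_nn_integral borel_measurable_times borel_measurable_indicator) (auto simp: sets_\<eta>)
  also have "(\<integral>\<^sup>+x. ennreal (indicator A x * measure (\<Theta> x) B) \<partial>\<eta>) = (\<integral>\<^sup>+x\<in>A. emeasure (\<Theta> x) B \<partial>\<eta>)"
    by (intro nn_integral_cong)
      (auto simp: indicator_def finite_measure.emeasure_eq_measure[OF prob_space.finite_measure[OF prob_space_\<Theta>]])
  finally show ?thesis .
qed

lemma is_kernel_\<Theta>: "is_kernel \<eta> \<gamma> \<Theta>"
  unfolding is_kernel_def
proof (intro conjI allI ballI)
  show "\<Theta> x \<in> borel_probs" for x by (rule \<Theta>_borel_probs)
  show "(\<lambda>x. measure (\<Theta> x) B) \<in> borel_measurable borel" if "B \<in> sets borel" for B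
    using measure_\<Theta>_measurable[OF that] by (simp add: sets_\<eta> cong: measurable_cong_sets)
  show "measure \<gamma> (A \<times> B) = (LINT x:A|\<eta>. measure (\<Theta> x) B)" if "A \<in> sets borel" "B \<in> sets borel" for A B
    using integral_measure_\<Theta>[OF that] emeasure_\<gamma>_times[OF that]
    by (simp add: set_lebesgue_integral_def measure_def)
qed

text \<open>Only the variable x is extended, from indicators to bounded Borel functions, using norm
  continuity of \<open>L\<close>. The set \<open>B\<close> stays fixed, so a \<nu>-continuity set
  qualifies as soon as \<open>eq\<close> is known for it.\<close>

lemma L_eq_kernel_integral:
  assumes B: "B \<in> sets borel"
    and eq: "\<And>A. A \<in> sets borel \<Longrightarrow> (\<integral>\<^sup>+x\<in>A. emeasure (\<Theta> x) B \<partial>\<eta>) = ennreal (\<Lambda> A B)"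
    and f: "f \<in> borel_measurable borel" "bounded (range f)"
  shows "L (\<lambda>z. f (fst z) * indicator B (snd z)) = (\<integral>x. f x * measure (\<Theta> x) B \<partial>\<eta>)"
proof -
  note ker = kernel_integral[OF \<eta> transference_plansD(1)[OF \<gamma>_plan] is_kernel_\<Theta> B]
  have fe: "f \<in> borel_measurable \<eta> \<longleftrightarrow> f \<in> borel_measurable borel" for f :: "'e \<Rightarrow> real"
    by (simp cong: measurable_cong_sets add: sets_\<eta>)
  have b: "bounded (range (\<lambda>z. f (fst z) * indicator B (snd z) :: real))" if f: "bounded (range f)" for f :: "'e \<Rightarrow> real"
  proof -
    obtain b where b: "\<And>x. \<bar>f x\<bar> \<le> b" using f by (auto simp: bounded_iff)
    have "0 \<le> b" using b[of undefined] by simp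
    then show ?thesis using b by (auto simp: bounded_iff indicator_def intro!: exI[of _ b])
  qed
  define \<l> where "\<l> f = L (\<lambda>z. f (fst z) * indicator B (snd z)) - (\<integral>z. f (fst z) * indicator B (snd z) \<partial>\<gamma>)"
    for f :: "'e \<Rightarrow> real"
  have "\<l> f = 0"
  proof (rule bounded_functional_eq_zero[where \<l> = \<l> and f = f and M = \<eta> and K = 2])
    fix f :: "'e \<Rightarrow> real" and a
    assume f: "f \<in> borel_measurable \<eta>" "bounded (range f)"
    show "\<l> (\<lambda>x. a * f x) = a * \<l> f"
      using L_cmult[OF b[OF f(2)], of a] by (simp add: \<l>_def mult.assoc right_diff_distrib)
  next
    fix f g :: "'e \<Rightarrow> real"
    assume f: "f \<in> borel_measurable \<eta>" "g \<in> borel_measurable \<eta>" "bounded (range f)" "bounded (range g)"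
    have "(\<integral>z. f (fst z) * indicator B (snd z) + g (fst z) * indicator B (snd z) \<partial>\<gamma>)
        = (\<integral>z. f (fst z) * indicator B (snd z) \<partial>\<gamma>) + (\<integral>z. g (fst z) * indicator B (snd z) \<partial>\<gamma>)"
      using f by (intro Bochner_Integration.integral_add ker(1)) (simp_all add: fe)
    then show "\<l> (\<lambda>x. f x + g x) = \<l> f + \<l> g"
      using L_add[OF b[OF f(3)] b[OF f(4)]] by (simp add: \<l>_def distrib_right)
  next
    fix f :: "'e \<Rightarrow> real" and v
    assume f: "f \<in> borel_measurable \<eta>" and v: "\<And>x. \<bar>f x\<bar> \<le> v"
    have f': "f \<in> borel_measurable borel" "bounded (range f)" using f v by (auto simp: fe bounded_iff)
    have v0: "0 \<le> v" using v[of undefined] by simp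
    have le: "\<bar>f (fst z) * indicator B (snd z)\<bar> \<le> v" for z using v v0 by (auto simp: indicator_def)
    have "\<bar>\<integral>z. f (fst z) * indicator B (snd z) \<partial>\<gamma>\<bar> \<le> (\<integral>z. \<bar>f (fst z) * indicator B (snd z)\<bar> \<partial>\<gamma>)"
      by (rule integral_abs_bound)
    also have "\<dots> \<le> (\<integral>z. v \<partial>\<gamma>)"
      using ker(1)[OF f'] le by (intro integral_mono) simp_all
    finally have 1: "\<bar>\<integral>z. f (fst z) * indicator B (snd z) \<partial>\<gamma>\<bar> \<le> v" using G.prob_space by simp
    show "\<bar>\<l> f\<bar> \<le> 2 * v"
      using 1 L_bound[of "\<lambda>z. f (fst z) * indicator B (snd z)", OF le] unfolding \<l>_def by linarith
  next
    fix A assume "A \<in> sets \<eta>"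
    then have A: "A \<in> sets borel" by (simp add: sets_\<eta>)
    have "bounded (range (indicator A :: 'e \<Rightarrow> real))"
      by (auto simp: bounded_iff indicator_def intro!: exI[of _ 1])
    then have "(\<integral>z. indicator A (fst z) * indicator B (snd z) \<partial>\<gamma>) = (\<integral>x. indicator A x * measure (\<Theta> x) B \<partial>\<eta>)"
      using A by (intro ker(2)) simp_all
    also have "\<dots> = \<Lambda> A B"
      using K.nonneg[of A B] A by (simp add: integral_measure_\<Theta>[OF A B] eq sets_\<eta>)
    finally show "\<l> (indicator A) = 0" by (simp add: \<l>_def \<Lambda>_def)
  qed (use f in \<open>simp_all add: fe space_\<eta>\<close>)
  then show ?thesis using ker(2)[OF f] by (simp add: \<l>_def)
qed

end

context plan_kernel begin

text \<open>Take a \<nu>-continuity set C in \<open>BS t\<close>, its kernel mass W and the residual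
  g of W. The product of g and the indicator of C lies in \<open>H_maps\<close>, so \<open>L\<close>
  annihilates it; as \<open>L\<close> is there the kernel integral, g is orthogonal to W, and
  \<open>measurable_if_orthogonal\<close> applies.\<close>

lemma \<gamma>_causal:
  fixes I :: "'i::linorder set"
  assumes BE: "borel_filtration I BE" and BS: "borel_filtration I BS"
    and L_H: "\<And>h. h \<in> H_maps I BE BS \<eta> \<Longrightarrow> L h = 0"
  shows "\<gamma> \<in> causal_plans I BE BS \<eta> \<nu>"
proof -
  have "kernel_sigma BS \<eta> \<nu> \<Theta> t \<subseteq> sigma_completion \<eta> (BE t)" if t: "t \<in> I" for t
  proof -
    have t': "Some t \<in> insert None (Some ` I)" using t by simp
    interpret C: conditioning \<eta> "BE t"
      using conditioning_with_trivial[OF BE \<eta> t'] by (simp add: with_trivial_def)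
    have W: "(\<lambda>x. measure (\<Theta> x) C) \<in> borel_measurable (cond_algebra \<eta> (BE t))"
      if C: "C \<in> BS t" "measure \<nu> (frontier C) = 0" for C
    proof -
      have Cb: "C \<in> sets borel" using BS t C(1) by (auto simp: borel_filtration_def)
      have fr: "frontier C \<in> null_sets \<nu>"
        using C(2) by (auto simp: null_sets_def borel_probsD(2)[OF \<nu>] borel_closed S.emeasure_eq_measure)
      have bd: "\<bar>measure (\<Theta> x) C\<bar> \<le> 1" for x
        using prob_space.prob_le_1[OF prob_space_\<Theta>] by simp
      show ?thesis
      proof (rule C.measurable_if_orthogonal[OF measure_\<Theta>_measurable[OF Cb] bd])
        fix g assume g: "g \<in> borel_measurable \<eta>" "bounded (range g)"
          and res: "AE x in \<eta>. g x = measure (\<Theta> x) C - C.E (\<lambda>x. measure (\<Theta> x) C) x"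
        have gb: "g \<in> borel_measurable borel" using g(1) by (simp add: sets_\<eta> cong: measurable_cong_sets)
        have "(\<lambda>x. measure (\<Theta> x) C) \<in> L_infty \<eta>"
          using measure_\<Theta>_measurable[OF Cb] bd by (auto simp: L_infty_def)
        then have T: "H_term I BE BS \<eta> (Some t) g C"
          unfolding H_term_def using t C(1) gb g(2) res by (auto simp: with_trivial_def)
        have "(\<lambda>z. g (fst z) * indicator C (snd z)) \<in> borel_measurable borel"
          using gb Cb by (intro borel_measurable_times measurable_compose[OF borel_fst] measurable_compose[OF borel_snd]) auto
        then have "L (\<lambda>z. g (fst z) * indicator C (snd z)) = 0"
          by (intro L_H H_maps_single[OF T])
        then show "(\<integral>x. g x * measure (\<Theta> x) C \<partial>\<eta>) = 0"
          using L_eq_kernel_integral[OF Cb K.\<Theta>_continuity_set[OF Cb fr] gb g(2)] by (simp add: sets_\<eta>)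
      qed
    qed
    have "{(\<lambda>x. measure (\<Theta> x) C) -` V | C V. C \<in> BS t \<and> measure \<nu> (frontier C) = 0 \<and> V \<in> sets (borel :: real measure)}
        \<subseteq> sets (cond_algebra \<eta> (BE t))"
    proof safe
      fix C and V :: "real set" assume "C \<in> BS t" "measure \<nu> (frontier C) = 0" "V \<in> sets borel"
      then show "(\<lambda>x. measure (\<Theta> x) C) -` V \<in> sets (cond_algebra \<eta> (BE t))"
        using measurable_sets[OF W] by simp
    qed
    then have "sigma_sets UNIV {(\<lambda>x. measure (\<Theta> x) C) -` V | C V. C \<in> BS t \<and> measure \<nu> (frontier C) = 0 \<and> V \<in> sets (borel :: real measure)}
        \<subseteq> sets (cond_algebra \<eta> (BE t))"
      using sets.sigma_sets_subset[of _ "cond_algebra \<eta> (BE t)"] by simp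
    moreover have "null_sets (completion \<eta>) \<subseteq> sets (cond_algebra \<eta> (BE t))"
      by (auto intro: sigma_completion_null)
    ultimately have "kernel_sigma BS \<eta> \<nu> \<Theta> t \<subseteq> sets (cond_algebra \<eta> (BE t))"
      unfolding kernel_sigma_def sigma_completion_def[of \<eta> "sigma_sets _ _"]
      using sets.sigma_sets_subset[of _ "cond_algebra \<eta> (BE t)"] by (simp only: space_cond_algebra Un_subset_iff)
    then show ?thesis by simp
  qed
  then show ?thesis
    unfolding causal_plans_def using \<gamma>_plan is_kernel_\<Theta> by blast
qed

section \<open>Functions integrated alike by the functional and the plan\<close>

text \<open>Agreement is required after cutting by any rectangle with saturated second side. This
  local form allows different functions to be pasted together on a rectangle and off it, as maxima
  require.\<close>

definition exact :: "('e \<times> 's \<Rightarrow> real) \<Rightarrow> bool" where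
  "exact f \<longleftrightarrow> f \<in> borel_measurable borel \<and> bounded (range f) \<and>
     (\<forall>A n B. A \<in> sets borel \<longrightarrow> K.saturated n B \<longrightarrow>
        L (\<lambda>z. f z * (indicator A (fst z) * indicator B (snd z)))
          = (\<integral>z. f z * (indicator A (fst z) * indicator B (snd z)) \<partial>\<gamma>))"

lemma rectangle_measurable:
  "A \<in> sets borel \<Longrightarrow> K.saturated n B \<Longrightarrow>
     (\<lambda>z. indicator A (fst z) * indicator B (snd z) :: real) \<in> borel_measurable borel"
  using K.saturated_borel[of n B]
  by (intro borel_measurable_times measurable_compose[OF borel_fst] measurable_compose[OF borel_snd]) auto

lemma bounded_times_rectangle:
  assumes "bounded (range f)"
  shows "bounded (range (\<lambda>z. f z * (indicator A (fst z) * indicator B (snd z)) :: real))"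
proof -
  obtain b where b: "\<And>z. \<bar>f z\<bar> \<le> b" using assms by (auto simp: bounded_iff)
  have "0 \<le> b" using b[of undefined] by simp
  then show ?thesis using b by (auto simp: bounded_iff indicator_def intro!: exI[of _ b])
qed

lemma integrable_bounded:
  fixes f :: "'e \<times> 's \<Rightarrow> real"
  assumes "f \<in> borel_measurable borel" "bounded (range f)"
  shows "integrable \<gamma> f"
proof -
  obtain b where "\<And>z. \<bar>f z\<bar> \<le> b" using assms(2) by (auto simp: bounded_iff)
  then show ?thesis
    using assms(1) by (intro G.integrable_const_bound[of _ b]) (auto simp: sets_\<gamma> cong: measurable_cong_sets)
qed

lemma exactD:
  assumes "exact f"
  shows "f \<in> borel_measurable borel" "bounded (range f)"
    and "A \<in> sets borel \<Longrightarrow> K.saturated n B \<Longrightarrow> L (\<lambda>z. f z * (indicator A (fst z) * indicator B (snd z)))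
      = (\<integral>z. f z * (indicator A (fst z) * indicator B (snd z)) \<partial>\<gamma>)"
  using assms unfolding exact_def by blast+

lemma exact_const: "exact (\<lambda>z. s)"
  unfolding exact_def
proof (intro conjI allI impI)
  fix A :: "'e set" and n and B :: "'s set" assume A: "A \<in> sets borel" and B: "K.saturated n B"
  note Bb = K.saturated_borel[OF B]
  have "(\<integral>z. indicator A (fst z) * indicator B (snd z) \<partial>\<gamma>) = (\<integral>z. (indicator (A \<times> B) z :: real) \<partial>\<gamma>)"
    by (intro Bochner_Integration.integral_cong) (auto simp: indicator_def)
  also have "\<dots> = measure \<gamma> (A \<times> B)" by simp
  also have "\<dots> = \<Lambda> A B"
    using K.\<Theta>_saturated[OF B, of A] K.nonneg[of A B] A emeasure_\<gamma>_times[OF A Bb]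
    by (simp add: measure_def sets_\<eta>)
  finally show "L (\<lambda>z. s * (indicator A (fst z) * indicator B (snd z)))
      = (\<integral>z. s * (indicator A (fst z) * indicator B (snd z)) \<partial>\<gamma>)"
    using L_cmult[OF bounded_rectangle] by (simp add: \<Lambda>_def)
qed auto

lemma exact_add:
  assumes f: "exact f" and g: "exact g"
  shows "exact (\<lambda>z. f z + g z)"
  unfolding exact_def
proof (intro conjI allI impI)
  show "(\<lambda>z. f z + g z) \<in> borel_measurable borel" using exactD(1)[OF f] exactD(1)[OF g] by measurable
  show "bounded (range (\<lambda>z. f z + g z))" by (rule bounded_plus_comp[OF exactD(2)[OF f] exactD(2)[OF g]])
  fix A :: "'e set" and n and B :: "'s set" assume AB: "A \<in> sets borel" "K.saturated n B"
  have "integrable \<gamma> (\<lambda>z. h z * (indicator A (fst z) * indicator B (snd z)))" if h: "exact h" for h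
    by (intro integrable_bounded bounded_times_rectangle exactD[OF h] borel_measurable_times rectangle_measurable[OF AB])
  then show "L (\<lambda>z. (f z + g z) * (indicator A (fst z) * indicator B (snd z)))
      = (\<integral>z. (f z + g z) * (indicator A (fst z) * indicator B (snd z)) \<partial>\<gamma>)"
    unfolding distrib_right
      L_add[OF bounded_times_rectangle[OF exactD(2)[OF f]] bounded_times_rectangle[OF exactD(2)[OF g]]]
      exactD(3)[OF f AB] exactD(3)[OF g AB]
    using f g by (intro Bochner_Integration.integral_add[symmetric])
qed

lemma exact_cmult:
  assumes f: "exact f"
  shows "exact (\<lambda>z. v * f z)"
  unfolding exact_def
proof (intro conjI allI impI)
  show "(\<lambda>z. v * f z) \<in> borel_measurable borel" using exactD(1)[OF f] by measurable
  show "bounded (range (\<lambda>z. v * f z))" using bounded_scaleR_comp[OF exactD(2)[OF f], of v] by simp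
  fix A :: "'e set" and n and B :: "'s set" assume AB: "A \<in> sets borel" "K.saturated n B"
  show "L (\<lambda>z. v * f z * (indicator A (fst z) * indicator B (snd z)))
      = (\<integral>z. v * f z * (indicator A (fst z) * indicator B (snd z)) \<partial>\<gamma>)"
    unfolding mult.assoc[of v] L_cmult[OF bounded_times_rectangle[OF exactD(2)[OF f]]] exactD(3)[OF f AB] by simp
qed

text \<open>Two rectangles meet in a rectangle, and the saturation levels combine to their
  maximum.\<close>

lemma exact_cut:
  assumes f: "exact f" and AB: "A \<in> sets borel" "K.saturated n B"
  shows "exact (\<lambda>z. f z * (indicator A (fst z) * indicator B (snd z)))"
  unfolding exact_def
proof (intro conjI allI impI)
  show "(\<lambda>z. f z * (indicator A (fst z) * indicator B (snd z))) \<in> borel_measurable borel"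
    by (intro borel_measurable_times[OF exactD(1)[OF f]] rectangle_measurable[OF AB])
  show "bounded (range (\<lambda>z. f z * (indicator A (fst z) * indicator B (snd z))))"
    by (rule bounded_times_rectangle[OF exactD(2)[OF f]])
  fix A' :: "'e set" and m and B' :: "'s set" assume AB': "A' \<in> sets borel" "K.saturated m B'"
  have eq: "(\<lambda>z. f z * (indicator A (fst z) * indicator B (snd z)) * (indicator A' (fst z) * indicator B' (snd z)))
      = (\<lambda>z. f z * (indicator (A \<inter> A') (fst z) * indicator (B \<inter> B') (snd z)))"
    by (rule ext) (simp add: indicator_inter_arith)
  show "L (\<lambda>z. f z * (indicator A (fst z) * indicator B (snd z)) * (indicator A' (fst z) * indicator B' (snd z)))
      = (\<integral>z. f z * (indicator A (fst z) * indicator B (snd z)) * (indicator A' (fst z) * indicator B' (snd z)) \<partial>\<gamma>)"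
    unfolding eq by (rule exactD(3)[OF f sets.Int[OF AB(1) AB'(1)] K.saturated_Int[OF AB(2) AB'(2)]])
qed

lemma L_exact:
  assumes "exact f"
  shows "L f = (\<integral>z. f z \<partial>\<gamma>)"
  using exactD(3)[OF assms, of UNIV 0 UNIV] by (simp add: K.saturated_def)

text \<open>The floor \<open>s\<close> is carried through the induction: on the new rectangle the
  floor rises to \<open>max (q k) s\<close>, and off it nothing changes because the value 0 there is
  absorbed by s \<ge> 0.\<close>

lemma exact_max_rectangles:
  fixes q :: "nat \<Rightarrow> real" and A :: "nat \<Rightarrow> 'e set" and B :: "nat \<Rightarrow> 's set"
  assumes "\<And>k. A k \<in> sets borel" and "\<And>k. \<exists>n. K.saturated n (B k)"
    and m0: "\<And>z. m 0 z = 0"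
    and mS: "\<And>k z. m (Suc k) z = max (m k z) (q k * (indicator (A k) (fst z) * indicator (B k) (snd z)))"
  shows "s \<ge> 0 \<Longrightarrow> exact (\<lambda>z. max (m k z) s)"
proof (induction k arbitrary: s)
  case 0
  then show ?case using exact_const[of s] by (simp add: m0)
next
  case (Suc k)
  let ?R = "\<lambda>z. indicator (A k) (fst z) * indicator (B k) (snd z) :: real"
  obtain n where n: "K.saturated n (B k)" using assms(2) by blast
  have 1: "exact (\<lambda>z. max (m k z) s)" using Suc by blast
  have 2: "exact (\<lambda>z. max (m k z) (max (q k) s))" using Suc by auto
  \<comment> \<open>Swaps the function with floor \<open>s\<close> for the one with the higher
    floor, on the rectangle only.\<close>
  have "exact (\<lambda>z. max (m k z) s + (max (m k z) (max (q k) s) * ?R z + - 1 * (max (m k z) s * ?R z)))"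
    by (intro exact_add exact_cmult exact_cut[OF _ assms(1) n] 1 2)
  moreover have "(\<lambda>z. max (m (Suc k) z) s)
      = (\<lambda>z. max (m k z) s + (max (m k z) (max (q k) s) * ?R z + - 1 * (max (m k z) s * ?R z)))"
    using Suc.prems by (intro ext) (auto simp: mS indicator_def max_def)
  ultimately show ?case by simp
qed

text \<open>A lower semicontinuous cost is an increasing limit of finite maxima of rectangles, on which
  \<open>L\<close> and \<open>\<gamma>\<close> agree.\<close>

lemma cost_le:
  assumes c: "\<And>z. 0 \<le> c z" and lsc: "lower_semicontinuous c"
    and Lc: "\<And>f. bounded (range f) \<Longrightarrow> (\<And>z. ereal (f z) \<le> c z) \<Longrightarrow> L f \<le> d"
  shows "(\<integral>\<^sup>+z. e2ennreal (c z) \<partial>\<gamma>) \<le> ennreal d"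
proof -
  obtain \<V> :: "'e set set" where V: "countable \<V>" "topological_basis \<V>" using ex_countable_basis by blast
  \<comment> \<open>By lower semicontinuity these countably many plateaus exhaust \<open>c\<close>
    from below. Their second sides are balls of the base, hence saturated.\<close>
  define R where "R = {(q :: rat, V, n). 0 \<le> q \<and> V \<in> \<V> \<and> (\<forall>z\<in>V \<times> K.U n. ereal (of_rat q) \<le> c z)}"
  \<comment> \<open>Height 0 needs no strict inequality, as c \<ge> 0; it shows that
    \<open>R\<close> is non-empty, so that \<open>R\<close> can be enumerated.\<close>
  have ex: "\<exists>V n. (q, V, n) \<in> R \<and> z \<in> V \<times> K.U n" if q: "0 \<le> q" and le: "ereal (of_rat q) < c z \<or> q = 0" for q z
  proof -
    obtain x y where z: "z = (x, y)" by (cases z)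
    obtain G where G: "open G" "z \<in> G" "\<And>w. w \<in> G \<Longrightarrow> ereal (of_rat q) \<le> c w"
    proof (cases "q = 0")
      case True
      then show thesis using that[of UNIV] c by (simp add: zero_ereal_def)
    next
      case False
      then show thesis
        using that[of "{w. ereal (of_rat q) < c w}"] le lsc by (auto simp: lower_semicontinuous_def)
    qed
    obtain P Q where PQ: "open P" "open Q" "x \<in> P" "y \<in> Q" "P \<times> Q \<subseteq> G"
      using open_prod_elim[OF G(1,2)] z by (metis mem_Sigma_iff)
    obtain V where V': "V \<in> \<V>" "x \<in> V" "V \<subseteq> P" using topological_basisE[OF V(2) PQ(1,3)] by blast
    obtain n where n: "y \<in> K.U n" "K.U n \<subseteq> Q"
      using open_eq_Union_balls[OF K.base PQ(2)] PQ(4) unfolding K.U_def by blast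
    have "(q, V, n) \<in> R" unfolding R_def using q V' n PQ(5) G(3) by blast
    then show ?thesis using V'(2) n(1) z by blast
  qed
  have "countable R"
  proof (rule countable_subset)
    show "R \<subseteq> UNIV \<times> (\<V> \<times> UNIV)" unfolding R_def by auto
    show "countable ((UNIV :: rat set) \<times> (\<V> \<times> (UNIV :: nat set)))" using V(1) by auto
  qed
  moreover have "R \<noteq> {}" using ex[of 0 undefined] by auto
  ultimately have "range (from_nat_into R) = R" by (intro range_from_nat_into)
  then obtain e :: "nat \<Rightarrow> rat \<times> 'e set \<times> nat" where e: "range e = R" by blast
  define q where "q k = real_of_rat (fst (e k))" for k
  define A where "A k = fst (snd (e k))" for k
  define B where "B k = K.U (snd (snd (e k)))" for k
  have eR: "e k \<in> R" for k using e by auto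
  have q0: "0 \<le> q k" and Vk: "A k \<in> \<V>" and le: "\<And>z. z \<in> A k \<times> B k \<Longrightarrow> ereal (q k) \<le> c z" for k
    using eR[of k] by (auto simp: R_def q_def A_def B_def split: prod.splits)
  \<comment> \<open>Running maxima of the plateaus, started at 0 so that they remain below
    \<open>c\<close> and have the form required by \<open>exact_max_rectangles\<close>.\<close>
  define m where "m = rec_nat (\<lambda>z. 0) (\<lambda>k f z. max (f z) (q k * (indicator (A k) (fst z) * indicator (B k) (snd z))))"
  have m0: "m 0 z = 0" and mS: "m (Suc k) z = max (m k z) (q k * (indicator (A k) (fst z) * indicator (B k) (snd z)))" for k z
    by (simp_all add: m_def)
  have mpos: "0 \<le> m k z" for k z by (induction k) (auto simp: m0 mS)
  have mle: "ereal (m k z) \<le> c z" for k z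
  proof (induction k)
    case 0
    then show ?case using c by (simp add: m0 zero_ereal_def)
  next
    case (Suc k)
    have "ereal (q k * (indicator (A k) (fst z) * indicator (B k) (snd z))) \<le> c z"
      using le[of z k] c[of z] by (cases z) (auto simp: indicator_def zero_ereal_def)
    then show ?case using Suc by (simp add: mS max_def)
  qed
  have ex_m: "exact (m k)" for k
  proof -
    have "exact (\<lambda>z. max (m k z) 0)"
    proof (rule exact_max_rectangles[OF _ _ m0 mS])
      show "A k \<in> sets borel" for k using topological_basis_open[OF V(2) Vk] by (rule borel_open)
      show "\<exists>n. K.saturated n (B k)" for k unfolding B_def using K.saturated_U by blast
    qed simp
    then show ?thesis using mpos by (simp add: max_absorb1)
  qed
  have sup: "(SUP k. ennreal (m k z)) = e2ennreal (c z)" for z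
  proof (rule antisym)
    show "(SUP k. ennreal (m k z)) \<le> e2ennreal (c z)"
    proof (rule SUP_least)
      fix k show "ennreal (m k z) \<le> e2ennreal (c z)"
        using e2ennreal_mono[OF mle[of k z]] by simp
    qed
    show "e2ennreal (c z) \<le> (SUP k. ennreal (m k z))"
    proof (rule dense_le)
      \<comment> \<open>A value strictly below \<open>c z\<close>, even an infinite one, is finite,
        which leaves room for a rational height in between.\<close>
      fix v assume v: "v < e2ennreal (c z)"
      then obtain p where p: "v = ennreal p" "0 \<le> p" by (cases v) (auto simp: top_unique)
      have "ereal p < c z"
      proof (rule ccontr)
        assume "\<not> ereal p < c z"
        then have "e2ennreal (c z) \<le> ennreal p" using e2ennreal_mono[of "c z" "ereal p"] by simp
        then show False using v p(1) by simp
      qed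
      then obtain w where w: "p < w" "ereal w < c z"
        using ereal_dense2[of "ereal p" "c z"] by auto
      obtain t where t: "p < of_rat t" "of_rat t < w" using of_rat_dense[OF w(1)] by blast
      have "ereal (of_rat t) < c z" using w(2) t(2) less_trans[of "ereal (of_rat t)" "ereal w"] by simp
      moreover have "0 < real_of_rat t" using p(2) t(1) by linarith
      then have "0 \<le> t" by simp
      ultimately obtain V n where Vn: "(t, V, n) \<in> R" "z \<in> V \<times> K.U n" using ex by blast
      then obtain k where k: "e k = (t, V, n)" using e by (metis rangeE)
      \<comment> \<open>\<open>m (Suc k)\<close> is the first maximum that includes plateau
        \<open>k\<close>.\<close>
      have "of_rat t \<le> m (Suc k) z" using Vn(2) k by (cases z) (auto simp: mS q_def A_def B_def)
      then have "v \<le> ennreal (m (Suc k) z)" unfolding p(1) using t(1) by (intro ennreal_leI) simp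
      then show "v \<le> (SUP k. ennreal (m k z))" by (rule SUP_upper2[OF UNIV_I])
    qed
  qed
  have "(\<integral>\<^sup>+z. e2ennreal (c z) \<partial>\<gamma>) = (\<integral>\<^sup>+z. (SUP k. ennreal (m k z)) \<partial>\<gamma>)" by (simp add: sup)
  also have "\<dots> = (SUP k. \<integral>\<^sup>+z. ennreal (m k z) \<partial>\<gamma>)"
  proof (rule nn_integral_monotone_convergence_SUP)
    show "incseq (\<lambda>k z. ennreal (m k z))"
      by (intro incseq_SucI le_funI ennreal_leI) (simp add: mS)
    show "(\<lambda>z. ennreal (m k z)) \<in> borel_measurable \<gamma>" for k
      using exactD(1)[OF ex_m] by (intro measurable_compose[OF _ measurable_ennreal]) (simp cong: measurable_cong_sets add: sets_\<gamma>)
  qed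
  also have "\<dots> \<le> ennreal d"
  proof (rule SUP_least)
    fix k
    have "(\<integral>\<^sup>+z. ennreal (m k z) \<partial>\<gamma>) = ennreal (\<integral>z. m k z \<partial>\<gamma>)"
      using integrable_bounded[OF exactD(1,2)[OF ex_m]] mpos by (intro nn_integral_eq_integral) auto
    also have "\<dots> = ennreal (L (m k))" by (simp add: L_exact[OF ex_m])
    also have "\<dots> \<le> ennreal d" by (intro ennreal_leI Lc exactD(2)[OF ex_m] mle)
    finally show "(\<integral>\<^sup>+z. ennreal (m k z) \<partial>\<gamma>) \<le> ennreal d" .
  qed
  finally show ?thesis .
qed

end

section \<open>The extra index and the duality theorem\<close>

text \<open>In the completed trivial sigma-field every set is null or has null complement, so
  \<open>f\<close> and its mean have the same integral over each of its sets. Through the extra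
  index this ties \<open>L\<close> to the marginal \<eta>.\<close>

lemma cond_exp_trivial:
  assumes "\<eta> \<in> borel_probs" and f: "f \<in> borel_measurable borel" "\<And>x. \<bar>f x\<bar> \<le> K"
  shows "AE x in \<eta>. real_cond_exp (completion \<eta>) (cond_algebra \<eta> {{}, UNIV}) f x = (\<integral>x. f x \<partial>\<eta>)"
proof -
  interpret conditioning \<eta> "{{}, UNIV}"
    using borel_probsD[OF assms(1)] by (intro conditioning.intro conditioning_axioms.intro) auto
  have fm: "f \<in> borel_measurable \<eta>" using f(1) by (simp add: sets_\<eta> cong: measurable_cong_sets)
  note cf = measurable_completion[OF fm]
  have i: "integrable (completion \<eta>) f" using f(2) by (intro integrable_L_infty[OF cf]) auto
  have triv: "A \<in> null_sets (completion \<eta>) \<or> - A \<in> null_sets (completion \<eta>)"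
    if "A \<in> sigma_sets UNIV ({{}, UNIV} \<union> null_sets (completion \<eta>))" for A
    using that
  proof (induction)
    case (Compl A)
    then show ?case by (auto simp: Compl_eq_Diff_UNIV[symmetric])
  next
    case (Union A)
    show ?case
    proof (cases "\<forall>i. A i \<in> null_sets (completion \<eta>)")
      case True
      then show ?thesis by (intro disjI1 null_sets_UN) auto
    next
      case False
      then obtain i where "- A i \<in> null_sets (completion \<eta>)" using Union by blast
      then have "- (\<Union>i. A i) \<in> null_sets (completion \<eta>)"
        by (rule null_sets_completion_subset[rotated]) auto
      then show ?thesis ..
    qed
  qed auto
  have "AE x in completion \<eta>. E f x = (\<integral>x. f x \<partial>\<eta>)"
  proof (rule c.real_cond_exp_charact[OF _ i])
    fix A assume "A \<in> sets F"
    then have "A \<in> null_sets (completion \<eta>) \<or> - A \<in> null_sets (completion \<eta>)" and Ac: "A \<in> sets (completion \<eta>)"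
      using triv c.subalg by (auto simp: sigma_completion_def subalgebra_def)
    then show "(\<integral>x\<in>A. f x \<partial>completion \<eta>) = (\<integral>x\<in>A. (\<integral>x. f x \<partial>\<eta>) \<partial>completion \<eta>)"
    proof (elim disjE)
      assume "A \<in> null_sets (completion \<eta>)"
      then have "AE x in completion \<eta>. x \<notin> A" by (rule AE_not_in)
      then have ae: "AE x in completion \<eta>. indicator A x = (0 :: real)" by eventually_elim simp
      have "(\<integral>x\<in>A. g x \<partial>completion \<eta>) = 0" for g :: "_ \<Rightarrow> real"
        unfolding set_lebesgue_integral_def
        by (rule integral_eq_zero_AE) (use ae in \<open>eventually_elim, simp\<close>)
      then show ?thesis by simp
    next
      assume "- A \<in> null_sets (completion \<eta>)"
      then have "AE x in completion \<eta>. x \<notin> - A" by (rule AE_not_in)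
      then have ae: "AE x in completion \<eta>. indicator A x = (1 :: real)" by eventually_elim simp
      have "(\<integral>x\<in>A. g x \<partial>completion \<eta>) = (\<integral>x. g x \<partial>completion \<eta>)"
        if "g \<in> borel_measurable (completion \<eta>)" for g :: "_ \<Rightarrow> real"
        unfolding set_lebesgue_integral_def
        by (rule integral_cong_AE) (use ae that Ac in \<open>auto elim: eventually_mono\<close>)
      then show ?thesis
        using cf c.prob_space by (simp add: integral_completion[OF fm])
    qed
  qed (use c.integrable_const in auto)
  then show ?thesis by (simp add: AE_completion_iff)
qed

theorem corollary2:
  fixes I :: "'i::linorder set"
    and BE :: "'i \<Rightarrow> 'e::polish_space set set"
    and BS :: "'i \<Rightarrow> 's::polish_space set set"
    and c :: "'e \<times> 's \<Rightarrow> ereal"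
    and \<eta> :: "'e measure" and \<nu> :: "'s measure"
  assumes "borel_filtration I BE"
    and "borel_filtration I BS"
    and "regular_filtration I BS"
    and "\<And>z. 0 \<le> c z"
    and "lower_semicontinuous c"
    and "\<eta> \<in> borel_probs" and "\<nu> \<in> borel_probs"
  shows "dual_value I BE BS c \<eta> \<nu> = primal_value I BE BS c \<eta> \<nu>"
proof (rule antisym)
  show "dual_value I BE BS c \<eta> \<nu> \<le> primal_value I BE BS c \<eta> \<nu>"
    unfolding dual_value_def primal_value_def
    by (rule SUP_least, rule INF_greatest) (auto intro: weak_duality[OF assms(1-3,6,7)])
next
  \<comment> \<open>The pair (0, 0) is admissible because c \<ge> 0. This excludes the dual value
    -\<infinity>, and for \<infinity> there is nothing to prove.\<close>
  have "ereal (\<integral>y. 0 \<partial>\<nu>) \<le> dual_value I BE BS c \<eta> \<nu>"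
    unfolding dual_value_def
    by (rule SUP_upper2[of "(\<lambda>y. 0, \<lambda>z. 0)"])
      (use assms(4) bcontfun_const[of 0] H_maps_zero[of I BE BS \<eta>] in \<open>auto simp: zero_ereal_def\<close>)
  then have pos: "0 \<le> dual_value I BE BS c \<eta> \<nu>" by (simp add: zero_ereal_def)
  show "primal_value I BE BS c \<eta> \<nu> \<le> dual_value I BE BS c \<eta> \<nu>"
  proof (cases "dual_value I BE BS c \<eta> \<nu>")
    case (real d)
    obtain L where L:
      "\<And>f g. bounded (range f) \<Longrightarrow> bounded (range g) \<Longrightarrow> L (\<lambda>z. f z + g z) = L f + L g"
      "\<And>f a. bounded (range f) \<Longrightarrow> L (\<lambda>z. a * f z) = a * L f"
      "\<And>f. bounded (range f) \<Longrightarrow> (\<And>z. 0 \<le> f z) \<Longrightarrow> 0 \<le> L f"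
      "\<And>g. g \<in> bcontfun \<Longrightarrow> L (\<lambda>z. g (snd z)) = (\<integral>y. g y \<partial>\<nu>)"
      and L_H: "\<And>h. h \<in> H_maps I BE BS \<eta> \<Longrightarrow> L h = 0"
      and L_c: "\<And>f. bounded (range f) \<Longrightarrow> (\<And>z. ereal (f z) \<le> c z) \<Longrightarrow> L f \<le> d"
      using dual_functional[OF assms(1,6,7,4) real] by blast
    interpret E: prob_space \<eta> by (rule borel_probsD(1)[OF assms(6)])
    interpret S: prob_space \<nu> by (rule borel_probsD(1)[OF assms(7)])
    \<comment> \<open>The indicator of \<open>A\<close> minus \<eta>(A), constant in y, belongs to
      \<open>H_maps\<close> at the extra index, where the conditional expectation is the mean;
      \<open>L\<close> annihilates it and preserves constants.\<close>
    have L_fst: "L (\<lambda>z. indicator A (fst z)) = measure \<eta> A" if A: "A \<in> sets borel" for A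
    proof -
      let ?f = "indicator A :: 'e \<Rightarrow> real" and ?m = "measure \<eta> A"
      define h where "h z = (?f (fst z) - ?m) * indicator UNIV (snd z)" for z :: "'e \<times> 's"
      have A': "A \<in> sets \<eta>" using A by (simp add: borel_probsD(2)[OF assms(6)])
      have int: "(\<integral>x. ?f x \<partial>\<eta>) = ?m" using A' by simp
      have fm: "?f \<in> borel_measurable borel" using A by simp
      have "AE x in \<eta>. real_cond_exp (completion \<eta>) (cond_algebra \<eta> {{}, UNIV}) ?f x = ?m"
        using cond_exp_trivial[OF assms(6) fm, of 1] unfolding int by (simp add: indicator_def)
      moreover have "?f \<in> L_infty \<eta>" using A' by (auto simp: L_infty_def intro!: exI[of _ 1])
      moreover have bf: "bounded (range (\<lambda>x. ?f x - ?m))"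
        by (auto simp: bounded_iff indicator_def intro!: exI[of _ "1 + ?m"] order_trans[OF abs_triangle_ineq4])
      ultimately have T: "H_term I BE BS \<eta> None (\<lambda>x. ?f x - ?m) (UNIV :: 's set)"
        unfolding H_term_def using fm by (auto simp: with_trivial_def intro!: bexI[of _ ?f])
      have "h \<in> H_maps I BE BS \<eta>"
        unfolding h_def
        by (rule H_maps_single[OF T], intro borel_measurable_times borel_measurable_diff measurable_compose[OF borel_fst fm])
          auto
      then have h0: "L h = 0" by (rule L_H)
      have bh: "bounded (range h)"
        by (rule bounded_subset[OF bf]) (auto simp: h_def)
      have "L (\<lambda>z. h z + ?m) = L h + L (\<lambda>z. ?m)" by (rule L(1)[OF bh]) simp
      also have "(\<lambda>z. h z + ?m) = (\<lambda>z. ?f (fst z))" by (simp add: h_def)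
      finally show ?thesis using h0 L(4)[OF bcontfun_const[of ?m]] S.prob_space by simp
    qed
    interpret P: plan_functional \<eta> \<nu> L
      by (intro plan_functional.intro assms L L_fst)
    obtain a :: "nat \<Rightarrow> 's" and r where a: "\<And>n. measure \<nu> {y. dist (a n) y = r n} = 0"
      and base: "\<And>y \<epsilon>. \<epsilon> > 0 \<Longrightarrow> \<exists>n. dist (a n) y < r n \<and> r n < \<epsilon>"
      using continuity_ball_base[OF S.finite_measure_axioms borel_probsD(2)[OF assms(7)]] by blast
    interpret Q: plan_kernel \<eta> \<nu> L a r
      by (intro plan_kernel.intro P.plan_functional_axioms P.additive_plan_\<Lambda> ball_base.intro a base)
    have "Q.\<gamma> \<in> causal_plans I BE BS \<eta> \<nu>" by (rule Q.\<gamma>_causal[OF assms(1,2) L_H])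
    then have "primal_value I BE BS c \<eta> \<nu> \<le> enn2ereal (\<integral>\<^sup>+z. e2ennreal (c z) \<partial>Q.\<gamma>)"
      unfolding primal_value_def by (rule INF_lower)
    also have "\<dots> \<le> enn2ereal (ennreal d)"
      using Q.cost_le[OF assms(4,5) L_c] by (simp add: less_eq_ennreal.rep_eq)
    \<comment> \<open>\<open>ennreal\<close> truncates negative numbers to 0, so the sign of
      \<open>d\<close> matters here.\<close>
    also have "\<dots> = ereal d" using pos real by (simp add: enn2ereal_ennreal)
    finally show ?thesis by (simp add: real)
  qed (use pos in auto)
qed

end
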